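(* Let $G$ be either $G^{(m,n)}$ (with $m+n$ odd, and $k:=\frac{m+n+1}{2}$) or $G^{(k)}$ (with $k\ge1$), and let $N=|V(G)|$. Then any two dimer coverings of $G$ can be transformed into each other by a successive application of local moves (square-moves and triangular-moves), using $O(k^2N^{3/2})$ steps.
   Context: Let $\mathcal{G}$ be the graph with vertex set $\mathcal{V}=\mathbb{Z}^2\cup(\mathbb{Z}^2+(\frac12,\frac12))$, two vertices adjacent iff their Euclidean distance is $1$ or $\frac{\sqrt2}{2}$. $\mathcal{V}_1=\{(x,y)\in\mathbb{Z}^2:x-y\text{ even}\}$, $\mathcal{V}_2=\{(x,y)\in\mathbb{Z}^2:x-y\text{ odd}\}$, $\mathcal{V}_3=\mathbb{Z}^2+(\frac12,\frac12)$; $\mathcal{E}_2$ = edges between two points of $\mathbb{Z}^2$, $\mathcal{E}_1$ = edges between $\mathbb{Z}^2$ and $\mathcal{V}_3$. A dimer covering of a finite subgraph $G$ is a perfect matching $M\subset E(G)$; edges of $M$ in $\mathcal{E}_2$ are impurities. $G^{(m,n)}$ is the subgraph of $\mathcal{G}$ induced by $\{(x,y)\in\mathbb{Z}^2:0\le x\le m,0\le y\le n\}\cup\{(x+\frac12,y+\frac12):0\le x\le m-1,0\le y\le n-1\}$; its dimer coverings have $\frac{m+n+1}2$ impurities. $G^{(k)}$: for $v\in\mathcal{V}_1$ let $Q(v)=\{v,v\pm(1,0),v\pm(0,1),v\pm(\frac12,\frac12),v\pm(\frac12,-\frac12)\}$ (basic block); $G^{(k)}$ is the subgraph of $\mathcal{G}$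 induced by a free composition $\bigcup_{v\in B}Q(v)$ of finitely many basic blocks together with $2k-1$ terminals, i.e. vertices of $\mathcal{V}_1\setminus B$ attached to the boundary (each adjacent to exactly one $\mathcal{V}_3$-vertex of the graph), such that every dimer covering has exactly $k$ impurities. Local moves on a dimer covering $M$ of $G$ (all vertices and edges involved lying in $G$): (square-move) if $x,y\in\mathbb{Z}^2$ with $|x-y|=1$ and $z,z'\in\mathcal{V}_3$ are the two centers of unit squares having $xy$ as a side, and $\{x,z\},\{y,z'\}\in M$, replace them by $\{x,z'\},\{y,z\}$; (triangular-move) if $a,c,b$ are three corners of a unit square with center $z$, $c$ adjacent to both $a$ and $b$, and $\{a,c\}\in M$, $\{b,z\}\in M$, replace them by $\{b,c\},\{a,z\}$ (the impurity rotates about $c$).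
   Formalization: Two V3-vertices are never adjacent; the composition of blocks with terminals is assumed connected; each terminal's other neighbours must all be adjacent to its unique V3-neighbour. Without these the claim fails (e.g. a terminal also touching a far corner gives an immovable impurity). *)

theory Defs
  imports "HOL-Analysis.Analysis"
begin

type_synonym point = "real \<times> real"

definition Z2 :: "point set" where
  "Z2 = {(of_int x, of_int y) | x y. True}"

definition V1 :: "point set" where
  "V1 = {(of_int x, of_int y) | x y. even (x - y)}"

definition V3 :: "point set" where
  "V3 = {(of_int x + 1/2, of_int y + 1/2) | x y. True}"

definition near :: "point \<Rightarrow> point \<Rightarrow> bool" where
  "near u v \<longleftrightarrow> dist u v = 1 \<or> dist u v = sqrt 2 / 2"

definition E1 :: "point set set" where
  "E1 = {{u, v} | u v. u \<in> Z2 \<and> v \<in> V3 \<and> near u v}"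

definition E2 :: "point set set" where
  "E2 = {{u, v} | u v. u \<in> Z2 \<and> v \<in> Z2 \<and> near u v}"

text \<open>The edges of the ambient graph are those of \<open>E1 \<union> E2\<close>; two points of \<open>V3\<close> are never
  joined, although they may be at distance 1.  A finite subgraph is given by its vertex set \<open>W\<close>
  and carries all edges inside \<open>W\<close>.\<close>

definition induced_edges :: "point set \<Rightarrow> point set set" where
  "induced_edges W = {e \<in> E1 \<union> E2. e \<subseteq> W}"

definition dimer_covering :: "point set \<Rightarrow> point set set \<Rightarrow> bool" where
  "dimer_covering W M \<longleftrightarrow> M \<subseteq> induced_edges W \<and> (\<forall>v\<in>W. \<exists>!e. e \<in> M \<and> v \<in> e)"

definition impurities :: "point set set \<Rightarrow> point set set" where
  "impurities M = M \<inter> E2"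

definition rect_graph :: "nat \<Rightarrow> nat \<Rightarrow> point set" where
  "rect_graph m n =
     {(real x, real y) | x y. x \<le> m \<and> y \<le> n} \<union>
     {(real x + 1/2, real y + 1/2) | x y. x < m \<and> y < n}"

definition basic_block :: "point \<Rightarrow> point set" where
  "basic_block v =
     {v, v + (1, 0), v - (1, 0), v + (0, 1), v - (0, 1),
      v + (1/2, 1/2), v - (1/2, 1/2), v + (1/2, -1/2), v - (1/2, -1/2)}"

definition connected_graph :: "point set \<Rightarrow> bool" where
  "connected_graph W \<longleftrightarrow>
     (\<forall>u\<in>W. \<forall>v\<in>W. (u, v) \<in> {(a, b). {a, b} \<in> induced_edges W}\<^sup>*)"

text \<open>A terminal touches the rest of the graph only at its unique \<open>V3\<close>-neighbour \<open>z\<close>: all its other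
  neighbours are neighbours of \<open>z\<close>.  Without this, a terminal could also meet the graph at a
  \<open>Z2\<close>-vertex \<open>w\<close> far from \<open>z\<close>, and then no local move applies to an impurity joining the terminal
  to \<open>w\<close>.\<close>

definition attached_terminal :: "point set \<Rightarrow> point \<Rightarrow> bool" where
  "attached_terminal W t \<longleftrightarrow>
     (\<exists>z. {s \<in> V3. {t, s} \<in> induced_edges W} = {z} \<and>
          (\<forall>w. {t, w} \<in> induced_edges W \<longrightarrow> w = z \<or> {w, z} \<in> induced_edges W))"

text \<open>The blocks may be put together in any way that gives a connected graph.  If some dimer covering
  exists, the condition on the number of impurities then says by Euler's formula that the
  union of the blocks has no holes.\<close>

definition block_graph :: "nat \<Rightarrow> point set \<Rightarrow> bool" where
  "block_graph k W \<longleftrightarrow>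
     (\<exists>B T. finite B \<and> B \<subseteq> V1 \<and> finite T \<and> T \<subseteq> V1 - B \<and> card T = 2 * k - 1 \<and>
        W = (\<Union>v\<in>B. basic_block v) \<union> T \<and>
        connected_graph W \<and>
        (\<forall>t\<in>T. attached_terminal W t) \<and>
        (\<forall>M. dimer_covering W M \<longrightarrow> card (impurities M) = k))"

definition square_corners :: "point \<Rightarrow> point set" where
  "square_corners z = {z + (1/2, 1/2), z - (1/2, 1/2), z + (1/2, -1/2), z - (1/2, -1/2)}"

definition square_move :: "point set \<Rightarrow> point set set \<Rightarrow> point set set \<Rightarrow> bool" where
  "square_move W M M' \<longleftrightarrow>
     (\<exists>x y z z'. x \<in> Z2 \<and> y \<in> Z2 \<and> dist x y = 1 \<and> z \<in> V3 \<and> z' \<in> V3 \<and> z \<noteq> z' \<and>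
        {x, y} \<subseteq> square_corners z \<and> {x, y} \<subseteq> square_corners z' \<and>
        {x, z} \<in> M \<and> {y, z'} \<in> M \<and>
        {x, z'} \<in> induced_edges W \<and> {y, z} \<in> induced_edges W \<and>
        M' = (M - {{x, z}, {y, z'}}) \<union> {{x, z'}, {y, z}})"

definition triangular_move :: "point set \<Rightarrow> point set set \<Rightarrow> point set set \<Rightarrow> bool" where
  "triangular_move W M M' \<longleftrightarrow>
     (\<exists>a b c z. z \<in> V3 \<and> {a, b, c} \<subseteq> Z2 \<and> {a, b, c} \<subseteq> square_corners z \<and> a \<noteq> b \<and>
        dist a c = 1 \<and> dist b c = 1 \<and>
        {a, c} \<in> M \<and> {b, z} \<in> M \<and>
        {b, c} \<in> induced_edges W \<and> {a, z} \<in> induced_edges W \<and>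
        M' = (M - {{a, c}, {b, z}}) \<union> {{b, c}, {a, z}})"

definition local_move :: "point set \<Rightarrow> (point set set \<times> point set set) set" where
  "local_move W =
     {(M, M'). dimer_covering W M \<and> (square_move W M M' \<or> triangular_move W M M')}"

end

theory Submission
  imports Defs
begin

text \<open>
  The graph is a plane triangulation: every triangle has one vertex \<open>z\<close> in \<open>V3\<close> (white) and two
  adjacent corners of the square around \<open>z\<close> in \<open>Z2\<close> (black).  Both local moves rotate an
  alternating 4-cycle around two adjacent triangles.  In the admissible regions every set of edges with
  even degrees is the mod 2 boundary of a set of triangles of the region; this follows from Euler's
  formula, since the boundaries of sets of triangles already exhaust all even edge sets.

  First every impurity slides to the border of the region.  Its route is determined by the axes of the
  white vertices, which slides preserve, and a route avoiding the border would sweep a finite set of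
  triangles without boundary.  Then the symmetric difference of the two coverings splits into
  alternating circuits \<open>c\<close>, each bounding a set \<open>D\<close> of triangles, and \<open>c\<close> is rotated by
  shrinking \<open>D\<close>: an impurity slides inside \<open>D\<close>, or an alternating circuit of spokes (edges of
  \<open>E1\<close>) that meets the boundary is cut off.  Such a circuit is found by following alternating paths:
  if they did not close up, the set of vertices reached would be matched into itself by both coverings,
  hence avoid the boundary, and counting its spokes (four at each vertex) gives a contradiction.
  Circuits of spokes are split by the same argument until a single square move remains.

  Rotating \<open>c\<close> costs at most \<open>(k + 1) * card D\<close> moves, and \<open>card D\<close> is at most \<open>4 * N\<close> and, by
  the isoperimetric inequality, at most \<open>4 * (card c)\<^sup>2\<close>.  So \<open>card D \<le> 4 * sqrt N * card c\<close>, and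
  the lengths of the circuits add up to \<open>O(N)\<close>.
\<close>

text \<open>Arguing mod 2 replaces plane topology: the interior of a circuit is the finite set of
  triangles with that boundary, unique because a finite nonempty set of triangles always has a
  boundary. Minimal even sets take the place of simple closed curves.

  The obstacle is an impurity in the interior of \<open>D\<close>. It matches two black vertices, so
  alternating paths no longer respect the colours and the count of spokes breaks down. An impurity
  on the border has a triangle outside the region, hence is interior to no \<open>D\<close>; this is
  why the border comes before the circuits. Absence of holes in \<open>D\<close> is carried along
  because it guarantees that whatever a circuit of edges of \<open>D\<close> encloses lies in
  \<open>D\<close>.

  An impurity on the boundary of \<open>D\<close> can still block, when its slide would leave
  \<open>D\<close>. The slide is made all the same and \<open>D\<close> is deformed with it, keeping
  its number of triangles. At most \<open>k\<close> such slides precede a cut of at least one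
  triangle, which is the origin of the factor \<open>k + 1\<close>. The bound obtained is linear in
  \<open>k\<close>; the square enters by \<open>k \<le> k\<^sup>2\<close>.\<close>

section \<open>The triangulation\<close>

text \<open>\<open>cor z x\<close>: \<open>x\<close> is a corner of the unit square with centre \<open>z\<close>, and \<open>opp z x\<close> is the
  opposite corner; \<open>sq z x y\<close>: \<open>x\<close> and \<open>y\<close> are adjacent corners.\<close>

definition cor :: "point \<Rightarrow> point \<Rightarrow> bool" where
  "cor z x \<longleftrightarrow> z \<in> V3 \<and> \<bar>fst x - fst z\<bar> = 1/2 \<and> \<bar>snd x - snd z\<bar> = 1/2"

definition opp :: "point \<Rightarrow> point \<Rightarrow> point" where
  "opp z x = z + z - x"

definition sq :: "point \<Rightarrow> point \<Rightarrow> point \<Rightarrow> bool" where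
  "sq z x y \<longleftrightarrow> cor z x \<and> cor z y \<and> y \<noteq> x \<and> y \<noteq> opp z x"

definition Tri :: "point set set" where
  "Tri = {{z, x, y} | z x y. sq z x y}"

definition TW :: "point set \<Rightarrow> point set set" where
  "TW W = {t \<in> Tri. t \<subseteq> W}"

text \<open>The simplicial boundary with coefficients mod 2: symmetric difference is addition, and
  \<open>bd\<close> is linear for it.\<close>

definition bd :: "point set set \<Rightarrow> point set set" where
  "bd D = {e \<in> E1 \<union> E2. odd (card {t \<in> D. e \<subseteq> t})}"

lemma white_not_black: "v \<in> V3 \<Longrightarrow> v \<notin> Z2"
proof
  assume "v \<in> V3" "v \<in> Z2"
  then obtain x y :: int where "real_of_int x + 1/2 = of_int y"
    unfolding V3_def Z2_def by force
  then have "real_of_int (2 * x + 1) = of_int (2 * y)" by simp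
  then have "2 * x + 1 = 2 * y" by (simp only: of_int_eq_iff)
  then show False by presburger
qed

lemma abs_half_iff: "\<bar>u - v\<bar> = 1/2 \<longleftrightarrow> u = v + 1/2 \<or> u = v - 1/2" for u v :: real
  by (auto simp: abs_if)

lemma cor_black: "cor z x \<Longrightarrow> x \<in> Z2"
proof -
  assume c: "cor z x"
  then obtain a b :: int where z: "z = (of_int a + 1/2, of_int b + 1/2)"
    unfolding cor_def V3_def by auto
  have "fst x = of_int (a + 1) \<or> fst x = of_int a" "snd x = of_int (b + 1) \<or> snd x = of_int b"
    using c unfolding cor_def z abs_half_iff by auto
  then show ?thesis unfolding Z2_def by (metis (mono_tags, lifting) mem_Collect_eq prod.collapse)
qed

lemma cor_white: "cor z x \<Longrightarrow> z \<in> V3" by (simp add: cor_def)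

lemma black_shift: "\<lbrakk>x \<in> Z2; \<bar>fst x - fst z\<bar> = 1/2; \<bar>snd x - snd z\<bar> = 1/2\<rbrakk> \<Longrightarrow> z \<in> V3"
proof -
  assume x: "x \<in> Z2" and h: "\<bar>fst x - fst z\<bar> = 1/2" "\<bar>snd x - snd z\<bar> = 1/2"
  obtain a b :: int where z: "x = (of_int a, of_int b)"
    using x unfolding Z2_def by auto
  have "fst z = of_int a + 1/2 \<or> fst z = of_int (a - 1) + 1/2"
       "snd z = of_int b + 1/2 \<or> snd z = of_int (b - 1) + 1/2"
    using h unfolding z abs_half_iff by auto
  then show ?thesis unfolding V3_def by (metis (mono_tags, lifting) mem_Collect_eq prod.collapse)
qed

lemma cor_iff: "cor z x \<longleftrightarrow> x \<in> Z2 \<and> \<bar>fst x - fst z\<bar> = 1/2 \<and> \<bar>snd x - snd z\<bar> = 1/2"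
  using black_shift cor_black cor_def by blast

lemma opp_opp [simp]: "opp z (opp z x) = x"
  by (simp add: opp_def)

lemma cor_opp: "cor z (opp z x) \<longleftrightarrow> cor z x"
  by (simp add: cor_def opp_def abs_minus_commute)

lemma opp_neq: "cor z x \<Longrightarrow> opp z x \<noteq> x"
  by (auto simp: cor_def opp_def prod_eq_iff abs_half_iff)

lemma sq_sym: "sq z x y \<Longrightarrow> sq z y x"
  by (auto simp: sq_def)

lemma sq_opp: "sq z x y \<Longrightarrow> sq z (opp z x) y"
  by (auto simp: sq_def cor_opp)

lemma sq_opp2: "sq z x y \<Longrightarrow> sq z x (opp z y)"
  using sq_sym sq_opp by blast

lemma sqD: "sq z x y \<Longrightarrow> cor z x" "sq z x y \<Longrightarrow> cor z y" "sq z x y \<Longrightarrow> x \<noteq> y"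
   "sq z x y \<Longrightarrow> z \<in> V3" "sq z x y \<Longrightarrow> x \<in> Z2" "sq z x y \<Longrightarrow> y \<in> Z2"
  by (auto simp: sq_def cor_white cor_black)

text \<open>The offsets from a centre to its corners. Statements about a single square become finite
  case checks on this set.\<close>

definition diag :: "point set" where
  "diag = {(1/2, 1/2), (1/2, -1/2), (-1/2, 1/2), (-1/2, -1/2)}"

lemma diag_iff: "p \<in> diag \<longleftrightarrow> \<bar>fst p\<bar> = 1/2 \<and> \<bar>snd p\<bar> = 1/2"
  unfolding diag_def using abs_half_iff[of _ 0] by (cases p) auto

lemma cor_diag: "cor z x \<longleftrightarrow> z \<in> V3 \<and> (\<exists>p\<in>diag. x = z + p)"
proof -
  have "(\<exists>p\<in>diag. x = z + p) \<longleftrightarrow> x - z \<in> diag"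
    by (metis add_diff_cancel_left' diff_add_cancel add.commute)
  then show ?thesis by (simp add: cor_def diag_iff)
qed

lemma corE: assumes "cor z x" obtains p where "p \<in> diag" "x = z + p"
  using assms cor_diag by blast

lemma opp_add [simp]: "opp z (z + p) = z + - p"
  by (simp add: opp_def)

lemma diag_perp: "p \<in> diag \<Longrightarrow> r \<in> diag \<Longrightarrow> (r \<noteq> p \<and> r \<noteq> - p) \<longleftrightarrow>
    (fst p = fst r \<and> \<bar>snd p - snd r\<bar> = 1 \<or> snd p = snd r \<and> \<bar>fst p - fst r\<bar> = 1)"
  unfolding diag_def by (elim insertE emptyE) simp_all

lemma diag_four: "p \<in> diag \<Longrightarrow> r \<in> diag \<Longrightarrow> r \<noteq> p \<Longrightarrow> r \<noteq> - p \<Longrightarrow> s \<in> diag \<Longrightarrow>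
    s = p \<or> s = r \<or> s = - p \<or> s = - r"
  unfolding diag_def by (elim insertE emptyE) simp_all

lemma sq_add: "sq z (z + p) (z + r) \<longleftrightarrow> z \<in> V3 \<and> p \<in> diag \<and> r \<in> diag \<and> r \<noteq> p \<and> r \<noteq> - p"
  unfolding sq_def cor_diag by auto

lemma sqE: assumes "sq z x y" obtains p r where "p \<in> diag" "r \<in> diag" "r \<noteq> p" "r \<noteq> - p"
    "x = z + p" "y = z + r" "z \<in> V3"
  using assms unfolding sq_def cor_diag by auto

lemma sq_iff: "sq z x y \<longleftrightarrow> cor z x \<and> cor z y \<and>
    (fst x = fst y \<and> \<bar>snd x - snd y\<bar> = 1 \<or> snd x = snd y \<and> \<bar>fst x - fst y\<bar> = 1)"
proof (cases "cor z x \<and> cor z y")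
  case True
  then obtain p r where p: "p \<in> diag" "x = z + p" "r \<in> diag" "y = z + r" "z \<in> V3"
    using cor_diag by auto
  then show ?thesis using diag_perp[OF p(1,3)] True by (simp add: sq_add)
qed (auto simp: sq_def)

lemma cor_cases: "sq z x y \<Longrightarrow> cor z b \<longleftrightarrow> b = x \<or> b = y \<or> b = opp z x \<or> b = opp z y"
proof
  assume s: "sq z x y" and "cor z b"
  then obtain q where q: "q \<in> diag" "b = z + q" using cor_diag by blast
  from s obtain p r where p: "p \<in> diag" "r \<in> diag" "r \<noteq> p" "r \<noteq> - p"
    "x = z + p" "y = z + r" by (rule sqE)
  show "b = x \<or> b = y \<or> b = opp z x \<or> b = opp z y"
    using diag_four[OF p(1-4) q(1)] p(5,6) q(2) by auto
qed (auto simp: sq_def cor_opp)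

lemma sq_cases: "sq z x y \<Longrightarrow> sq z x b \<longleftrightarrow> b = y \<or> b = opp z y"
  using cor_cases[of z x y b] sq_opp2 sq_def by metis

lemma cor_sq: "cor z x \<Longrightarrow> \<exists>y. sq z x y"
proof -
  assume c: "cor z x"
  then obtain p where p: "p \<in> diag" "x = z + p" "z \<in> V3" using cor_diag by blast
  have "(fst p, - snd p) \<in> diag" "(fst p, - snd p) \<noteq> p" "(fst p, - snd p) \<noteq> - p"
    using p(1) unfolding diag_def by auto
  then have "sq z x (z + (fst p, - snd p))" unfolding p(2) sq_add using p by auto
  then show ?thesis by blast
qed

text \<open>The reflection of \<open>z\<close> in the midpoint of the side \<open>xy\<close>, hence
  the centre of the square across that side.\<close>

definition other :: "point \<Rightarrow> point \<Rightarrow> point \<Rightarrow> point" where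
  "other z x y = x + y - z"

lemma sq_other: "sq z x y \<Longrightarrow> sq (other z x y) x y"
proof -
  assume s: "sq z x y"
  from s obtain p r where p: "p \<in> diag" "r \<in> diag" "r \<noteq> p" "r \<noteq> - p"
    "x = z + p" "y = z + r" "z \<in> V3" by (rule sqE)
  define u where "u = other z x y"
  have x: "x = u + - r" and y: "y = u + - p" unfolding u_def other_def p(5,6) by (simp_all add: algebra_simps)
  have m: "- r \<in> diag" "- p \<in> diag" using p by (auto simp: diag_iff)
  have "cor u x" using cor_black[OF sqD(1)[OF s]] m(1) unfolding cor_iff diag_iff x by auto
  then have "u \<in> V3" by (rule cor_white)
  then have "sq u (u + - r) (u + - p)" unfolding sq_add using m p(3,4) by auto
  then show ?thesis unfolding u_def[symmetric] by (simp only: x[symmetric] y[symmetric])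
qed

lemma other_cases: "sq z x y \<Longrightarrow> sq z' x y \<longleftrightarrow> z' = z \<or> z' = other z x y"
proof
  assume s: "sq z x y" and s': "sq z' x y"
  from s obtain p r where p: "p \<in> diag" "r \<in> diag" "r \<noteq> p" "r \<noteq> - p"
    "x = z + p" "y = z + r" "z \<in> V3" by (rule sqE)
  from s' obtain p' r' where p': "p' \<in> diag" "r' \<in> diag" "r' \<noteq> p'" "r' \<noteq> - p'"
    "x = z' + p'" "y = z' + r'" "z' \<in> V3" by (rule sqE)
  have "p - r = p' - r'" using p(5,6) p'(5,6) by (metis add_diff_cancel_left)
  then have "p' = p \<or> p' = - r"
    using p(1-4) p'(1-4) unfolding diag_def by (elim insertE emptyE) simp_all
  moreover have "z' = z + p - p'" using p(5) p'(5) by (simp add: algebra_simps)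
  ultimately show "z' = z \<or> z' = other z x y" unfolding other_def p(5,6) by (auto simp: algebra_simps)
qed (auto simp: sq_other)

lemma other_neq: "sq z x y \<Longrightarrow> other z x y \<noteq> z"
proof
  assume s: "sq z x y" and o: "other z x y = z"
  from s obtain p r where p: "p \<in> diag" "r \<in> diag" "r \<noteq> p" "r \<noteq> - p"
    "x = z + p" "y = z + r" "z \<in> V3" by (rule sqE)
  have "p + r = 0" using o unfolding other_def p(5,6) by (simp add: algebra_simps)
  then show False using p(4) by (metis add_eq_0_iff)
qed

section \<open>The two kinds of edges in terms of squares\<close>

lemma near_iff: "near u v \<longleftrightarrow> (fst u - fst v)\<^sup>2 + (snd u - snd v)\<^sup>2 = 1 \<or>
     (fst u - fst v)\<^sup>2 + (snd u - snd v)\<^sup>2 = 1/2"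
proof -
  have "sqrt 2 / 2 = sqrt (1/2)" by (simp add: real_sqrt_divide field_simps)
  then show ?thesis
    unfolding near_def dist_prod_def dist_real_def
    by (simp add: real_sqrt_eq_iff)
qed

text \<open>An upper bound on the squared distance is enough, so both admissible lengths are treated
  at once: a half-odd number of absolute value at most 1 is 1/2 or -1/2.\<close>

lemma int_sq_sum_half:
  fixes a b :: int
  assumes "(of_int a + 1/2 :: real)\<^sup>2 + (of_int b + 1/2)\<^sup>2 \<le> 1"
  shows "(a = 0 \<or> a = -1) \<and> (b = 0 \<or> b = -1)"
proof -
  have *: "c = 0 \<or> c = -1" if "(of_int c + 1/2 :: real)\<^sup>2 \<le> 1" for c :: int
  proof -
    have "\<bar>of_int c + 1/2 :: real\<bar> \<le> 1" using that by (simp add: abs_square_le_1)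
    then have "real_of_int c \<le> 1/2" "real_of_int c \<ge> - 3/2" by auto
    then show ?thesis by linarith
  qed
  have "0 \<le> (of_int a + 1/2 :: real)\<^sup>2" "0 \<le> (of_int b + 1/2 :: real)\<^sup>2" by simp_all
  then have "(of_int a + 1/2 :: real)\<^sup>2 \<le> 1" "(of_int b + 1/2 :: real)\<^sup>2 \<le> 1" using assms by linarith+
  then show ?thesis using * by blast
qed

lemma near_spoke: "z \<in> V3 \<Longrightarrow> x \<in> Z2 \<Longrightarrow> near x z \<longleftrightarrow> cor z x"
proof -
  assume z: "z \<in> V3" and x: "x \<in> Z2"
  obtain a b :: int where zz: "z = (of_int a + 1/2, of_int b + 1/2)"
    using z unfolding V3_def by auto
  obtain c d :: int where xx: "x = (of_int c, of_int d)"
    using x unfolding Z2_def by auto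
  have e: "(fst x - fst z)\<^sup>2 + (snd x - snd z)\<^sup>2 = (of_int (a - c) + 1/2 :: real)\<^sup>2 + (of_int (b - d) + 1/2)\<^sup>2"
    unfolding zz xx by (simp add: power2_eq_square algebra_simps)
  show ?thesis
  proof
    assume "near x z"
    then have "(of_int (a - c) + 1/2 :: real)\<^sup>2 + (of_int (b - d) + 1/2)\<^sup>2 \<le> 1"
      unfolding near_iff e by auto
    from int_sq_sum_half[OF this] show "cor z x"
      unfolding cor_def using z by (auto simp: zz xx abs_if algebra_simps)
  next
    assume "cor z x"
    then have "(fst x - fst z)\<^sup>2 = (1/2)\<^sup>2" "(snd x - snd z)\<^sup>2 = (1/2)\<^sup>2"
      unfolding cor_def by (metis power2_abs)+
    then show "near x z" unfolding near_iff by (simp add: power2_eq_square)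
  qed
qed

lemma near_side: "x \<in> Z2 \<Longrightarrow> y \<in> Z2 \<Longrightarrow> near x y \<longleftrightarrow>
   (fst x = fst y \<and> \<bar>snd x - snd y\<bar> = 1 \<or> snd x = snd y \<and> \<bar>fst x - fst y\<bar> = 1)"
proof -
  assume y: "y \<in> Z2" and x: "x \<in> Z2"
  obtain a b :: int where yy: "y = (of_int a, of_int b)"
    using y unfolding Z2_def by auto
  obtain c d :: int where xx: "x = (of_int c, of_int d)"
    using x unfolding Z2_def by auto
  show ?thesis
  proof
    assume n: "near x y"
    define A where "A = c - a"
    define B where "B = d - b"
    have e: "(fst x - fst y)\<^sup>2 + (snd x - snd y)\<^sup>2 = real_of_int (A\<^sup>2 + B\<^sup>2)"
      unfolding yy xx A_def B_def by simp
    have "real_of_int (A\<^sup>2 + B\<^sup>2) = 1 \<or> real_of_int (2 * (A\<^sup>2 + B\<^sup>2)) = 1"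
      using n unfolding near_iff e by auto
    then have "A\<^sup>2 + B\<^sup>2 = 1 \<or> 2 * (A\<^sup>2 + B\<^sup>2) = 1"
      using of_int_eq_1_iff by blast
    \<comment> \<open>The length \<open>sqrt 2 / 2\<close> is excluded by parity: twice an integer
      is never 1.\<close>
    then have s: "A\<^sup>2 + B\<^sup>2 = 1" by presburger
    have "A\<^sup>2 \<le> 1" "B\<^sup>2 \<le> 1" using s zero_le_power2[of A] zero_le_power2[of B] by linarith+
    then have "\<bar>A\<bar> \<le> 1" "\<bar>B\<bar> \<le> 1" by (simp_all add: abs_square_le_1)
    then have "A \<in> {-1,0,1}" "B \<in> {-1,0,1}" by auto
    then have "A = 0 \<and> \<bar>B\<bar> = 1 \<or> B = 0 \<and> \<bar>A\<bar> = 1" using s by auto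
    then show "fst x = fst y \<and> \<bar>snd x - snd y\<bar> = 1 \<or> snd x = snd y \<and> \<bar>fst x - fst y\<bar> = 1"
      unfolding xx yy A_def B_def by (auto simp: abs_if split: if_splits)
  next
    assume "fst x = fst y \<and> \<bar>snd x - snd y\<bar> = 1 \<or> snd x = snd y \<and> \<bar>fst x - fst y\<bar> = 1"
    then have "fst x = fst y \<and> (snd x - snd y)\<^sup>2 = 1 \<or> snd x = snd y \<and> (fst x - fst y)\<^sup>2 = 1"
      by (metis power2_abs one_power2)
    then show "near x y" unfolding near_iff by auto
  qed
qed

lemma E1_eq: "E1 = {{z, x} | z x. cor z x}"
  unfolding E1_def using near_spoke cor_black cor_white by (fastforce simp: insert_commute)

lemma side_sq:
  assumes x: "x \<in> Z2" and y: "y \<in> Z2"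
    and d: "fst x = fst y \<and> \<bar>snd x - snd y\<bar> = 1 \<or> snd x = snd y \<and> \<bar>fst x - fst y\<bar> = 1"
  shows "\<exists>z. sq z x y"
  using d
proof
  assume h: "fst x = fst y \<and> \<bar>snd x - snd y\<bar> = 1"
  define z where "z = (fst x + 1/2, (snd x + snd y) / 2)"
  have "\<bar>snd x - snd z\<bar> = 1/2" "\<bar>snd y - snd z\<bar> = 1/2"
    using h unfolding z_def by (auto simp: abs_if field_simps split: if_splits)
  then have "cor z x" "cor z y" using x y h unfolding cor_iff by (auto simp: z_def)
  then show ?thesis using h sq_iff by blast
next
  assume h: "snd x = snd y \<and> \<bar>fst x - fst y\<bar> = 1"
  define z where "z = ((fst x + fst y) / 2, snd x + 1/2)"
  have "\<bar>fst x - fst z\<bar> = 1/2" "\<bar>fst y - fst z\<bar> = 1/2"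
    using h unfolding z_def by (auto simp: abs_if field_simps split: if_splits)
  then have "cor z x" "cor z y" using x y h unfolding cor_iff by (auto simp: z_def)
  then show ?thesis using h sq_iff by blast
qed

lemma E2_eq: "E2 = {{x, y} | x y. \<exists>z. sq z x y}"
proof -
  have "x \<in> Z2 \<and> y \<in> Z2 \<and> near x y \<longleftrightarrow> (\<exists>z. sq z x y)" for x y
  proof
    assume "x \<in> Z2 \<and> y \<in> Z2 \<and> near x y"
    then show "\<exists>z. sq z x y" using near_side[of x y] side_sq[of x y] by blast
  next
    assume "\<exists>z. sq z x y"
    then obtain z where z: "sq z x y" ..
    then have "x \<in> Z2" "y \<in> Z2" by (auto dest: sqD)
    moreover from this have "near x y" using z unfolding sq_iff by (simp add: near_side)
    ultimately show "x \<in> Z2 \<and> y \<in> Z2 \<and> near x y" by blast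
  qed
  then show ?thesis unfolding E2_def by auto
qed

declare split_paired_All [simp del] split_paired_Ex [simp del]
  \<comment> \<open>from now on points are atoms\<close>

lemma TriI: "sq z x y \<Longrightarrow> {z, x, y} \<in> Tri" unfolding Tri_def by blast

lemma TriE: assumes "t \<in> Tri" obtains z x y where "t = {z, x, y}" "sq z x y"
  using assms unfolding Tri_def by blast

lemma E1I: "cor z x \<Longrightarrow> {z, x} \<in> E1" unfolding E1_eq by blast

lemma E1E: assumes "e \<in> E1" obtains z x where "e = {z, x}" "cor z x"
  using assms unfolding E1_eq by blast

lemma E2I: "sq z x y \<Longrightarrow> {x, y} \<in> E2" unfolding E2_eq by blast

lemma E2E: assumes "e \<in> E2" obtains z x y where "e = {x, y}" "sq z x y"
  using assms unfolding E2_eq by blast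

lemma E1_E2_disjoint: "e \<in> E1 \<Longrightarrow> e \<notin> E2"
proof
  assume "e \<in> E1" "e \<in> E2"
  then obtain z x y u v where "e = {z,x}" "z \<in> V3" "e = {u,v}" "u \<in> Z2" "v \<in> Z2"
    by (metis E1E E2E cor_white sqD(5) sqD(6))
  then have "z = u \<or> z = v" by auto
  then show False using white_not_black \<open>z \<in> V3\<close> \<open>u \<in> Z2\<close> \<open>v \<in> Z2\<close> by metis
qed

lemma white_E1: "{z, x} \<in> E1 \<Longrightarrow> z \<in> V3 \<Longrightarrow> cor z x"
  by (metis E1E cor_black doubleton_eq_iff white_not_black)

lemma black_E1: "{z, x} \<in> E1 \<Longrightarrow> z \<in> Z2 \<Longrightarrow> cor x z"
  by (metis E1E cor_white doubleton_eq_iff white_not_black)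

lemma E1_colours: "{z, x} \<in> E1 \<Longrightarrow> z \<in> V3 \<and> x \<in> Z2 \<or> z \<in> Z2 \<and> x \<in> V3"
  by (metis E1E cor_black cor_white doubleton_eq_iff)

lemma white_edge: "{z, x} \<in> E1 \<union> E2 \<Longrightarrow> z \<in> V3 \<Longrightarrow> cor z x"
  using white_E1 E2E white_not_black sqD by (metis Un_iff doubleton_eq_iff)

lemma edge_card: "e \<in> E1 \<union> E2 \<Longrightarrow> \<exists>u v. u \<noteq> v \<and> e = {u, v}"
proof -
  assume "e \<in> E1 \<union> E2"
  then show ?thesis
  proof
    assume "e \<in> E1"
    then obtain z x where "e = {z,x}" "cor z x" by (rule E1E)
    then show ?thesis using cor_black cor_white white_not_black by metis
  next
    assume "e \<in> E2"
    then obtain z x y where "e = {x,y}" "sq z x y" by (rule E2E)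
    then show ?thesis using sqD(3) by metis
  qed
qed

lemma E2_black: "e \<in> E2 \<Longrightarrow> v \<in> e \<Longrightarrow> v \<in> Z2"
  by (metis E2E insert_iff singletonD sqD(5) sqD(6))

lemma tri_eq: "sq z x y \<Longrightarrow> sq z' x' y' \<Longrightarrow> {z,x,y} = {z',x',y'} \<longleftrightarrow> z = z' \<and> {x,y} = {x',y'}"
proof
  assume s: "sq z x y" "sq z' x' y'" and e: "{z,x,y} = {z',x',y'}"
  have w: "z \<in> V3" "z' \<in> V3" "x \<notin> V3" "y \<notin> V3" "x' \<notin> V3" "y' \<notin> V3"
    using s sqD white_not_black by blast+
  then have "z = z'" using e by auto
  then show "z = z' \<and> {x,y} = {x',y'}" using e w by auto
qed auto

section \<open>The two triangles at an edge\<close>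

lemma spoke_tri: assumes s: "sq z x y" shows "{t \<in> Tri. {z, x} \<subseteq> t} = {{z, x, y}, {z, x, opp z y}}"
proof -
  have "t = {z,x,y} \<or> t = {z,x,opp z y}" if "t \<in> Tri" "{z,x} \<subseteq> t" for t
  proof -
    obtain z' u v where t: "t = {z',u,v}" "sq z' u v" using \<open>t \<in> Tri\<close> by (rule TriE)
    have w: "z \<in> V3" "z' \<in> V3" "u \<notin> V3" "v \<notin> V3" "x \<notin> V3" using s t sqD white_not_black by blast+
    then have z: "z' = z" using that(2) t(1) by auto
    then have "x = u \<or> x = v" using that(2) t(1) w by auto
    then have "(sq z x v \<and> t = {z,x,v}) \<or> (sq z x u \<and> t = {z,x,u})"
      using t z sq_sym[of z' u v] by (elim disjE) (simp_all add: insert_commute)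
    then have "\<exists>b. sq z x b \<and> t = {z,x,b}" by (elim disjE) (rule exI, assumption)+
    then show ?thesis using sq_cases[OF s] by metis
  qed
  note * = this
  show ?thesis
  proof (intro equalityI subsetI)
    fix t assume "t \<in> {t \<in> Tri. {z,x} \<subseteq> t}"
    then show "t \<in> {{z,x,y}, {z,x,opp z y}}" using * by simp
  next
    fix t assume "t \<in> {{z,x,y}, {z,x,opp z y}}"
    then show "t \<in> {t \<in> Tri. {z,x} \<subseteq> t}"
      using TriI[OF s] TriI[OF sq_opp2[OF s]] by (elim insertE emptyE) simp_all
  qed
qed

lemma side_tri: assumes s: "sq z x y" shows "{t \<in> Tri. {x, y} \<subseteq> t} = {{z, x, y}, {other z x y, x, y}}"
proof -
  have "t = {z,x,y} \<or> t = {other z x y,x,y}" if "t \<in> Tri" "{x,y} \<subseteq> t" for t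
  proof -
    obtain z' u v where t: "t = {z',u,v}" "sq z' u v" using \<open>t \<in> Tri\<close> by (rule TriE)
    have w: "z' \<in> V3" "x \<notin> V3" "y \<notin> V3" "x \<noteq> y" using s t sqD white_not_black by blast+
    then have "{x,y} = {u,v}" using that(2) t(1) by auto
    then have "sq z' x y" "t = {z',x,y}" using t sq_sym[of z' u v] by (auto simp: doubleton_eq_iff)
    then show ?thesis using other_cases[OF s] by metis
  qed
  note * = this
  show ?thesis
  proof (intro equalityI subsetI)
    fix t assume "t \<in> {t \<in> Tri. {x,y} \<subseteq> t}"
    then show "t \<in> {{z,x,y}, {other z x y,x,y}}" using * by simp
  next
    fix t assume "t \<in> {{z,x,y}, {other z x y,x,y}}"
    then show "t \<in> {t \<in> Tri. {x,y} \<subseteq> t}"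
      using TriI[OF s] TriI[OF sq_other[OF s]] by (elim insertE emptyE) simp_all
  qed
qed

lemma spoke_tri_neq: "sq z x y \<Longrightarrow> {z, x, y} \<noteq> {z, x, opp z y}"
proof -
  assume s: "sq z x y"
  then show ?thesis using tri_eq[OF s sq_opp2[OF s]] opp_neq[OF sqD(2)[OF s]]
    by (auto simp: doubleton_eq_iff)
qed

lemma side_tri_neq: "sq z x y \<Longrightarrow> {z, x, y} \<noteq> {other z x y, x, y}"
  by (metis tri_eq sq_other other_neq)

text \<open>Triangles are taken in the whole plane and not in a region, so an edge on the border of
  a region also has two of them. The parity in \<open>bd\<close> then means that exactly one of the
  two is chosen.\<close>

lemma edge_triangles: "e \<in> E1 \<union> E2 \<Longrightarrow> \<exists>t1 t2. t1 \<noteq> t2 \<and> {t \<in> Tri. e \<subseteq> t} = {t1, t2}"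
proof -
  assume "e \<in> E1 \<union> E2"
  then show ?thesis
  proof
    assume "e \<in> E1"
    then obtain z x where e: "e = {z,x}" "cor z x" by (rule E1E)
    obtain y where s: "sq z x y" using cor_sq e by blast
    show ?thesis unfolding e by (rule exI, rule exI, rule conjI[OF spoke_tri_neq[OF s] spoke_tri[OF s]])
  next
    assume "e \<in> E2"
    then obtain z x y where e: "e = {x,y}" and s: "sq z x y" by (rule E2E)
    show ?thesis unfolding e by (rule exI, rule exI, rule conjI[OF side_tri_neq[OF s] side_tri[OF s]])
  qed
qed

lemma bd_iff:
  assumes "D \<subseteq> Tri" "e \<in> E1 \<union> E2" "{t \<in> Tri. e \<subseteq> t} = {t1, t2}" "t1 \<noteq> t2"
  shows "e \<in> bd D \<longleftrightarrow> (t1 \<in> D) \<noteq> (t2 \<in> D)"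
proof -
  have "{t \<in> D. e \<subseteq> t} = {t1, t2} \<inter> D" using assms(1,3) by blast
  then have "card {t \<in> D. e \<subseteq> t} = card ({t1, t2} \<inter> D)" by (rule arg_cong)
  then have "odd (card {t \<in> D. e \<subseteq> t}) \<longleftrightarrow> (t1 \<in> D) \<noteq> (t2 \<in> D)"
    using assms(4) by (simp add: Int_insert_left)
  then show ?thesis unfolding bd_def using assms(2) by simp
qed

lemma bd_spoke: "D \<subseteq> Tri \<Longrightarrow> sq z x y \<Longrightarrow> {z, x} \<in> bd D \<longleftrightarrow> ({z,x,y} \<in> D) \<noteq> ({z,x,opp z y} \<in> D)"
  using bd_iff[OF _ _ spoke_tri spoke_tri_neq] E1I sqD(1) by blast

lemma bd_side: "D \<subseteq> Tri \<Longrightarrow> sq z x y \<Longrightarrow> {x, y} \<in> bd D \<longleftrightarrow> ({z,x,y} \<in> D) \<noteq> ({other z x y,x,y} \<in> D)"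
  using bd_iff[OF _ _ side_tri side_tri_neq] E2I by blast

lemma bd_edges: "bd D \<subseteq> E1 \<union> E2" unfolding bd_def by blast

lemma bd_sym_diff: "A \<subseteq> Tri \<Longrightarrow> B \<subseteq> Tri \<Longrightarrow> bd (sym_diff A B) = sym_diff (bd A) (bd B)"
proof -
  assume A: "A \<subseteq> Tri" and B: "B \<subseteq> Tri"
  then have AB: "sym_diff A B \<subseteq> Tri" by blast
  show ?thesis
  proof (rule set_eqI)
    fix e
    show "e \<in> bd (sym_diff A B) \<longleftrightarrow> e \<in> sym_diff (bd A) (bd B)"
    proof (cases "e \<in> E1 \<union> E2")
      case True
      then obtain t1 t2 where t: "t1 \<noteq> t2" "{t \<in> Tri. e \<subseteq> t} = {t1, t2}"
        using edge_triangles[OF True] by (elim exE conjE) (rule that)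
      note i = bd_iff[OF _ True t(2,1)]
      show ?thesis using i[OF A] i[OF B] i[OF AB] by blast
    next
      case False
      then show ?thesis using bd_edges by blast
    qed
  qed
qed

lemma bd_Diff: "A \<subseteq> Tri \<Longrightarrow> B \<subseteq> A \<Longrightarrow> bd (A - B) = sym_diff (bd A) (bd B)"
proof -
  assume "A \<subseteq> Tri" "B \<subseteq> A"
  moreover from this have "A - B = sym_diff A B" by blast
  ultimately show ?thesis using bd_sym_diff[of A B] by (metis subset_trans)
qed

lemma bd_empty [simp]: "bd {} = {}" unfolding bd_def by simp

lemma bd_edge_tri: assumes "e \<in> bd D" shows "\<exists>t\<in>D. e \<subseteq> t"
proof (rule ccontr)
  assume "\<not> ?thesis"
  then have "{t \<in> D. e \<subseteq> t} = {}" by blast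
  then have "card {t \<in> D. e \<subseteq> t} = 0" by (simp only: card.empty)
  then show False using assms unfolding bd_def by simp
qed

section \<open>Triangles around a vertex\<close>

lemma white_tri:
  assumes z: "z \<in> V3" and t: "t \<in> Tri" "z \<in> t" obtains x y where "t = {z,x,y}" "sq z x y"
proof -
  obtain w x y where "t = {w,x,y}" "sq w x y" using t(1) by (rule TriE)
  moreover from this have "w = z" using t(2) z white_not_black sqD by blast
  ultimately show ?thesis using that by blast
qed

lemma white_tris:
  assumes s: "sq z x y" and t: "t \<in> Tri" "z \<in> t"
  shows "t \<in> {{z,x,y},{z,x,opp z y},{z,opp z x,y},{z,opp z x,opp z y}}"
proof -
  obtain u v where uv: "t = {z,u,v}" "sq z u v" using white_tri[OF sqD(4)[OF s] t] by blast
  have "u = x \<or> u = y \<or> u = opp z x \<or> u = opp z y" "v = x \<or> v = y \<or> v = opp z x \<or> v = opp z y"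
    using cor_cases[OF s] uv(2) sqD by blast+
  then have "{u,v} \<in> {{x,y},{x,opp z y},{opp z x,y},{opp z x,opp z y}}"
    using uv(2) unfolding sq_def by (elim disjE) (simp_all add: insert_commute)
  then show ?thesis unfolding uv(1) by (elim insertE emptyE) simp_all
qed

lemma link_white:
  assumes D: "D \<subseteq> Tri" and z: "z \<in> V3" and nb: "\<And>e. e \<in> bd D \<Longrightarrow> z \<notin> e"
    and t: "t \<in> D" "z \<in> t" and t': "t' \<in> Tri" "z \<in> t'"
  shows "t' \<in> D"
proof -
  obtain x y where xy: "t = {z,x,y}" "sq z x y" using white_tri[OF z _ t(2)] t D by blast
  have step: "{z,a,b} \<in> D \<longleftrightarrow> {z,a,opp z b} \<in> D" if "sq z a b" for a b
    using bd_spoke[OF D that] nb by blast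
  have a: "{z,x,opp z y} \<in> D" using step[OF xy(2)] t xy by blast
  have b: "{z,opp z x, y} \<in> D" using step[OF sq_sym[OF xy(2)]] t xy by (metis insert_commute)
  have c: "{z,opp z x, opp z y} \<in> D" using step[OF sq_opp[OF xy(2)]] b by blast
  show ?thesis using white_tris[OF xy(2) t'] a b c t(1) unfolding xy(1) by (elim insertE emptyE) simp_all
qed

text \<open>Eight triangles surround a black vertex, two for each of its four squares. The walk
  alternates between crossing a spoke inside a square and crossing a side into the next square;
  \<open>z1\<close> to \<open>z4\<close> are the four squares, the one diagonally opposite to
  \<open>z\<close> being reached through \<open>o1\<close>.\<close>

lemma link_black:
  assumes D: "D \<subseteq> Tri" and b: "b \<in> Z2" and nb: "\<And>e. e \<in> bd D \<Longrightarrow> b \<notin> e"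
    and t: "t \<in> D" "b \<in> t" and t': "t' \<in> Tri" "b \<in> t'"
  shows "t' \<in> D"
proof -
  have get: "\<exists>z y. s = {z,b,y} \<and> sq z b y" if "s \<in> Tri" "b \<in> s" for s
  proof -
    obtain w x y where s: "s = {w,x,y}" "sq w x y" using \<open>s \<in> Tri\<close> by (rule TriE)
    then have "w \<noteq> b" using b white_not_black sqD by blast
    then have "b = x \<or> b = y" using s that(2) by auto
    then show ?thesis
    proof
      assume "b = y"
      then have "s = {w,b,x} \<and> sq w b x" using s sq_sym by (simp add: insert_commute)
      then show ?thesis by blast
    qed (use s in blast)
  qed
  obtain z y where zy: "t = {z,b,y}" "sq z b y" using get t D by blast
  obtain w v where wv: "t' = {w,b,v}" "sq w b v" using get t' by blast
  have sp: "{w,b,v} \<in> D \<longleftrightarrow> {w,b,opp w v} \<in> D" if "sq w b v" for w v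
    using bd_spoke[OF D that] nb by blast
  have si: "{w,b,v} \<in> D \<longleftrightarrow> {other w b v,b,v} \<in> D" if "sq w b v" for w v
    using bd_side[OF D that] nb by blast
  have all: "\<forall>v. sq w b v \<longrightarrow> {w,b,v} \<in> D" if "{w,b,v} \<in> D" "sq w b v" for w v
    using sp[OF that(2)] that sq_cases[OF that(2)] by metis
  have z1: "\<forall>v. sq z b v \<longrightarrow> {z,b,v} \<in> D" using all t zy by blast
  have z2: "\<forall>v. sq (other z b y) b v \<longrightarrow> {other z b y,b,v} \<in> D"
    using all[OF _ sq_other[OF zy(2)]] si[OF zy(2)] t zy by blast
  have z3: "\<forall>v. sq (other z b (opp z y)) b v \<longrightarrow> {other z b (opp z y),b,v} \<in> D"
    using all[OF _ sq_other[OF sq_opp2[OF zy(2)]]] si[OF sq_opp2[OF zy(2)]] z1 sq_opp2[OF zy(2)] by blast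
  define o1 where "o1 = other z b y"
  have s1: "sq o1 b (opp o1 y)" unfolding o1_def using sq_opp2[OF sq_other[OF zy(2)]] .
  have z4: "\<forall>v. sq (other o1 b (opp o1 y)) b v \<longrightarrow> {other o1 b (opp o1 y),b,v} \<in> D"
    using all[OF _ sq_other[OF s1]] si[OF s1] z2 s1 unfolding o1_def by blast
  from zy(2) obtain p r where p: "p \<in> diag" "r \<in> diag" "r \<noteq> p" "r \<noteq> - p" "b = z + p" "y = z + r" by (rule sqE)
  have "cor w b" using wv(2) sqD by blast
  then obtain q where q: "q \<in> diag" "b = w + q" by (rule corE)
  have "q = p \<or> q = r \<or> q = - p \<or> q = - r" using diag_four[OF p(1-4) q(1)] .
  moreover have w: "w = z + p - q" using q(2) p(5) by (simp add: algebra_simps)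
  ultimately have "w = z \<or> w = other z b (opp z y) \<or> w = other o1 b (opp o1 y) \<or> w = other z b y"
    unfolding o1_def other_def opp_def p(5,6) by (auto simp: algebra_simps)
  then show ?thesis using z1 z2 z3 z4 wv by blast
qed

lemma Tri_vertex: "t \<in> Tri \<Longrightarrow> v \<in> t \<Longrightarrow> v \<in> V3 \<or> v \<in> Z2"
  by (metis TriE insert_iff singletonD sqD(4-6))

text \<open>The triangles at a vertex form a single cycle in which neighbours share an edge. A
  vertex off the boundary is therefore either surrounded by \<open>D\<close> or untouched by
  it.\<close>

lemma link:
  assumes "D \<subseteq> Tri" "\<And>e. e \<in> bd D \<Longrightarrow> v \<notin> e" "t \<in> D" "v \<in> t" "t' \<in> Tri" "v \<in> t'"
  shows "t' \<in> D"
  using Tri_vertex[of t v] link_white[of D v t t'] link_black[of D v t t'] assms by blast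

lemma cor_E1_card: "z \<in> V3 \<Longrightarrow> card {x. cor z x} = 4"
proof -
  assume "z \<in> V3"
  then have "{x. cor z x} = (\<lambda>p. z + p) ` diag" using cor_diag by auto
  moreover have "card diag = 4" unfolding diag_def by simp
  ultimately show ?thesis by (simp add: card_image)
qed

lemma white_card: "b \<in> Z2 \<Longrightarrow> card {z. cor z b} = 4"
proof -
  assume b: "b \<in> Z2"
  have "{z. cor z b} = (\<lambda>p. b - p) ` diag"
  proof (rule set_eqI)
    fix z
    have "z \<in> (\<lambda>p. b - p) ` diag \<longleftrightarrow> b - z \<in> diag" by force
    then show "z \<in> {z. cor z b} \<longleftrightarrow> z \<in> (\<lambda>p. b - p) ` diag" using b by (simp add: cor_iff diag_iff)
  qed
  moreover have "card diag = 4" unfolding diag_def by simp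
  moreover have "inj_on (\<lambda>p. b - p) diag" by (auto simp: inj_on_def)
  ultimately show ?thesis by (simp add: card_image)
qed

lemma spoke_nbrs_card: "v \<in> V3 \<union> Z2 \<Longrightarrow> card {u. {v, u} \<in> E1} = 4"
proof -
  assume "v \<in> V3 \<union> Z2"
  then show ?thesis
  proof
    assume v: "v \<in> V3"
    then have "{u. {v, u} \<in> E1} = {u. cor v u}" using white_E1 E1I by blast
    then show ?thesis using cor_E1_card v by simp
  next
    assume v: "v \<in> Z2"
    then have "{u. {v, u} \<in> E1} = {u. cor u v}" using black_E1 E1I by (metis insert_commute)
    then show ?thesis using white_card v by simp
  qed
qed

lemma edge_in_tri: assumes "t \<in> Tri" "e \<in> E1 \<union> E2" "e \<subseteq> t" "t = {z,x,y}" "sq z x y"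
  shows "e = {z,x} \<or> e = {z,y} \<or> e = {x,y}"
proof -
  obtain u v where e: "u \<noteq> v" "e = {u, v}" using edge_card[OF assms(2)] by (elim exE conjE) (rule that)
  then have "u = z \<or> u = x \<or> u = y" "v = z \<or> v = x \<or> v = y" using assms(3,4) by simp_all
  then show ?thesis using e by (elim disjE) (simp_all add: insert_commute)
qed

lemma tri_edges: "sq z x y \<Longrightarrow> {z,x} \<in> E1" "sq z x y \<Longrightarrow> {z,y} \<in> E1" "sq z x y \<Longrightarrow> {x,y} \<in> E2"
  using E1I E2I sqD by blast+

lemma bd_single: assumes s: "sq z x y" shows "bd {{z,x,y}} = {{z,x},{z,y},{x,y}}"
proof -
  have "e \<in> bd {{z,x,y}} \<longleftrightarrow> e \<in> E1 \<union> E2 \<and> e \<subseteq> {z,x,y}" for e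
  proof -
    have "{t \<in> {{z,x,y}}. e \<subseteq> t} = (if e \<subseteq> {z,x,y} then {{z,x,y}} else {})" by auto
    then show ?thesis unfolding bd_def by auto
  qed
  then show ?thesis using edge_in_tri[OF TriI[OF s] _ _ refl s] tri_edges[OF s] by blast
qed

section \<open>Even edge sets and areas\<close>

lemma even_card_sym_diff:
  assumes "finite A" "finite B"
  shows "even (card (sym_diff A B)) \<longleftrightarrow> (even (card A) \<longleftrightarrow> even (card B))"
proof -
  have "card (sym_diff A B) = card (A - B) + card (B - A)"
    by (rule card_Un_disjoint) (use assms in auto)
  moreover have "card A = card (A - B) + card (A \<inter> B)"
    by (metis Int_Diff_Un Int_Diff_disjoint add.commute assms(1) card_Un_disjoint finite_Diff finite_Int)
  moreover have "card B = card (B - A) + card (A \<inter> B)"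
    by (metis Int_Diff_Un Int_Diff_disjoint Int_commute add.commute assms(2) card_Un_disjoint finite_Diff finite_Int)
  ultimately show ?thesis by (simp only: even_add) blast
qed

definition even_set :: "point set set \<Rightarrow> bool" where
  "even_set X \<longleftrightarrow> finite X \<and> (\<forall>v. even (card {e \<in> X. v \<in> e}))"

lemma even_set_sym_diff: "even_set X \<Longrightarrow> even_set Y \<Longrightarrow> even_set (sym_diff X Y)"
proof -
  assume X: "even_set X" and Y: "even_set Y"
  have "even (card {e \<in> sym_diff X Y. v \<in> e})" for v
  proof -
    have "{e \<in> sym_diff X Y. v \<in> e} = sym_diff {e \<in> X. v \<in> e} {e \<in> Y. v \<in> e}" by auto
    then show ?thesis using X Y unfolding even_set_def by (simp add: even_card_sym_diff)
  qed
  then show ?thesis using X Y unfolding even_set_def by auto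
qed

lemma even_set_empty [simp]: "even_set {}" unfolding even_set_def by simp

lemma even_set_Diff: "even_set X \<Longrightarrow> even_set Y \<Longrightarrow> Y \<subseteq> X \<Longrightarrow> even_set (X - Y)"
  using even_set_sym_diff[of X Y] by (simp add: Un_absorb2 Diff_eq_empty_iff[THEN iffD2])

text \<open>A minimal nonzero element of the cycle space mod 2. No cyclic order of the edges is ever
  needed, only this minimality.\<close>

definition circuit :: "point set set \<Rightarrow> bool" where
  "circuit c \<longleftrightarrow> even_set c \<and> c \<noteq> {} \<and> (\<forall>X\<subseteq>c. even_set X \<longrightarrow> X = {} \<or> X = c)"

text \<open>Take a minimal even subset containing \<open>f\<close>. If \<open>X\<close> is an even
  part of it, then \<open>f\<close> lies in \<open>X\<close> or in its complement, which is even as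
  well, and minimality applies to whichever contains \<open>f\<close>.\<close>

lemma circuit_through:
  assumes "even_set c" "f \<in> c" shows "\<exists>c'\<subseteq>c. circuit c' \<and> f \<in> c'"
proof -
  define S where "S = {X. X \<subseteq> c \<and> even_set X \<and> f \<in> X}"
  have "finite S" using assms(1) unfolding S_def even_set_def by simp
  moreover have "S \<noteq> {}" using assms unfolding S_def by blast
  ultimately obtain m where m: "m \<in> S" "\<forall>X\<in>S. X \<subseteq> m \<longrightarrow> m = X"
    using finite_has_minimal[of S] by blast
  have "X = {} \<or> X = m" if X: "X \<subseteq> m" "even_set X" for X
  proof (cases "f \<in> X")
    case True
    then show ?thesis using m X unfolding S_def by blast
  next
    case False
    then have "m - X \<in> S" using m(1) X even_set_Diff unfolding S_def by blast
    then have "m = m - X" using m(2) by blast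
    then show ?thesis using X(1) by blast
  qed
  then show ?thesis using m(1) unfolding S_def circuit_def by blast
qed

lemma Tri_finite: "t \<in> Tri \<Longrightarrow> finite t" by (erule TriE) simp

lemma bd_finite: "finite D \<Longrightarrow> D \<subseteq> Tri \<Longrightarrow> finite (bd D)"
proof -
  assume f: "finite D" "D \<subseteq> Tri"
  have "bd D \<subseteq> (\<Union>t\<in>D. Pow t)" using bd_edge_tri by blast
  moreover have "finite (\<Union>t\<in>D. Pow t)" using f Tri_finite by blast
  ultimately show ?thesis by (rule finite_subset)
qed

lemma even_set_triangle: "x \<noteq> y \<Longrightarrow> z \<noteq> x \<Longrightarrow> z \<noteq> y \<Longrightarrow> even_set {{z,x},{z,y},{x,y}}"
proof -
  assume h: "x \<noteq> y" "z \<noteq> x" "z \<noteq> y"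
  then have d: "{z,x} \<noteq> {z,y}" "{z,x} \<noteq> {x,y}" "{z,y} \<noteq> {x,y}" by (auto simp: doubleton_eq_iff)
  have "even (card {e \<in> {{z,x},{z,y},{x,y}}. v \<in> e})" for v
  proof -
    have "{e \<in> {{z,x},{z,y},{x,y}}. v \<in> e} =
       (if v = z then {{z,x},{z,y}} else if v = x then {{z,x},{x,y}} else if v = y then {{z,y},{x,y}} else {})"
      using h by auto
    then show ?thesis using d by auto
  qed
  then show ?thesis unfolding even_set_def by simp
qed

lemma bd_even_set: "finite D \<Longrightarrow> D \<subseteq> Tri \<Longrightarrow> even_set (bd D)"
proof (induction rule: finite_induct)
  case (insert t D)
  obtain z x y where t: "t = {z,x,y}" "sq z x y" using insert.prems by (meson TriE insert_subset)
  have "z \<noteq> x" "z \<noteq> y" "x \<noteq> y" using sqD[OF t(2)] white_not_black by blast+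
  then have "even_set (bd {t})" unfolding t(1) bd_single[OF t(2)] using even_set_triangle by blast
  moreover have "insert t D = sym_diff {t} D" using insert.hyps by auto
  moreover have "bd (sym_diff {t} D) = sym_diff (bd {t}) (bd D)"
    by (rule bd_sym_diff) (use insert.prems in auto)
  ultimately show ?case using even_set_sym_diff insert by simp
qed simp

section \<open>Uniqueness of fillings and the isoperimetric inequality\<close>

definition whites :: "point set set \<Rightarrow> point set" where
  "whites D = {z \<in> V3. \<exists>t\<in>D. z \<in> t}"

lemma whites_finite: "finite D \<Longrightarrow> D \<subseteq> Tri \<Longrightarrow> finite (whites D)"
proof -
  assume f: "finite D" "D \<subseteq> Tri"
  have "whites D \<subseteq> \<Union>D" unfolding whites_def by blast
  moreover have "finite (\<Union>D)" using f Tri_finite by blast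
  ultimately show ?thesis by (rule finite_subset)
qed

lemma whites_nonempty: "D \<subseteq> Tri \<Longrightarrow> t \<in> D \<Longrightarrow> \<exists>z. z \<in> t \<and> z \<in> whites D"
  unfolding whites_def by (smt (verit) TriE insertI1 mem_Collect_eq sqD(4) subsetD)

text \<open>For \<open>d\<close> half a coordinate unit vector, \<open>(snd d, fst d)\<close> is
  perpendicular to \<open>d\<close>, so this is the side of the square around \<open>z\<close>
  facing in direction \<open>d\<close>.\<close>

definition side_of :: "point \<Rightarrow> point \<Rightarrow> point set" where
  "side_of z d = {z + (d + (snd d, fst d)), z + (d - (snd d, fst d))}"

text \<open>Moving in the direction \<open>d\<close>, every line of whites of \<open>D\<close> has to leave \<open>D\<close>.\<close>

lemma leave_edge:
  assumes D: "finite D" "D \<subseteq> Tri" and d: "d = (1/2, 0) \<or> d = (0, 1/2)"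
    and z0: "z0 \<in> whites D"
  shows "\<exists>z\<in>V3. snd d * fst z0 = snd d * fst z \<and> fst d * snd z0 = fst d * snd z \<and>
     (side_of z d \<in> bd D \<or> (\<exists>x. {z,x} \<in> bd D))"
proof (rule ccontr)
  assume no: "\<not> ?thesis"
  define S where "S = {z \<in> whites D. snd d * fst z0 = snd d * fst z \<and> fst d * snd z0 = fst d * snd z}"
  have S: "finite S" "z0 \<in> S" unfolding S_def using whites_finite[OF D] z0 by auto
  \<comment> \<open>On a single line the sum of the coordinates measures the position, and crossing
    a side in direction \<open>d\<close> raises it by 1. A vertex where it is maximal cannot be
    followed by another one.\<close>
  define m where "m = Max ((\<lambda>z. fst z + snd z) ` S)"
  have "m \<in> (\<lambda>z. fst z + snd z) ` S" unfolding m_def using S by (intro Max_in) auto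
  then obtain z where z: "z \<in> S" "fst z + snd z = m" by auto
  have zz: "z \<in> V3" "snd d * fst z0 = snd d * fst z" "fst d * snd z0 = fst d * snd z"
    using z unfolding S_def whites_def by auto
  have nb: "z \<notin> e" if e: "e \<in> bd D" for e
  proof
    assume "z \<in> e"
    then obtain x where x: "e = {z,x}" using edge_card[of e] bd_edges e by blast
    then show False using no zz e by blast
  qed
  define p where "p = d + (snd d, fst d)"
  define r where "r = d - (snd d, fst d)"
  have pr: "p \<in> diag" "r \<in> diag" "r \<noteq> p" "r \<noteq> - p" using d unfolding p_def r_def diag_def by auto
  have s: "sq z (z + p) (z + r)" unfolding sq_add using pr zz(1) by blast
  obtain t where t: "t \<in> D" "z \<in> t" using z unfolding S_def whites_def by auto
  have t1: "{z, z + p, z + r} \<in> D" using link_white[OF D(2) zz(1) nb t TriI[OF s]] by blast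
  have so: "side_of z d \<notin> bd D" using no zz by blast
  then have "{z + p, z + r} \<notin> bd D" unfolding side_of_def p_def r_def by simp
  then have t2: "{other z (z+p) (z+r), z + p, z + r} \<in> D" using bd_side[OF D(2) s] t1 by blast
  define w where "w = other z (z+p) (z+r)"
  have w: "w = z + d + d" unfolding w_def other_def p_def r_def by (simp add: algebra_simps)
  have "w \<in> V3" using sq_other[OF s] sqD unfolding w_def by blast
  then have "w \<in> whites D" using t2 unfolding w_def whites_def by blast
  then have "w \<in> S" unfolding S_def using w zz(2,3) d by auto
  then have "fst w + snd w \<le> m" unfolding m_def using S by (intro Max_ge) auto
  moreover have "fst w + snd w = m + 1" using w z(2) d by auto
  ultimately show False by simp
qed

text \<open>Any row that meets a nonempty finite \<open>D\<close> has to end in a boundary edge. In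
  homological terms, the plane has no nonzero finite 2-cycle.\<close>

lemma bd_eq_empty: assumes "finite D" "D \<subseteq> Tri" "bd D = {}" shows "D = {}"
proof (rule ccontr)
  assume "D \<noteq> {}"
  then obtain z where "z \<in> whites D" using whites_nonempty assms(2) by blast
  from leave_edge[OF assms(1,2) _ this, of "(1/2,0)"] show False using assms(3) by auto
qed

text \<open>Linearity and the trivial kernel of \<open>bd\<close>. This is what makes the filling of
  a circuit unique.\<close>

lemma bd_inj: assumes "finite A" "A \<subseteq> Tri" "finite B" "B \<subseteq> Tri" "bd A = bd B" shows "A = B"
proof -
  have "bd (sym_diff A B) = {}" using bd_sym_diff[of A B] assms by simp
  moreover have "finite (sym_diff A B)" "sym_diff A B \<subseteq> Tri" using assms by auto
  ultimately have "sym_diff A B = {}" using bd_eq_empty by blast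
  then show ?thesis by blast
qed

text \<open>Up to the factor 1/2 the linear form is the coordinate that stays constant in direction
  \<open>d\<close>, so its values label the lines. Each line through white vertices of
  \<open>D\<close> provides a boundary edge, and that edge remembers the line: a spoke by its white
  end, a side by its midpoint.\<close>

lemma line_count:
  assumes D: "finite D" "D \<subseteq> Tri" and d: "d = (1/2, 0) \<or> d = (0, 1/2)"
  shows "card ((\<lambda>z. snd d * fst z + fst d * snd z) ` whites D) \<le> card (bd D)"
proof -
  let ?f = "\<lambda>z::point. snd d * fst z + fst d * snd z"
  let ?P = "\<lambda>r e. \<exists>z\<in>V3. ?f z = r \<and> (e = side_of z d \<or> (\<exists>x. e = {z,x} \<and> cor z x))"
  have ex: "\<exists>e. e \<in> bd D \<and> ?P r e" if "r \<in> ?f ` whites D" for r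
  proof -
    obtain z0 where z0: "z0 \<in> whites D" "r = ?f z0" using \<open>r \<in> ?f ` whites D\<close> by (rule imageE)
    obtain z where z: "z \<in> V3" "snd d * fst z0 = snd d * fst z" "fst d * snd z0 = fst d * snd z"
       "side_of z d \<in> bd D \<or> (\<exists>x. {z,x} \<in> bd D)" using leave_edge[OF D d z0(1)] by blast
    have "?f z = r" by (simp only: z0(2) z(2) z(3))
    then show ?thesis using z(1,4) white_edge bd_edges by blast
  qed
  define g where "g r = (SOME e. e \<in> bd D \<and> ?P r e)" for r
  have g: "g r \<in> bd D" "?P r (g r)" if "r \<in> ?f ` whites D" for r
    using someI_ex[OF ex[OF that]] unfolding g_def by blast+
  have black: "v \<in> Z2" if "v \<in> side_of z d" "z \<in> V3" for v z
  proof -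
    have "cor z v" using that d unfolding cor_diag side_of_def diag_def by auto
    then show ?thesis by (rule cor_black)
  qed
  have "inj_on g (?f ` whites D)"
  proof (rule inj_onI)
    fix r r' assume r: "r \<in> ?f ` whites D" "r' \<in> ?f ` whites D" "g r = g r'"
    obtain z where z: "z \<in> V3" "?f z = r" "g r = side_of z d \<or> (\<exists>x. g r = {z,x} \<and> cor z x)"
      using g(2)[OF r(1)] by blast
    obtain z' where z': "z' \<in> V3" "?f z' = r'" "g r = side_of z' d \<or> (\<exists>x. g r = {z',x} \<and> cor z' x)"
      using g(2)[OF r(2)] r(3) by auto
    have w: "z \<notin> side_of z' d" "z' \<notin> side_of z d" using black z z' white_not_black by blast+
    show "r = r'"
    proof (cases "g r = side_of z d")
      case True
      then have "side_of z d = side_of z' d" using z'(3) w by auto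
      then show ?thesis using z(2) z'(2) d unfolding side_of_def
        by (auto simp: doubleton_eq_iff prod_eq_iff)
    next
      case False
      then obtain x where x: "g r = {z,x}" "cor z x" using z by blast
      then have "\<exists>x'. {z,x} = {z',x'} \<and> cor z' x'" using z'(3) w by auto
      then have "z = z'" using x(2) cor_black cor_white white_not_black by (metis doubleton_eq_iff)
      then show ?thesis using z z' by simp
    qed
  qed
  moreover have "g ` (?f ` whites D) \<subseteq> bd D" using g(1) by blast
  ultimately show ?thesis using card_inj_on_le bd_finite[OF D] by blast
qed

lemma whites_card:
  assumes D: "finite D" "D \<subseteq> Tri" shows "card D \<le> 4 * card (whites D)"
proof -
  have fin: "finite {t \<in> Tri. z \<in> t} \<and> card {t \<in> Tri. z \<in> t} \<le> 4" if "z \<in> V3" for z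
  proof -
    have "cor z (z + (1/2,1/2))" using that by (auto simp: cor_diag diag_def)
    then obtain y where s: "sq z (z + (1/2,1/2)) y" using cor_sq by blast
    let ?x = "z + (1/2,1/2)"
    let ?S = "{{z,?x,y},{z,?x,opp z y},{z,opp z ?x,y},{z,opp z ?x,opp z y}}"
    have "{t \<in> Tri. z \<in> t} \<subseteq> ?S" using white_tris[OF s] by (intro subsetI) simp
    moreover have "card ?S \<le> 4" by (rule card_insert_le_m1 | simp)+
    moreover have "finite ?S" by simp
    ultimately show ?thesis using card_mono finite_subset le_trans by meson
  qed
  have "D \<subseteq> (\<Union>z\<in>whites D. {t \<in> Tri. z \<in> t})" using whites_nonempty[OF D(2)] D(2) by blast
  then have "card D \<le> card (\<Union>z\<in>whites D. {t \<in> Tri. z \<in> t})"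
    by (rule card_mono[rotated]) (use fin whites_finite[OF D] in \<open>auto simp: whites_def\<close>)
  also have "\<dots> \<le> (\<Sum>z\<in>whites D. card {t \<in> Tri. z \<in> t})" by (rule card_UN_le[OF whites_finite[OF D]])
  also have "\<dots> \<le> (\<Sum>z\<in>whites D. 4)" by (rule sum_mono) (use fin in \<open>auto simp: whites_def\<close>)
  finally show ?thesis by simp
qed

text \<open>A white vertex is determined by its row and its column, and rows and columns are each at
  most as numerous as the boundary edges. The factor 4 is the number of triangles at a white
  vertex.\<close>

lemma isoperimetric:
  assumes D: "finite D" "D \<subseteq> Tri" shows "card D \<le> 4 * (card (bd D))\<^sup>2"
proof -
  let ?A = "(\<lambda>z. snd ((0,1/2)::point) * fst z + fst ((0,1/2)::point) * snd z) ` whites D"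
  let ?B = "(\<lambda>z. snd ((1/2,0)::point) * fst z + fst ((1/2,0)::point) * snd z) ` whites D"
  have "inj_on (\<lambda>z::point. (snd ((0,1/2)::point) * fst z + fst ((0,1/2)::point) * snd z,
       snd ((1/2,0)::point) * fst z + fst ((1/2,0)::point) * snd z)) (whites D)"
    by (auto simp: inj_on_def)
  then have "card (whites D) \<le> card (?A \<times> ?B)"
    by (rule card_inj_on_le) (use whites_finite[OF D] in auto)
  also have "\<dots> = card ?A * card ?B" by (rule card_cartesian_product)
  also have "\<dots> \<le> card (bd D) * card (bd D)"
    by (intro mult_le_mono line_count[OF D]) auto
  finally show ?thesis using whites_card[OF D] unfolding power2_eq_square by linarith
qed

section \<open>Dimer coverings and local moves\<close>

lemma cov_edges: "dimer_covering W M \<Longrightarrow> e \<in> M \<Longrightarrow> e \<in> E1 \<union> E2 \<and> e \<subseteq> W"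
  unfolding dimer_covering_def induced_edges_def by blast

lemma cov_unique: "dimer_covering W M \<Longrightarrow> e \<in> M \<Longrightarrow> e' \<in> M \<Longrightarrow> v \<in> e \<Longrightarrow> v \<in> e' \<Longrightarrow> e = e'"
  using cov_edges unfolding dimer_covering_def by blast

lemma cov_pair: "dimer_covering W M \<Longrightarrow> {v,u} \<in> M \<Longrightarrow> {v,u'} \<in> M \<Longrightarrow> u = u'"
  using cov_unique[of W M "{v,u}" "{v,u'}" v] by (auto simp: doubleton_eq_iff)

lemma cov_mate: assumes "dimer_covering W M" "v \<in> W" obtains u where "{v,u} \<in> M" "u \<noteq> v" "u \<in> W"
proof -
  obtain e where e: "e \<in> M" "v \<in> e" using assms unfolding dimer_covering_def by blast
  obtain a b where ab: "a \<noteq> b" "e = {a,b}" using edge_card cov_edges[OF assms(1) e(1)] by blast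
  define u where "u = (if v = a then b else a)"
  have "e = {v,u}" "u \<noteq> v" using ab e(2) unfolding u_def by auto
  then show ?thesis using that e(1) cov_edges[OF assms(1) e(1)] by blast
qed

lemma covI:
  assumes "M \<subseteq> induced_edges W" "\<And>v. v \<in> W \<Longrightarrow> \<exists>e\<in>M. v \<in> e"
    "\<And>v e e'. \<lbrakk>e \<in> M; e' \<in> M; v \<in> e; v \<in> e'\<rbrakk> \<Longrightarrow> e = e'"
  shows "dimer_covering W M"
  unfolding dimer_covering_def using assms by blast

lemma cov_finite: "finite W \<Longrightarrow> dimer_covering W M \<Longrightarrow> finite M"
  using cov_edges by (metis Pow_iff finite_Pow_iff finite_subset subsetI)

lemma cov_sym_diff_even_set:
  assumes W: "finite W" and M: "dimer_covering W M" and M': "dimer_covering W M'"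
  shows "even_set (sym_diff M M')"
proof -
  have "even (card {e \<in> sym_diff M M'. v \<in> e})" for v
  proof (cases "v \<in> W")
    case True
    obtain u where u: "{v,u} \<in> M" using cov_mate[OF M True] by blast
    obtain u' where u': "{v,u'} \<in> M'" using cov_mate[OF M' True] by blast
    have "(e \<in> M \<and> v \<in> e) = (e = {v,u})" for e
      using cov_unique[OF M _ u, of e v] u by (metis insertI1)
    then have 1: "{e \<in> M. v \<in> e} = {{v,u}}" by simp
    have "(e \<in> M' \<and> v \<in> e) = (e = {v,u'})" for e
      using cov_unique[OF M' _ u', of e v] u' by (metis insertI1)
    then have 2: "{e \<in> M'. v \<in> e} = {{v,u'}}" by simp
    have "{e \<in> sym_diff M M'. v \<in> e} = sym_diff {e \<in> M. v \<in> e} {e \<in> M'. v \<in> e}" by auto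
    then have "{e \<in> sym_diff M M'. v \<in> e} = sym_diff {{v,u}} {{v,u'}}" unfolding 1 2 .
    then show ?thesis using even_card_sym_diff[of "{{v,u}}" "{{v,u'}}"] by simp
  next
    case False
    then have "{e \<in> sym_diff M M'. v \<in> e} = {}" using cov_edges[OF M] cov_edges[OF M'] by blast
    then have "card {e \<in> sym_diff M M'. v \<in> e} = 0" by (simp only: card.empty)
    then show ?thesis by simp
  qed
  then show ?thesis unfolding even_set_def using cov_finite[OF W] M M' by blast
qed

text \<open>Where the two coverings use different edges at a vertex, evenness forces
  \<open>X\<close> to contain both or neither. Hence each circuit in the symmetric difference can be
  switched by itself.\<close>

lemma cov_sub:
  assumes M: "dimer_covering W M" and M': "dimer_covering W M'"
    and X: "X \<subseteq> sym_diff M M'" "even_set X"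
  shows "dimer_covering W (sym_diff M X)"
proof (rule covI)
  show "sym_diff M X \<subseteq> induced_edges W"
    using X(1) M M' unfolding dimer_covering_def by blast
next
  have key: "({v,u} \<in> X \<longleftrightarrow> {v,u'} \<in> X)" if u: "{v,u} \<in> M" "{v,u'} \<in> M'" "{v,u} \<noteq> {v,u'}" for v u u'
  proof -
    have "{e \<in> X. v \<in> e} \<subseteq> {{v,u},{v,u'}}" using X(1) u cov_unique[OF M] cov_unique[OF M'] by blast
    then have "{e \<in> X. v \<in> e} = {{v,u},{v,u'}} \<inter> X" by blast
    then have "card {e \<in> X. v \<in> e} = card ({{v,u},{v,u'}} \<inter> X)" by (rule arg_cong)
    then have "even (card ({{v,u},{v,u'}} \<inter> X))" using X(2) unfolding even_set_def by metis
    then show ?thesis using u(3) by (auto simp: Int_insert_left split: if_splits)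
  qed
  {
    fix v assume v: "v \<in> W"
    obtain u where u: "{v,u} \<in> M" using cov_mate[OF M v] by blast
    obtain u' where u': "{v,u'} \<in> M'" using cov_mate[OF M' v] by blast
    show "\<exists>e\<in>sym_diff M X. v \<in> e"
    proof (cases "{v,u} \<in> X")
      case True
      then have "{v,u} \<notin> M'" using X(1) u by blast
      then have n: "{v,u} \<noteq> {v,u'}" using u' by metis
      then have "{v,u'} \<in> X" using key[OF u u'] True by blast
      moreover have "{v,u'} \<notin> M" using cov_unique[OF M u, of "{v,u'}" v] n by blast
      ultimately show ?thesis by blast
    qed (use u in blast)
  }
  fix v e e' assume e: "e \<in> sym_diff M X" "e' \<in> sym_diff M X" "v \<in> e" "v \<in> e'"
  then have v: "v \<in> W" using X(1) cov_edges[OF M] cov_edges[OF M'] by blast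
  obtain u where u: "{v,u} \<in> M" using cov_mate[OF M v] by blast
  obtain u' where u': "{v,u'} \<in> M'" using cov_mate[OF M' v] by blast
  have *: "f = {v,u} \<and> f \<notin> X \<or> f = {v,u'} \<and> f \<in> X \<and> f \<notin> M" if "f \<in> sym_diff M X" "v \<in> f" for f
    using that X(1) cov_unique[OF M _ u that(2)] cov_unique[OF M' _ u' that(2)] by blast
  show "e = e'" using *[OF e(1,3)] *[OF e(2,4)] key[OF u u'] u by metis
qed

lemma cov_replace:
  assumes M: "dimer_covering W M" and A: "A \<subseteq> M" and B: "B \<subseteq> induced_edges W" "\<Union>A = \<Union>B"
    and u: "\<And>v e e'. \<lbrakk>e \<in> B; e' \<in> B; v \<in> e; v \<in> e'\<rbrakk> \<Longrightarrow> e = e'"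
  shows "dimer_covering W (M - A \<union> B)"
proof (rule covI)
  show "M - A \<union> B \<subseteq> induced_edges W" using M B unfolding dimer_covering_def by blast
next
  fix v assume "v \<in> W"
  then obtain e where "e \<in> M" "v \<in> e" using M unfolding dimer_covering_def by blast
  then show "\<exists>e\<in>M - A \<union> B. v \<in> e" using B(2) by blast
next
  fix v e e' assume e: "e \<in> M - A \<union> B" "e' \<in> M - A \<union> B" "v \<in> e" "v \<in> e'"
  have *: "f = g" if "f \<in> M - A" "g \<in> B" "v \<in> f" "v \<in> g" for f g
  proof -
    have "v \<in> \<Union>A" unfolding B(2) using that by blast
    then obtain h where "h \<in> A" "v \<in> h" by (rule UnionE)
    then show ?thesis using cov_unique[OF M, of f h v] that A by blast
  qed
  show "e = e'" using e * u cov_unique[OF M, of e e' v] by blast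
qed

section \<open>Local moves as differences of coverings\<close>

lemma sq_dist: "sq z x y \<Longrightarrow> dist x y = 1"
proof -
  assume "sq z x y"
  then have "fst x = fst y \<and> \<bar>snd x - snd y\<bar> = 1 \<or> snd x = snd y \<and> \<bar>fst x - fst y\<bar> = 1"
    unfolding sq_iff by blast
  then have "fst x = fst y \<and> (snd x - snd y)\<^sup>2 = 1 \<or> snd x = snd y \<and> (fst x - fst y)\<^sup>2 = 1"
    by (metis power2_abs one_power2)
  then show ?thesis unfolding dist_prod_def dist_real_def by auto
qed

lemma corners_eq: "z \<in> V3 \<Longrightarrow> square_corners z = {x. cor z x}"
proof -
  assume z: "z \<in> V3"
  have "square_corners z = (\<lambda>p. z + p) ` diag"
  proof -
    have *: "z - (1/2, 1/2) = z + (-1/2, -1/2)" "z - (1/2, -1/2) = z + (-1/2, 1/2)"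
      by (simp_all add: prod_eq_iff)
    show ?thesis unfolding square_corners_def diag_def image_insert image_empty * by (simp only: insert_commute)
  qed
  then show ?thesis using z cor_diag by auto
qed

lemma sq_neqs: "sq z x y \<Longrightarrow> x \<noteq> y \<and> z \<noteq> x \<and> z \<noteq> y \<and> opp z x \<noteq> x \<and> opp z x \<noteq> y \<and> z \<noteq> opp z x
   \<and> opp z y \<noteq> y \<and> opp z y \<noteq> x \<and> z \<noteq> opp z y \<and> opp z x \<noteq> opp z y"
  by (metis cor_black cor_opp opp_neq opp_opp sq_def sq_sym white_not_black cor_white)

lemma sym_diff_swap:
  "\<lbrakk>p \<in> M; q \<in> M; r \<notin> M; s \<notin> M; Q = {p,q,r,s}\<rbrakk> \<Longrightarrow> sym_diff M Q = (M - {p,q}) \<union> {r,s}"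
  by blast

text \<open>Phrased through two coverings and their difference, which is symmetric in them, so that
  a move and its inverse are covered alike. The case distinction finds out which of the two takes
  place.\<close>

lemma slide_move:
  assumes s: "sq z x y" and M: "dimer_covering W M" and M1: "dimer_covering W M1"
    and e: "M1 = sym_diff M {{x,y},{y,opp z x},{z,x},{z,opp z x}}"
  shows "(M, M1) \<in> local_move W"
proof -
  define a where "a = opp z x"
  have n: "x \<noteq> y" "z \<noteq> x" "z \<noteq> y" "a \<noteq> x" "a \<noteq> y" "z \<noteq> a" using sq_neqs[OF s] unfolding a_def by blast+
  have d: "{x,y} \<noteq> {y,a}" "{x,y} \<noteq> {z,x}" "{x,y} \<noteq> {z,a}" "{y,a} \<noteq> {z,x}" "{y,a} \<noteq> {z,a}" "{z,x} \<noteq> {z,a}"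
    using n by (auto simp: doubleton_eq_iff)
  have e': "M1 = sym_diff M {{x,y},{y,a},{z,x},{z,a}}" using e unfolding a_def .
  have sa: "sq z a y" unfolding a_def using sq_opp[OF s] .
  have tm: "triangular_move W M M1" if "sq z p y" "sq z q y" "p \<noteq> q" "{p,y} \<in> M" "{q,z} \<in> M" "{q,y} \<in> M1" "{p,z} \<in> M1"
    "M1 = (M - {{p,y},{q,z}}) \<union> {{q,y},{p,z}}" for p q
    unfolding triangular_move_def
  proof (intro exI conjI)
    show "z \<in> V3" "{p,q,y} \<subseteq> Z2" "{p,q,y} \<subseteq> square_corners z" "p \<noteq> q" "dist p y = 1" "dist q y = 1"
      using that(3) sqD[OF that(1)] sqD[OF that(2)] sq_dist[OF that(1)] sq_dist[OF that(2)] by (simp_all add: corners_eq)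
    show "{q,y} \<in> induced_edges W" "{p,z} \<in> induced_edges W"
      using that(6,7) M1 unfolding dimer_covering_def by blast+
  qed (use that in blast)+
  have "triangular_move W M M1"
  proof (cases "{x,y} \<in> M")
    case True
    have 1: "{y,a} \<notin> M" "{z,x} \<notin> M" using cov_unique[OF M True] d by blast+
    have 2: "{z,a} \<in> M"
    proof (rule ccontr)
      assume "{z,a} \<notin> M"
      then have "{z,a} \<in> M1" "{z,x} \<in> M1" using e' 1 by blast+
      then show False using cov_unique[OF M1, of "{z,a}" "{z,x}" z] d by blast
    qed
    have m: "M1 = (M - {{x,y},{a,z}}) \<union> {{a,y},{x,z}}"
      unfolding e' by (rule sym_diff_swap) (use True 1 2 in \<open>simp_all add: insert_commute\<close>)
    show ?thesis by (rule tm[OF s sa _ True]) (use n 2 m in \<open>auto simp: insert_commute\<close>)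
  next
    case False
    then have f: "{x,y} \<in> M1" using e' by blast
    have "{y,a} \<notin> M1"
      by (rule notI, drule cov_unique[OF M1 f, where v = y]) (simp_all only: d(1), simp_all)
    moreover have "{z,x} \<notin> M1"
      by (rule notI, drule cov_unique[OF M1 f, where v = x]) (simp_all only: d(2), simp_all)
    ultimately have 1: "{y,a} \<in> M" "{z,x} \<in> M" unfolding e' by simp_all
    have 2: "{z,a} \<notin> M" using cov_unique[OF M 1(2), of "{z,a}" z] d by blast
    have m: "M1 = (M - {{a,y},{x,z}}) \<union> {{x,y},{a,z}}"
      unfolding e' by (rule sym_diff_swap) (use False 1 2 in \<open>simp_all add: insert_commute\<close>)
    show ?thesis by (rule tm[OF sa s]) (use n 1 m in \<open>auto simp: insert_commute\<close>)
  qed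
  then show ?thesis unfolding local_move_def using M by blast
qed

lemma square_move:
  assumes s: "sq z x y" and M: "dimer_covering W M" and M1: "dimer_covering W M1"
    and e: "M1 = sym_diff M {{z,x},{z,y},{other z x y,x},{other z x y,y}}"
  shows "(M, M1) \<in> local_move W"
proof -
  define w where "w = other z x y"
  have sw: "sq w x y" unfolding w_def using sq_other[OF s] .
  have n: "x \<noteq> y" "z \<noteq> x" "z \<noteq> y" "w \<noteq> x" "w \<noteq> y" "w \<noteq> z"
    using sq_neqs[OF s] sq_neqs[OF sw] other_neq[OF s] unfolding w_def by blast+
  have d: "{z,x} \<noteq> {z,y}" "{z,x} \<noteq> {w,x}" "{z,x} \<noteq> {w,y}" "{z,y} \<noteq> {w,x}" "{z,y} \<noteq> {w,y}" "{w,x} \<noteq> {w,y}"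
    using n by (auto simp: doubleton_eq_iff)
  have e': "M1 = sym_diff M {{z,x},{z,y},{w,x},{w,y}}" using e unfolding w_def .
  have tm: "square_move W M M1" if "sq z p q" "sq w p q" "{p,z} \<in> M" "{q,w} \<in> M" "{p,w} \<in> M1" "{q,z} \<in> M1"
    "M1 = (M - {{p,z},{q,w}}) \<union> {{p,w},{q,z}}" for p q
    unfolding square_move_def
  proof (intro exI conjI)
    show "p \<in> Z2" "q \<in> Z2" "dist p q = 1" "z \<in> V3" "w \<in> V3" "z \<noteq> w" "{p,q} \<subseteq> square_corners z" "{p,q} \<subseteq> square_corners w"
      using n(6) sqD[OF that(1)] sqD[OF that(2)] sq_dist[OF that(1)] by (simp_all add: corners_eq)
    show "{p,w} \<in> induced_edges W" "{q,z} \<in> induced_edges W"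
      using that(5,6) M1 unfolding dimer_covering_def by blast+
  qed (use that in blast)+
  have "square_move W M M1"
  proof (cases "{z,x} \<in> M")
    case True
    have 1: "{z,y} \<notin> M" "{w,x} \<notin> M" using cov_unique[OF M True] d by blast+
    have 2: "{w,y} \<in> M"
    proof (rule ccontr)
      assume "{w,y} \<notin> M"
      then have "{w,y} \<in> M1" "{w,x} \<in> M1" using e' 1 by blast+
      then show False using cov_unique[OF M1, of "{w,y}" "{w,x}" w] d by blast
    qed
    have m: "M1 = (M - {{x,z},{y,w}}) \<union> {{x,w},{y,z}}"
      unfolding e' by (rule sym_diff_swap) (use True 1 2 in \<open>simp_all add: insert_commute\<close>)
    show ?thesis by (rule tm[OF s sw]) (use True 2 m in \<open>auto simp: insert_commute\<close>)
  next
    case False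
    then have f: "{z,x} \<in> M1" using e' by blast
    have "{z,y} \<notin> M1"
      by (rule notI, drule cov_unique[OF M1 f, where v = z]) (simp_all only: d(1), simp_all)
    moreover have "{w,x} \<notin> M1"
      by (rule notI, drule cov_unique[OF M1 f, where v = x]) (simp_all only: d(2), simp_all)
    ultimately have 1: "{z,y} \<in> M" "{w,x} \<in> M" unfolding e' by simp_all
    have 2: "{w,y} \<notin> M" using cov_unique[OF M 1(2), of "{w,y}" w] d by blast
    have m: "M1 = (M - {{y,z},{x,w}}) \<union> {{y,w},{x,z}}"
      unfolding e' by (rule sym_diff_swap) (use False 1 2 in \<open>simp_all add: insert_commute\<close>)
    show ?thesis by (rule tm[OF sq_sym[OF s] sq_sym[OF sw]]) (use 1 m in \<open>auto simp: insert_commute\<close>)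
  qed
  then show ?thesis unfolding local_move_def using M by blast
qed

lemma sym_diff_triple:
  "\<lbrakk>a \<noteq> c; b \<noteq> c; a' \<noteq> c; b' \<noteq> c; a \<noteq> a'; a \<noteq> b'; b \<noteq> a'; b \<noteq> b'\<rbrakk> \<Longrightarrow>
   sym_diff {a,b,c} {a',b',c} = {a,b,a',b'}"
  by blast

lemma bd_slide:
  assumes s: "sq z x y"
  shows "bd {{z,x,y},{z,y,opp z x}} = {{x,y},{y,opp z x},{z,x},{z,opp z x}}"
proof -
  define a where "a = opp z x"
  have n: "x \<noteq> y" "z \<noteq> x" "z \<noteq> y" "a \<noteq> x" "a \<noteq> y" "z \<noteq> a" using sq_neqs[OF s] unfolding a_def by blast+
  have sa: "sq z y a" unfolding a_def using sq_sym[OF sq_opp[OF s]] .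
  have ne: "{z,x,y} \<noteq> {z,y,a}" using n by auto
  have "{{z,x,y},{z,y,a}} = sym_diff {{z,x,y}} {{z,y,a}}" using ne by blast
  then have "bd {{z,x,y},{z,y,a}} = sym_diff (bd {{z,x,y}}) (bd {{z,y,a}})"
    using bd_sym_diff[of "{{z,x,y}}" "{{z,y,a}}"] TriI[OF s] TriI[OF sa] by (simp only: insert_subset empty_subsetI simp_thms)
  also have "\<dots> = sym_diff {{x,y},{z,x},{z,y}} {{y,a},{z,a},{z,y}}"
    unfolding bd_single[OF s] bd_single[OF sa] by (simp add: insert_commute)
  also have "\<dots> = {{x,y},{z,x},{y,a},{z,a}}"
    by (rule sym_diff_triple) (use n in \<open>auto simp: doubleton_eq_iff\<close>)
  also have "\<dots> = {{x,y},{y,a},{z,x},{z,a}}" by (simp add: insert_commute)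
  finally show ?thesis unfolding a_def .
qed

lemma bd_square:
  assumes s: "sq z x y"
  shows "bd {{z,x,y},{other z x y,x,y}} = {{z,x},{z,y},{other z x y,x},{other z x y,y}}"
proof -
  define w where "w = other z x y"
  have sw: "sq w x y" unfolding w_def using sq_other[OF s] .
  have n: "x \<noteq> y" "z \<noteq> x" "z \<noteq> y" "w \<noteq> x" "w \<noteq> y" "w \<noteq> z"
    using sq_neqs[OF s] sq_neqs[OF sw] other_neq[OF s] unfolding w_def by blast+
  have ne: "{z,x,y} \<noteq> {w,x,y}" using n by auto
  have "{{z,x,y},{w,x,y}} = sym_diff {{z,x,y}} {{w,x,y}}" using ne by blast
  then have "bd {{z,x,y},{w,x,y}} = sym_diff (bd {{z,x,y}}) (bd {{w,x,y}})"
    using bd_sym_diff[of "{{z,x,y}}" "{{w,x,y}}"] TriI[OF s] TriI[OF sw] by (simp only: insert_subset empty_subsetI simp_thms)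
  also have "\<dots> = {{z,x},{z,y},{w,x},{w,y}}"
    unfolding bd_single[OF s] bd_single[OF sw] by (rule sym_diff_triple) (use n in \<open>auto simp: doubleton_eq_iff\<close>)
  finally show ?thesis unfolding w_def .
qed

definition reach :: "point set \<Rightarrow> nat \<Rightarrow> point set set \<Rightarrow> point set set \<Rightarrow> bool" where
  "reach W n M M' \<longleftrightarrow> (\<exists>s\<le>n. (M, M') \<in> local_move W ^^ s)"

lemma reach_refl: "reach W n M M"
  unfolding reach_def by (rule exI[of _ 0]) simp

lemma reach_step: "(M, M') \<in> local_move W \<Longrightarrow> reach W 1 M M'"
  unfolding reach_def by (rule exI[of _ 1]) simp

lemma reach_trans: "reach W m A B \<Longrightarrow> reach W n B C \<Longrightarrow> reach W (m + n) A C"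
  unfolding reach_def by (meson add_mono relcomp.relcompI relpow_add[THEN equalityD2, THEN subsetD])

lemma reach_mono: "reach W m A B \<Longrightarrow> m \<le> n \<Longrightarrow> reach W n A B"
  unfolding reach_def by (meson le_trans)

section \<open>Regions without holes\<close>

lemma TW_finite: "finite W \<Longrightarrow> finite (TW W)"
  unfolding TW_def by (rule finite_subset[of _ "Pow W"]) auto

lemma TW_Tri: "TW W \<subseteq> Tri" unfolding TW_def by blast

definition edges_of :: "point set set \<Rightarrow> point set set" where
  "edges_of D = {e \<in> E1 \<union> E2. \<exists>t\<in>D. e \<subseteq> t}"

lemma bd_edges_of: "bd D \<subseteq> edges_of D"
  unfolding edges_of_def using bd_edges bd_edge_tri by blast

text \<open>No circuit of the boundary of \<open>D\<close> encloses a triangle outside \<open>D\<close>.\<close>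

definition hole_free :: "point set \<Rightarrow> point set set \<Rightarrow> bool" where
  "hole_free W D \<longleftrightarrow> (\<forall>X\<subseteq>TW W. bd X \<subseteq> bd D \<longrightarrow> X \<subseteq> D)"

lemma edge_triE:
  assumes "e \<in> E1 \<union> E2" obtains t1 t2 where "t1 \<noteq> t2" "{t \<in> Tri. e \<subseteq> t} = {t1, t2}"
    "t1 \<in> Tri" "t2 \<in> Tri" "e \<subseteq> t1" "e \<subseteq> t2"
proof -
  obtain t1 t2 where t: "t1 \<noteq> t2" "{t \<in> Tri. e \<subseteq> t} = {t1, t2}"
    using edge_triangles[OF assms] by (elim exE conjE) (rule that)
  have "t1 \<in> {t \<in> Tri. e \<subseteq> t}" "t2 \<in> {t \<in> Tri. e \<subseteq> t}" unfolding t(2) by simp_all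
  then show ?thesis using that[OF t] by simp
qed

lemma bdE:
  assumes "e \<in> bd D" "D \<subseteq> Tri"
  obtains t1 t2 where "t1 \<in> D" "t2 \<notin> D" "t1 \<in> Tri" "t2 \<in> Tri" "e \<subseteq> t1" "e \<subseteq> t2"
    "\<forall>X. X \<subseteq> Tri \<longrightarrow> e \<in> bd X \<longleftrightarrow> (t1 \<in> X) \<noteq> (t2 \<in> X)"
    "\<forall>t. t \<in> Tri \<longrightarrow> e \<subseteq> t \<longrightarrow> t = t1 \<or> t = t2"
proof -
  have e: "e \<in> E1 \<union> E2" using assms(1) bd_edges by blast
  obtain t1 t2 where t: "t1 \<noteq> t2" "{t \<in> Tri. e \<subseteq> t} = {t1, t2}"
    "t1 \<in> Tri" "t2 \<in> Tri" "e \<subseteq> t1" "e \<subseteq> t2" using edge_triE[OF e] .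
  have i: "e \<in> bd X \<longleftrightarrow> (t1 \<in> X) \<noteq> (t2 \<in> X)" if "X \<subseteq> Tri" for X
    using bd_iff[OF that e t(2,1)] .
  have two: "u = t1 \<or> u = t2" if "u \<in> Tri" "e \<subseteq> u" for u
  proof -
    have "u \<in> {t \<in> Tri. e \<subseteq> t}" using that by simp
    then show ?thesis unfolding t(2) by simp
  qed
  show ?thesis
  proof (cases "t1 \<in> D")
    case True
    then have "t2 \<notin> D" using i assms by blast
    then show ?thesis using that[of t1 t2] True t i two by blast
  next
    case False
    then have "t2 \<in> D" using i assms by blast
    then show ?thesis using that[of t2 t1] False t i two by blast
  qed
qed

text \<open>An edge of \<open>bd (X - D)\<close> off \<open>bd D\<close> would have both of its
  triangles outside \<open>D\<close>. It would then belong to \<open>bd X\<close>, hence to a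
  triangle of \<open>D\<close>.\<close>

lemma outside_bd:
  assumes D: "D \<subseteq> Tri" and X: "X \<subseteq> Tri" and b: "bd X \<subseteq> edges_of D"
  shows "bd (X - D) \<subseteq> bd D"
proof
  fix e assume e: "e \<in> bd (X - D)"
  have "X - D \<subseteq> Tri" using X by blast
  obtain t1 t2 where t: "t1 \<in> X - D" "t2 \<notin> X - D" "t1 \<in> Tri" "t2 \<in> Tri" "e \<subseteq> t1" "e \<subseteq> t2" and
    i0: "\<forall>X. X \<subseteq> Tri \<longrightarrow> e \<in> bd X \<longleftrightarrow> (t1 \<in> X) \<noteq> (t2 \<in> X)" and
    two0: "\<forall>t. t \<in> Tri \<longrightarrow> e \<subseteq> t \<longrightarrow> t = t1 \<or> t = t2" by (rule bdE[OF e \<open>X - D \<subseteq> Tri\<close>]) blast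
  note i = i0[rule_format] and two = two0[rule_format]
  have "t2 \<in> D"
  proof (rule ccontr)
    assume n: "t2 \<notin> D"
    then have "e \<in> bd X" using t i[OF X] by blast
    then obtain t where "t \<in> D" "e \<subseteq> t" using b unfolding edges_of_def by blast
    then show False using two[of t] t n D by blast
  qed
  then show "e \<in> bd D" using i[OF D] t by blast
qed

lemma hole_free_inside:
  assumes "hole_free W D" "D \<subseteq> TW W" "X \<subseteq> TW W" "bd X \<subseteq> edges_of D" shows "X \<subseteq> D"
proof -
  have "bd (X - D) \<subseteq> bd D" using outside_bd[of D X] assms TW_Tri by blast
  moreover have "X - D \<subseteq> TW W" using assms by blast
  ultimately have "X - D \<subseteq> D" using assms(1) unfolding hole_free_def by blast
  then show ?thesis by blast
qed

text \<open>Cutting off a connected piece that touches the boundary opens no hole;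
  \<open>con\<close> expresses the connectedness and \<open>e0\<close> the contact. A set
  \<open>X\<close> bounded by the remainder contains all or nothing of \<open>D'\<close>, and if it
  contained \<open>D'\<close> it would have to continue across \<open>e0\<close> and leave
  \<open>D\<close>.\<close>

lemma hole_free_Diff:
  assumes hole_free: "hole_free W D" and D: "D \<subseteq> TW W" and D': "D' \<subseteq> D"
    and con: "\<And>Y. Y \<subseteq> D' \<Longrightarrow> bd Y \<subseteq> bd D' \<Longrightarrow> Y = {} \<or> Y = D'"
    and e0: "e0 \<in> bd D'" "e0 \<in> bd D"
  shows "hole_free W (D - D')"
  unfolding hole_free_def
proof (intro allI impI)
  fix X assume X: "X \<subseteq> TW W" "bd X \<subseteq> bd (D - D')"
  have T: "D \<subseteq> Tri" "D' \<subseteq> Tri" "X \<subseteq> Tri" "D - D' \<subseteq> Tri" "X \<inter> D' \<subseteq> Tri" using D D' X TW_Tri by blast+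
  have "bd X \<subseteq> edges_of D" using X(2) bd_edges_of[of "D - D'"] unfolding edges_of_def by blast
  then have XD: "X \<subseteq> D" using hole_free_inside[OF hole_free D X(1)] by blast
  have "bd (X \<inter> D') \<subseteq> bd D'"
  proof
    fix e assume e: "e \<in> bd (X \<inter> D')"
    obtain t1 t2 where t: "t1 \<in> X \<inter> D'" "t2 \<notin> X \<inter> D'" "t1 \<in> Tri" "t2 \<in> Tri" "e \<subseteq> t1" "e \<subseteq> t2" and
      i0: "\<forall>X. X \<subseteq> Tri \<longrightarrow> e \<in> bd X \<longleftrightarrow> (t1 \<in> X) \<noteq> (t2 \<in> X)" by (rule bdE[OF e T(5)]) blast
    note i = i0[rule_format]
    show "e \<in> bd D'"
    proof (rule ccontr)
      assume "e \<notin> bd D'"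
      then have t2: "t2 \<in> D'" using i[OF T(2)] t by blast
      then have "e \<in> bd X" using i[OF T(3)] t by blast
      then have "e \<in> bd (D - D')" using X(2) by blast
      then show False using i[OF T(4)] t t2 by blast
    qed
  qed
  then have "X \<inter> D' = {} \<or> X \<inter> D' = D'" using con[of "X \<inter> D'"] by blast
  moreover have "X \<inter> D' \<noteq> D'"
  proof
    assume sub: "X \<inter> D' = D'"
    obtain t1 t2 where t: "t1 \<in> D'" "t2 \<notin> D'" "t1 \<in> Tri" "t2 \<in> Tri" "e0 \<subseteq> t1" "e0 \<subseteq> t2" and
      i0: "\<forall>X. X \<subseteq> Tri \<longrightarrow> e0 \<in> bd X \<longleftrightarrow> (t1 \<in> X) \<noteq> (t2 \<in> X)" by (rule bdE[OF e0(1) T(2)]) blast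
    note i = i0[rule_format]
    have t2: "t2 \<notin> D" using i[OF T(1)] e0(2) t D' by blast
    then have "e0 \<notin> bd (D - D')" using i[OF T(4)] t by blast
    then have "e0 \<notin> bd X" using X(2) by blast
    then have "t2 \<in> X" using i[OF T(3)] t sub by blast
    then show False using XD t2 by blast
  qed
  ultimately show "X \<subseteq> D - D'" using XD by blast
qed

lemma circuit_connected:
  assumes "finite D" "D \<subseteq> Tri" "circuit (bd D)" "Y \<subseteq> D" "bd Y \<subseteq> bd D" shows "Y = {} \<or> Y = D"
proof -
  have Y: "finite Y" "Y \<subseteq> Tri" using assms finite_subset by blast+
  then have "bd Y = {} \<or> bd Y = bd D" using assms(3,5) bd_even_set unfolding circuit_def by blast
  then show ?thesis using bd_eq_empty[OF Y] bd_inj[OF Y assms(1,2)] by blast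
qed

lemma hole_free_circuit:
  assumes "finite W" "D \<subseteq> TW W" "circuit (bd D)" shows "hole_free W D"
  unfolding hole_free_def
proof (intro allI impI)
  fix X assume X: "X \<subseteq> TW W" "bd X \<subseteq> bd D"
  have f: "finite X" "X \<subseteq> Tri" "finite D" "D \<subseteq> Tri"
    using X assms TW_finite TW_Tri finite_subset by (meson subset_trans)+
  then have "bd X = {} \<or> bd X = bd D" using X(2) assms(3) bd_even_set unfolding circuit_def by blast
  then show "X \<subseteq> D" using bd_eq_empty[OF f(1,2)] bd_inj[OF f] by blast
qed

section \<open>Rotations and the count of spokes\<close>

text \<open>The data of a rotation: \<open>M\<close> is to be replaced by its symmetric difference with the boundary of
  \<open>D\<close>.  The fourth condition says that no impurity lies in the interior of \<open>D\<close>.\<close>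

definition config :: "point set \<Rightarrow> point set set \<Rightarrow> point set set \<Rightarrow> bool" where
  "config W M D \<longleftrightarrow> dimer_covering W M \<and> dimer_covering W (sym_diff M (bd D)) \<and> D \<subseteq> TW W \<and>
     (\<forall>e\<in>M \<inter> E2. \<exists>t\<in>Tri. e \<subseteq> t \<and> t \<notin> D) \<and> hole_free W D"

lemma configD:
  assumes "config W M D"
  shows "dimer_covering W M" "dimer_covering W (sym_diff M (bd D))" "D \<subseteq> TW W" "hole_free W D" "D \<subseteq> Tri"
    "\<And>e. e \<in> M \<Longrightarrow> e \<in> E2 \<Longrightarrow> \<exists>t\<in>Tri. e \<subseteq> t \<and> t \<notin> D"
  using assms TW_Tri unfolding config_def by blast+

text \<open>An edge off the boundary that is in one covering is in both, while \<open>f\<close> is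
  in exactly one of them. At the common vertex \<open>v\<close> the two would collide in that
  covering.\<close>

lemma bd_at:
  assumes c: "config W M D" and e: "e \<in> M \<or> e \<in> sym_diff M (bd D)" "v \<in> e" and f: "f \<in> bd D" "v \<in> f"
  shows "e \<in> bd D"
proof (rule ccontr)
  assume n: "e \<notin> bd D"
  then have em: "e \<in> M" "e \<in> sym_diff M (bd D)" using e(1) by blast+
  have "f = e"
  proof (cases "f \<in> M")
    case True
    then show ?thesis using cov_unique[OF configD(1)[OF c] True em(1) f(2) e(2)] by blast
  next
    case False
    then have "f \<in> sym_diff M (bd D)" using f(1) by blast
    then show ?thesis using cov_unique[OF configD(2)[OF c] _ em(2) f(2) e(2)] by blast
  qed
  then show False using n f(1) by blast
qed

text \<open>At a boundary vertex both coverings follow the boundary; at any other vertex of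
  \<open>D\<close> all the surrounding triangles belong to \<open>D\<close>.\<close>

lemma D_edge:
  assumes c: "config W M D" and t: "t \<in> D" "v \<in> t" and e: "e \<in> M \<or> e \<in> sym_diff M (bd D)" "v \<in> e"
  shows "e \<in> edges_of D"
proof (cases "\<exists>f\<in>bd D. v \<in> f")
  case True
  then show ?thesis using bd_at[OF c e] bd_edges_of by blast
next
  case False
  have E: "e \<in> E1 \<union> E2" using e(1) cov_edges configD(1,2)[OF c] by metis
  obtain t1 where t1: "t1 \<in> Tri" "e \<subseteq> t1" using edge_triE[OF E] by metis
  have "t1 \<in> D" using link[OF configD(5)[OF c] _ t t1(1)] t1(2) e(2) False by blast
  then show ?thesis unfolding edges_of_def using E t1(2) by blast
qed

lemma impurity_on_bd:
  assumes c: "config W M D" and t: "t \<in> D" "v \<in> t" and e: "e \<in> M" "v \<in> e" "e \<in> E2"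
  shows "e \<in> bd D"
proof -
  have E: "e \<in> E1 \<union> E2" using e by blast
  obtain t1 where t1: "t1 \<in> D" "e \<subseteq> t1" using D_edge[OF c t] e unfolding edges_of_def by blast
  obtain t2 where t2: "t2 \<in> Tri" "e \<subseteq> t2" "t2 \<notin> D" using configD(6)[OF c e(1,3)] by blast
  obtain s1 s2 where s: "s1 \<noteq> s2" "{t \<in> Tri. e \<subseteq> t} = {s1, s2}" using edge_triE[OF E] by metis
  have "t1 \<in> {t \<in> Tri. e \<subseteq> t}" "t2 \<in> {t \<in> Tri. e \<subseteq> t}" using t1 t2 configD(5)[OF c] by auto
  then have "(s1 \<in> D) \<noteq> (s2 \<in> D)" unfolding s(2) using t1 t2 by auto
  then show ?thesis using bd_iff[OF configD(5)[OF c] E s(2,1)] by blast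
qed

lemma D_vertex: "config W M D \<Longrightarrow> t \<in> D \<Longrightarrow> v \<in> t \<Longrightarrow> v \<in> W"
  using configD(3) unfolding TW_def by blast

text \<open>If no alternating path leaves \<open>L\<close>, both coverings match \<open>L\<close> with \<open>B\<close>; then \<open>L \<union> B\<close>
  avoids the boundary of \<open>D\<close>, and counting the four spokes at every vertex shows that no spoke
  enters \<open>B\<close> from outside \<open>L\<close>.\<close>

lemma closure_count:
  assumes c: "config W M D" and L: "finite L" "\<And>l. l \<in> L \<Longrightarrow> \<exists>t\<in>D. l \<in> t"
    and B: "B = {b. \<exists>l\<in>L. {l,b} \<in> E1 \<and> {l,b} \<in> edges_of D}"
    and h0: "\<And>l u. l \<in> L \<Longrightarrow> {l,u} \<in> M \<or> {l,u} \<in> sym_diff M (bd D) \<Longrightarrow> {l,u} \<in> E1"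
    and h1: "\<And>b. b \<in> B \<Longrightarrow> \<exists>l\<in>L. {l,b} \<in> M"
    and h2: "\<And>X. X \<subseteq> bd D \<Longrightarrow> even_set X \<Longrightarrow> X \<subseteq> E1 \<Longrightarrow> \<Union>X \<subseteq> L \<union> B \<Longrightarrow> X = {}"
    and fD: "finite D"
    and b: "b \<in> B" "{w,b} \<in> E1"
  shows "w \<in> L"
proof -
  let ?M2 = "sym_diff M (bd D)"
  note cM = configD(1)[OF c] and cM2 = configD(2)[OF c]
  have LW: "l \<in> W" if "l \<in> L" for l using L(2)[OF that] D_vertex[OF c] by blast
  have toB: "u \<in> B" if "l \<in> L" "{l,u} \<in> M \<or> {l,u} \<in> ?M2" for l u
  proof -
    obtain t where "t \<in> D" "l \<in> t" using L(2)[OF \<open>l \<in> L\<close>] by blast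
    then have "{l,u} \<in> edges_of D" using D_edge[OF c, of t l "{l,u}"] that(2) by blast
    then show ?thesis unfolding B using h0[OF that] that(1) by blast
  qed
  define m where "m l = (SOME u. {l,u} \<in> M)" for l
  define m2 where "m2 l = (SOME u. {l,u} \<in> ?M2)" for l
  have m: "{l, m l} \<in> M" if "l \<in> L" for l
    unfolding m_def using cov_mate[OF cM LW[OF that]] by (metis someI_ex)
  have m2: "{l, m2 l} \<in> ?M2" if "l \<in> L" for l
    unfolding m2_def using cov_mate[OF cM2 LW[OF that]] by (metis (no_types, lifting) someI_ex)
  have im: "inj_on m L"
  proof (rule inj_onI)
    fix p q assume "p \<in> L" "q \<in> L" "m p = m q"
    then have "{m p, p} \<in> M" "{m p, q} \<in> M" using m by (metis insert_commute)+
    then show "p = q" using cov_pair[OF cM] by blast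
  qed
  have im2: "inj_on m2 L"
  proof (rule inj_onI)
    fix p q assume "p \<in> L" "q \<in> L" "m2 p = m2 q"
    then have "{m2 p, p} \<in> ?M2" "{m2 p, q} \<in> ?M2" using m2 by (metis insert_commute)+
    then show "p = q" using cov_pair[OF cM2] by blast
  qed
  have BL: "B = m ` L"
  proof (intro equalityI subsetI)
    fix u assume "u \<in> B"
    then obtain l where "l \<in> L" "{l,u} \<in> M" using h1 by blast
    then show "u \<in> m ` L" using m cov_pair[OF cM] by blast
  next
    fix u assume "u \<in> m ` L"
    then show "u \<in> B" using toB m by blast
  qed
  then have cB: "finite B" "card B = card L" using L(1) im card_image by auto
  have "m2 ` L \<subseteq> B" using toB m2 by blast
  then have BL2: "m2 ` L = B" using card_subset_eq[OF cB(1)] cB(2) card_image[OF im2] by auto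
  \<comment> \<open>The boundary edges that meet \<open>L \<union> B\<close>. They turn out to be
    spokes with both ends in that set, so their degrees are those of \<open>bd D\<close> and
    \<open>X\<close> is an even set to which \<open>h2\<close> applies.\<close>
  define X where "X = {e \<in> bd D. \<exists>v\<in>L \<union> B. v \<in> e}"
  have XE: "e \<in> E1 \<and> e \<subseteq> L \<union> B" if e: "e \<in> X" for e
  proof -
    have eM: "e \<in> M \<or> e \<in> ?M2" using e unfolding X_def by blast
    obtain v where v: "v \<in> L \<union> B" "v \<in> e" using e unfolding X_def by blast
    have "\<exists>l\<in>L. l \<in> e"
    proof (cases "v \<in> L")
      case False
      then have vB: "v \<in> B" using v by blast
      obtain l where l: "l \<in> L" "{l,v} \<in> M" using vB m unfolding BL by blast
      obtain l2 where l2: "l2 \<in> L" "{l2,v} \<in> ?M2" using vB m2 unfolding BL2[symmetric] by blast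
      show ?thesis using eM
      proof
        assume "e \<in> M"
        then have "e = {l,v}" using cov_unique[OF cM _ l(2) v(2)] by blast
        then show ?thesis using l by blast
      next
        assume "e \<in> ?M2"
        then have "e = {l2,v}" using cov_unique[OF cM2 _ l2(2) v(2)] by blast
        then show ?thesis using l2 by blast
      qed
    qed (use v in blast)
    then obtain l where l: "l \<in> L" "l \<in> e" by blast
    have "e \<in> E1 \<union> E2" using e bd_edges unfolding X_def by blast
    then obtain u where u: "e = {l,u}" using edge_card[of e] l(2) by blast
    show ?thesis using h0[OF l(1), of u] toB[OF l(1), of u] eM l unfolding u by blast
  qed
  have "even_set X"
  proof -
    have eb: "even_set (bd D)" using bd_even_set[OF fD configD(5)[OF c]] .
    have "even (card {e \<in> X. v \<in> e})" for v
    proof (cases "v \<in> L \<union> B")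
      case True
      then have "{e \<in> X. v \<in> e} = {e \<in> bd D. v \<in> e}" unfolding X_def by blast
      then show ?thesis using eb unfolding even_set_def by simp
    next
      case False
      then have "{e \<in> X. v \<in> e} = {}" using XE by blast
      then have "card {e \<in> X. v \<in> e} = 0" by (simp only: card.empty)
      then show ?thesis by simp
    qed
    moreover have "finite X" using eb unfolding X_def even_set_def by simp
    ultimately show ?thesis unfolding even_set_def by blast
  qed
  then have X0: "X = {}" using h2[of X] XE unfolding X_def by blast
  have nbr: "u \<in> B" if l: "l \<in> L" and e: "{l,u} \<in> E1" for l u
  proof -
    obtain t where t: "t \<in> D" "l \<in> t" using L(2)[OF l] by blast
    have E: "{l,u} \<in> E1 \<union> E2" using e by blast
    obtain t1 where t1: "t1 \<in> Tri" "{l,u} \<subseteq> t1" using edge_triE[OF E] by metis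
    have "t1 \<in> D" using link[OF configD(5)[OF c] _ t t1(1)] t1(2) X0 l unfolding X_def by blast
    then show ?thesis unfolding B edges_of_def using l e E t1(2) by blast
  qed
  have col: "p \<in> V3 \<union> Z2" if "{p,q} \<in> E1" for p q using E1_colours[OF that] by blast
  have L4: "card {u. {l,u} \<in> E1} = 4" if "l \<in> L" for l
    using spoke_nbrs_card col[OF h0[OF that]] m[OF that] by blast
  have B4: "card {u. {v,u} \<in> E1} = 4" if "v \<in> B" for v
  proof -
    obtain l where "{l,v} \<in> E1" using \<open>v \<in> B\<close> unfolding B by blast
    then have "{v,l} \<in> E1" by (metis insert_commute)
    then show ?thesis using spoke_nbrs_card[OF col] by blast
  qed
  have fin4: "finite A" if "card A = 4" for A :: "point set" using that card.infinite by fastforce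
  \<comment> \<open>\<open>P\<close> and \<open>Q\<close> list the spokes from the side of
    \<open>L\<close> and from the side of \<open>B\<close>. Both have four times the common size of
    \<open>L\<close> and \<open>B\<close>, and every spoke at \<open>L\<close> ends in
    \<open>B\<close>; so conversely every spoke at \<open>B\<close> ends in
    \<open>L\<close>.\<close>
  define P where "P = (SIGMA l:L. {u. {l,u} \<in> E1})"
  define Q where "Q = (SIGMA v:B. {u. {v,u} \<in> E1})"
  have "card P = (\<Sum>l\<in>L. card {u. {l,u} \<in> E1})" unfolding P_def
    by (rule card_SigmaI) (use L(1) fin4 L4 in auto)
  then have cP: "card P = 4 * card L" using L4 by simp
  have "card Q = (\<Sum>l\<in>B. card {u. {l,u} \<in> E1})" unfolding Q_def
    by (rule card_SigmaI) (use cB(1) fin4 B4 in auto)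
  then have cQ: "card Q = 4 * card L" using B4 cB by simp
  have fQ: "finite Q" unfolding Q_def by (rule finite_SigmaI) (use cB(1) fin4 B4 in auto)
  have sub: "prod.swap ` P \<subseteq> Q"
  proof
    fix p assume "p \<in> prod.swap ` P"
    then obtain l u where p: "p = (u,l)" "l \<in> L" "{l,u} \<in> E1" unfolding P_def by auto
    then have "{u,l} \<in> E1" by (metis insert_commute)
    then show "p \<in> Q" using p nbr unfolding Q_def by simp
  qed
  have "card (prod.swap ` P) = card P" by (rule card_image) (auto simp: inj_on_def)
  then have "prod.swap ` P = Q" using card_subset_eq[OF fQ sub] cP cQ by simp
  moreover have "(b,w) \<in> Q" unfolding Q_def using b by (simp add: insert_commute)
  ultimately have "(b,w) \<in> prod.swap ` P" by simp
  then show ?thesis unfolding P_def by auto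
qed

section \<open>Rotating circuits of spokes\<close>

text \<open>A shortest closed walk through \<open>a\<close> repeats no vertex, since the piece
  between two equal vertices could be left out (the walk \<open>g\<close>). Its successor map is
  then a permutation of its vertices, a form that avoids indices later.\<close>

lemma cycle_permutation:
  assumes "(a,a) \<in> r\<^sup>+"
  shows "\<exists>S s. finite S \<and> a \<in> S \<and> bij_betw s S S \<and> (\<forall>x\<in>S. (x, s x) \<in> r)"
proof -
  define n where "n = (LEAST n. n > 0 \<and> (a,a) \<in> r ^^ n)"
  have ex: "\<exists>n. n > 0 \<and> (a,a) \<in> r ^^ n" using assms trancl_power by metis
  have n: "n > 0" "(a,a) \<in> r ^^ n" unfolding n_def using LeastI_ex[OF ex] by blast+
  have least: "n \<le> k" if "k > 0" "(a,a) \<in> r ^^ k" for k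
    unfolding n_def using that by (intro Least_le) blast
  obtain f where f: "f 0 = a" "f n = a" "\<forall>i<n. (f i, f (Suc i)) \<in> r"
    using n(2) unfolding relpow_fun_conv by blast
  have ne: "f i \<noteq> f j" if ij: "i < j" "j < n" for i j
  proof
    assume e: "f i = f j"
    define g where "g k = (if k \<le> i then f k else f (k + (j - i)))" for k
    have "g 0 = a" "g (n - (j - i)) = a" using f ij e unfolding g_def by auto
    moreover have "(g k, g (Suc k)) \<in> r" if k: "k < n - (j - i)" for k
    proof (cases "k < i")
      case True
      then show ?thesis using f ij unfolding g_def by auto
    next
      case False
      then have "g k = f (k + (j - i))" "g (Suc k) = f (Suc (k + (j - i)))"
        using e ij unfolding g_def by (auto simp: not_less_eq_eq)
      then show ?thesis using f(3) k by auto
    qed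
    ultimately have "(a,a) \<in> r ^^ (n - (j - i))" unfolding relpow_fun_conv by blast
    then show False using least[of "n - (j - i)"] ij by linarith
  qed
  then have inj: "inj_on f {..<n}" unfolding inj_on_def by (metis lessThan_iff linorder_neqE_nat)
  define S where "S = f ` {..<n}"
  define s where "s x = f (Suc (the_inv_into {..<n} f x))" for x
  have s: "s (f i) = f (Suc i)" if "i < n" for i
    unfolding s_def using the_inv_into_f_f[OF inj] that by simp
  have "s ` S = S"
  proof (intro equalityI subsetI)
    fix x assume "x \<in> s ` S"
    then obtain i where i: "i < n" "x = f (Suc i)" using s unfolding S_def by auto
    show "x \<in> S"
    proof (cases "Suc i = n")
      case True
      then have "x = f 0" using i f by simp
      then show ?thesis unfolding S_def using n(1) by blast
    next
      case False
      then show ?thesis unfolding S_def using i by auto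
    qed
  next
    fix x assume "x \<in> S"
    then obtain i where i: "i < n" "x = f i" unfolding S_def by blast
    have "\<exists>j<n. f (Suc j) = x"
    proof (cases i)
      case 0
      then show ?thesis using i f n(1) by (intro exI[of _ "n - 1"]) simp
    next
      case (Suc j)
      then show ?thesis using i by (intro exI[of _ j]) simp
    qed
    then show "x \<in> s ` S" unfolding S_def using s by (metis imageI lessThan_iff)
  qed
  moreover have fS: "finite S" unfolding S_def by simp
  ultimately have "bij_betw s S S" unfolding bij_betw_def using eq_card_imp_inj_on[OF fS, of s] by simp
  moreover have "a \<in> S" unfolding S_def using f(1) n(1) by (metis imageI lessThan_iff)
  moreover have "\<forall>x\<in>S. (x, s x) \<in> r" using f(3) s unfolding S_def by auto
  ultimately show ?thesis using fS by blast
qed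

text \<open>The step from \<open>w\<close> to \<open>f w\<close> runs outside \<open>M\<close>, the
  step from \<open>f w\<close> to \<open>s w\<close> along \<open>M\<close>. The edge of
  \<open>M\<close> at \<open>f w\<close> determines \<open>s w\<close>, so \<open>f\<close> is
  injective because \<open>s\<close> is, and the new edges are disjoint.\<close>

lemma alternating_cycle:
  assumes M: "dimer_covering W M" and S: "bij_betw s S S" "S \<inter> f ` S = {}"
    and e: "\<And>w. w \<in> S \<Longrightarrow> {w, f w} \<in> induced_edges W" "\<And>w. w \<in> S \<Longrightarrow> {f w, s w} \<in> M"
    and ne: "\<And>w. w \<in> S \<Longrightarrow> s w \<noteq> w"
  defines "c \<equiv> (\<lambda>w. {w, f w}) ` S \<union> (\<lambda>w. {f w, s w}) ` S"
  shows "dimer_covering W (sym_diff M c)"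
proof -
  define A where "A = (\<lambda>w. {f w, s w}) ` S"
  define B where "B = (\<lambda>w. {w, f w}) ` S"
  have inj: "w = w'" if "w \<in> S" "w' \<in> S" "f w = f w'" for w w'
  proof -
    have "s w = s w'" using cov_pair[OF M e(2)[OF that(1)]] e(2)[OF that(2)] that(3) by simp
    then show ?thesis using S(1) that unfolding bij_betw_def inj_on_def by blast
  qed
  have BM: "b \<notin> M" if "b \<in> B" for b
  proof
    assume b: "b \<in> M"
    obtain w where w: "w \<in> S" "b = {w, f w}" using \<open>b \<in> B\<close> unfolding B_def by blast
    then have "{f w, w} \<in> M" using b by (simp add: insert_commute)
    then show False using cov_pair[OF M e(2)[OF w(1)]] ne[OF w(1)] by blast
  qed
  have "dimer_covering W (M - A \<union> B)"
  proof (rule cov_replace[OF M])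
    show "A \<subseteq> M" unfolding A_def using e(2) by blast
    show "B \<subseteq> induced_edges W" unfolding B_def using e(1) by blast
    have UA: "\<Union>A = f ` S \<union> s ` S" unfolding A_def by auto
    have UB: "\<Union>B = f ` S \<union> S" unfolding B_def by auto
    have "s ` S = S" using S(1) unfolding bij_betw_def by blast
    then show "\<Union>A = \<Union>B" unfolding UA UB by simp
    fix v b b' assume b: "b \<in> B" "b' \<in> B" "v \<in> b" "v \<in> b'"
    obtain w where w: "w \<in> S" "b = {w, f w}" using b(1) unfolding B_def by blast
    obtain w' where w': "w' \<in> S" "b' = {w', f w'}" using b(2) unfolding B_def by blast
    have "w = w'"
    proof (cases "v \<in> S")
      case True
      then have "v = w" "v = w'" using b w w' S(2) by auto
      then show ?thesis by simp
    next
      case False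
      then have "v = f w" "v = f w'" using b w w' by auto
      then show ?thesis using inj w w' by blast
    qed
    then show "b = b'" using w w' by simp
  qed
  moreover have "sym_diff M c = M - A \<union> B"
  proof -
    have "A \<subseteq> M" unfolding A_def using e(2) by blast
    then show ?thesis unfolding c_def A_def[symmetric] B_def[symmetric] using BM by blast
  qed
  ultimately show ?thesis by simp
qed

text \<open>The circuit closes up a walk through the chord \<open>{v,u}\<close>: otherwise the vertices reachable from
  the chord contradict the previous count.\<close>

lemma split_circuit:
  assumes fW: "finite W" and c: "config W M D" and b: "circuit (bd D)" "bd D \<subseteq> E1"
    and f0: "f0 \<in> bd D" "v \<in> f0" and vu: "{v,u} \<in> E1" "{v,u} \<in> edges_of D" "{v,u} \<notin> bd D"
  shows "\<exists>c. circuit c \<and> c \<subseteq> E1 \<and> c \<subseteq> edges_of D \<and> c \<inter> bd D \<noteq> {} \<and> c \<noteq> bd D \<and>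
     dimer_covering W (sym_diff M c)"
proof -
  let ?M2 = "sym_diff M (bd D)"
  note cM = configD(1)[OF c] and cM2 = configD(2)[OF c] and DT = configD(5)[OF c]
  have fD: "finite D" using configD(3)[OF c] TW_finite[OF fW] finite_subset by blast
  \<comment> \<open>The colour class of \<open>v\<close>, which may be white or black. Walks are
    recorded by their vertices in this class.\<close>
  define K where "K = (if v \<in> V3 then V3 else Z2)"
  have vK: "v \<in> K" "u \<notin> K" using E1_colours[OF vu(1)] white_not_black[of u] white_not_black[of v] unfolding K_def by auto
  have KE: "q \<notin> K" if "{p,q} \<in> E1" "p \<in> K" for p q
    using E1_colours[OF that(1)] that(2) white_not_black[of p] white_not_black[of q] unfolding K_def by (auto split: if_splits)
  have KE2: "q \<in> K" if "{p,q} \<in> E1" "p \<notin> K" for p q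
    using E1_colours[OF that(1)] that(2) white_not_black[of p] white_not_black[of q] unfolding K_def by (auto split: if_splits)
  have spoke: "{p,q} \<in> E1" if t: "t \<in> D" "p \<in> t" and e: "{p,q} \<in> M \<or> {p,q} \<in> ?M2" for p q t
  proof (cases "{p,q} \<in> bd D")
    case False
    then have m: "{p,q} \<in> M" using e by blast
    have "{p,q} \<notin> E2" using impurity_on_bd[OF c t m] False by blast
    then show ?thesis using cov_edges[OF cM m] by blast
  qed (use b in blast)
  have DEv: "\<exists>t\<in>D. p \<in> t \<and> q \<in> t" if "{p,q} \<in> edges_of D" for p q
    using that unfolding edges_of_def by blast
  \<comment> \<open>One step is a spoke of \<open>D\<close> followed by the edge of \<open>M\<close>
    at its far end. From \<open>v\<close> the chord is the only permitted exit, so every closed walk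
    through \<open>v\<close> contains it.\<close>
  define r where "r = {(p,p'). p \<in> K \<and> p' \<in> K \<and> p \<noteq> p' \<and>
      (\<exists>q. {p,q} \<in> E1 \<and> {p,q} \<in> edges_of D \<and> {q,p'} \<in> M \<and> (p = v \<longrightarrow> q = u))}"
  have rD: "p \<in> K \<and> p' \<in> K \<and> p \<noteq> p' \<and>
      (\<exists>q. {p,q} \<in> E1 \<and> {p,q} \<in> edges_of D \<and> {q,p'} \<in> M \<and> (p = v \<longrightarrow> q = u))" if "(p,p') \<in> r" for p p'
    using that unfolding r_def by simp
  obtain tu where tu: "tu \<in> D" "v \<in> tu" "u \<in> tu" using DEv[OF vu(2)] by blast
  have uW: "u \<in> W" using D_vertex[OF c tu(1,3)] .
  obtain v1 where v1: "{u,v1} \<in> M" using cov_mate[OF cM uW] by blast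
  have v1E: "{u,v1} \<in> E1" using spoke[OF tu(1,3)] v1 by blast
  have v1K: "v1 \<in> K" using KE2[OF v1E vK(2)] .
  have "{v,u} \<notin> M"
  proof
    assume "{v,u} \<in> M"
    then have "{v,u} \<in> bd D" using bd_at[OF c _ _ f0] by blast
    then show False using vu(3) by blast
  qed
  then have v1v: "v1 \<noteq> v" using v1 by (metis insert_commute)
  have rv: "(v,v1) \<in> r" unfolding r_def using vK v1K v1v vu v1 by blast
  have "(v1,v) \<in> r\<^sup>*"
  proof (rule ccontr)
    assume no: "(v1,v) \<notin> r\<^sup>*"
    define L where "L = {p. (v1,p) \<in> r\<^sup>*}"
    define B where "B = {b. \<exists>l\<in>L. {l,b} \<in> E1 \<and> {l,b} \<in> edges_of D}"
    have mD: "{q,p} \<in> edges_of D" if "{p0,q} \<in> edges_of D" "{q,p} \<in> M" for p0 p q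
      using DEv[OF that(1)] D_edge[OF c, of _ q "{q,p}"] that(2) by blast
    have v1D: "{u,v1} \<in> edges_of D" using mD[OF vu(2) v1] .
    have LD: "p \<in> K \<and> (\<exists>t\<in>D. p \<in> t)" if "p \<in> L" for p
    proof -
      have "(v1,p) \<in> r\<^sup>*" using that unfolding L_def by blast
      then show ?thesis
      proof (cases rule: rtranclE)
        case base
        then show ?thesis using v1K DEv[OF v1D] by blast
      next
        case (step y)
        then obtain q where q: "p \<in> K" "{y,q} \<in> edges_of D" "{q,p} \<in> M" unfolding r_def by blast
        then show ?thesis using DEv[OF mD[OF q(2,3)]] by blast
      qed
    qed
    have vL: "v \<notin> L" using no unfolding L_def by blast
    have "L \<subseteq> W" using LD D_vertex[OF c] by blast
    then have fL: "finite L" using fW finite_subset by blast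
    have uB: "u \<in> B"
    proof -
      have "v1 \<in> L" unfolding L_def by simp
      moreover have "{v1,u} \<in> E1" "{v1,u} \<in> edges_of D" using v1E v1D by (simp_all add: insert_commute)
      ultimately show ?thesis unfolding B_def by blast
    qed
    have "v \<in> L"
    proof (rule closure_count[OF c fL _ B_def _ _ _ fD uB vu(1)])
      fix l assume "l \<in> L" then show "\<exists>t\<in>D. l \<in> t" using LD by blast
    next
      fix l q assume "l \<in> L" "{l,q} \<in> M \<or> {l,q} \<in> ?M2"
      then show "{l,q} \<in> E1" using LD spoke by blast
    next
      fix q assume "q \<in> B"
      then obtain l where l: "l \<in> L" "{l,q} \<in> E1" "{l,q} \<in> edges_of D" unfolding B_def by blast
      obtain t where t: "t \<in> D" "q \<in> t" using DEv[OF l(3)] by blast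
      obtain p where p: "{q,p} \<in> M" using cov_mate[OF cM D_vertex[OF c t]] by blast
      have pE: "{q,p} \<in> E1" using spoke[OF t] p by blast
      have lK: "l \<in> K" using LD l by blast
      have "p \<in> K" using KE2[OF pE KE[OF l(2) lK]] .
      then have "p = l \<or> (l,p) \<in> r" unfolding r_def using lK l p vL by blast
      then have "p \<in> L" using l(1) unfolding L_def by (auto intro: rtrancl_into_rtrancl)
      then show "\<exists>l\<in>L. {l,q} \<in> M" using p by (metis insert_commute)
    next
      fix X assume X: "X \<subseteq> bd D" "even_set X" "X \<subseteq> E1" "\<Union>X \<subseteq> L \<union> B"
      \<comment> \<open>The colours keep \<open>v\<close> out of \<open>B\<close>. An even part of
        the boundary inside \<open>L \<union> B\<close> therefore misses \<open>f0\<close>, and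
        since \<open>bd D\<close> is a circuit it is empty.\<close>
      have "v \<notin> B" using KE LD vK(1) unfolding B_def by blast
      then have "f0 \<notin> X" using X(4) f0(2) vL by blast
      then show "X = {}" using b(1) X f0(1) unfolding circuit_def by blast
    qed
    then show False using vL by blast
  qed
  then have vv: "(v,v) \<in> r\<^sup>+" using rv by (rule rtrancl_into_trancl2[rotated])
  obtain S s where S: "finite S" "v \<in> S" "bij_betw s S S" "\<forall>x\<in>S. (x, s x) \<in> r"
    using cycle_permutation[OF vv] by (elim exE conjE) (rule that)
  define f where "f p = (SOME q. {p,q} \<in> E1 \<and> {p,q} \<in> edges_of D \<and> {q,s p} \<in> M \<and> (p = v \<longrightarrow> q = u))" for p
  have f: "{p,f p} \<in> E1 \<and> {p,f p} \<in> edges_of D \<and> {f p,s p} \<in> M \<and> (p = v \<longrightarrow> f p = u)" if "p \<in> S" for p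
  proof -
    have "\<exists>q. {p,q} \<in> E1 \<and> {p,q} \<in> edges_of D \<and> {q,s p} \<in> M \<and> (p = v \<longrightarrow> q = u)"
      using rD[OF bspec[OF S(4) that]] by simp
    then show ?thesis unfolding f_def by (rule someI_ex)
  qed
  have SK: "p \<in> K \<and> s p \<noteq> p" if "p \<in> S" for p using rD[OF bspec[OF S(4) that]] by metis
  define c1 where "c1 = (\<lambda>w. {w, f w}) ` S \<union> (\<lambda>w. {f w, s w}) ` S"
  have DEW: "e \<in> induced_edges W" if "e \<in> edges_of D" for e
    using that configD(3)[OF c] unfolding edges_of_def induced_edges_def TW_def by blast
  have cov1: "dimer_covering W (sym_diff M c1)"
    unfolding c1_def
  proof (rule alternating_cycle[OF cM S(3)])
    have fK: "f p \<notin> K" if "p \<in> S" for p using KE f[OF that] SK[OF that] by metis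
    show "S \<inter> f ` S = {}"
    proof (rule equals0I)
      fix x assume x: "x \<in> S \<inter> f ` S"
      then obtain p where "p \<in> S" "x = f p" by blast
      then show False using fK[of p] SK[of x] x by blast
    qed
    fix w assume w: "w \<in> S"
    show "{w, f w} \<in> induced_edges W" using DEW f[OF w] by metis
    show "{f w, s w} \<in> M" using f[OF w] by metis
    show "s w \<noteq> w" using SK[OF w] by metis
  qed
  have "even_set (sym_diff M (sym_diff M c1))" by (rule cov_sym_diff_even_set[OF fW cM cov1])
  moreover have sd: "sym_diff M (sym_diff M c1) = c1" by blast
  ultimately have ev1: "even_set c1" by simp
  have "f v = u" using f[OF S(2)] by blast
  then have vuc: "{v,u} \<in> c1" unfolding c1_def using S(2) by blast
  obtain c' where c': "c' \<subseteq> c1" "circuit c'" "{v,u} \<in> c'" using circuit_through[OF ev1 vuc] by blast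
  have c1E: "e \<in> E1 \<and> e \<in> edges_of D" if "e \<in> c1" for e
  proof -
    have "{f w, s w} \<in> E1 \<and> {f w, s w} \<in> edges_of D" if w: "w \<in> S" for w
    proof -
      obtain t where t: "t \<in> D" "f w \<in> t" using DEv f[OF w] by blast
      then show ?thesis using spoke[OF t] D_edge[OF c t] f[OF w] by blast
    qed
    then show ?thesis using that f unfolding c1_def by blast
  qed
  have cov': "dimer_covering W (sym_diff M c')"
    by (rule cov_sub[OF cM cov1]) (use c' sd in \<open>auto simp: circuit_def\<close>)
  \<comment> \<open>The circuit contains the chord at \<open>v\<close>, which is not in
    \<open>M\<close>, and so it also contains the edge of \<open>M\<close> at \<open>v\<close>; that
    edge runs along the boundary.\<close>
  have "c' \<inter> bd D \<noteq> {}"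
  proof -
    have vW: "v \<in> W" using D_vertex[OF c tu(1,2)] .
    obtain m where m: "{v,m} \<in> M" using cov_mate[OF cM vW] by blast
    then have mb: "{v,m} \<in> bd D" using bd_at[OF c _ _ f0] by blast
    have "{v,u} \<in> sym_diff M c'" using c'(3) \<open>{v,u} \<notin> M\<close> by blast
    have "{v,m} \<in> c'"
    proof (rule ccontr)
      assume "{v,m} \<notin> c'"
      then have "{v,m} \<in> sym_diff M c'" using m by blast
      then have "m = u" using cov_pair[OF cov' _ \<open>{v,u} \<in> sym_diff M c'\<close>] by blast
      then show False using mb vu(3) by blast
    qed
    then show ?thesis using mb by blast
  qed
  moreover have "c' \<noteq> bd D" using c'(3) vu(3) by blast
  ultimately show ?thesis using c'(1,2) c1E cov' by (intro exI[of _ c']) blast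
qed

text \<open>The first homology mod 2 of the region vanishes: the form in which a region without
  holes is used for rotations.\<close>

definition fillable :: "point set \<Rightarrow> bool" where
  "fillable W \<longleftrightarrow> (\<forall>X\<subseteq>induced_edges W. even_set X \<longrightarrow> (\<exists>D\<subseteq>TW W. bd D = X))"

lemma edges_of_induced: "D \<subseteq> TW W \<Longrightarrow> edges_of D \<subseteq> induced_edges W"
  unfolding edges_of_def induced_edges_def TW_def by blast

lemma edges_ofI: "e \<in> E1 \<union> E2 \<Longrightarrow> t \<in> D \<Longrightarrow> e \<subseteq> t \<Longrightarrow> e \<in> edges_of D"
  unfolding edges_of_def by blast

text \<open>A circuit of spokes moves no impurity, so the condition on interior impurities passes to
  both pieces. Its filling lies in \<open>D\<close> because \<open>D\<close> has no holes, and
  contact with \<open>bd D\<close> keeps the remainder free of holes.\<close>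

lemma split_config:
  assumes fW: "finite W" and sc: "fillable W" and cf: "config W M D" and c: "circuit c" "c \<subseteq> edges_of D" "c \<subseteq> E1"
    "c \<inter> bd D \<noteq> {}" "dimer_covering W (sym_diff M c)"
  obtains D' where "D' \<subseteq> D" "bd D' = c" "D' \<noteq> {}" "config W M D'" "config W (sym_diff M c) (D - D')"
    "sym_diff (sym_diff M c) (bd (D - D')) = sym_diff M (bd D)" "bd (D - D') = sym_diff (bd D) c"
proof -
  note D = configD(3)[OF cf] and DT = configD(5)[OF cf]
  have "c \<subseteq> induced_edges W" using c(2) edges_of_induced[OF D] by blast
  then have "\<exists>D'\<subseteq>TW W. bd D' = c" using sc c(1) unfolding fillable_def circuit_def by simp
  then obtain D' where D': "D' \<subseteq> TW W" "bd D' = c" by blast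
  have sub: "D' \<subseteq> D" using hole_free_inside[OF configD(4)[OF cf] D D'(1)] D'(2) c(2) by blast
  have fD': "finite D'" using D'(1) TW_finite[OF fW] finite_subset by blast
  have ne: "D' \<noteq> {}" using D'(2) c(1) unfolding circuit_def by auto
  have cir: "circuit (bd D')" using c(1) D'(2) by simp
  have bdd: "bd (D - D') = sym_diff (bd D) c" using bd_Diff[OF DT sub] D'(2) by simp
  have eq: "sym_diff (sym_diff M c) (bd (D - D')) = sym_diff M (bd D)" unfolding bdd by blast
  have c1: "config W M D'"
    unfolding config_def D'(2)
  proof (intro conjI ballI)
    show "\<exists>t\<in>Tri. e \<subseteq> t \<and> t \<notin> D'" if "e \<in> M \<inter> E2" for e using configD(6)[OF cf] that sub by blast
  qed (use configD(1)[OF cf] c(5) D'(1) hole_free_circuit[OF fW D'(1) cir] in auto)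
  have c2: "config W (sym_diff M c) (D - D')"
    unfolding config_def eq
  proof (intro conjI ballI)
    show "\<exists>t\<in>Tri. e \<subseteq> t \<and> t \<notin> D - D'" if "e \<in> sym_diff M c \<inter> E2" for e
    proof -
      have "e \<in> M" "e \<in> E2" using that c(3) E1_E2_disjoint by blast+
      then show ?thesis using configD(6)[OF cf] by blast
    qed
    obtain e0 where "e0 \<in> c" "e0 \<in> bd D" using c(4) by blast
    then show "hole_free W (D - D')"
      using hole_free_Diff[OF configD(4)[OF cf] D sub circuit_connected[OF fD' _ cir]] D' TW_Tri by blast
  qed (use c(5) configD(2)[OF cf] D in auto)
  show ?thesis by (rule that[OF sub D'(2) ne c1 c2 eq bdd])
qed

text \<open>Cutting along a circuit of spokes gives two smaller rotations whose costs add up. If no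
  cut exists, \<open>bd D\<close> is a circuit without chords, and such a \<open>D\<close> consists
  of the two triangles of a square move.\<close>

lemma rotate_spokes:
  assumes fW: "finite W" and sc: "fillable W"
  shows "config W M D \<Longrightarrow> bd D \<subseteq> E1 \<Longrightarrow> reach W (card D) M (sym_diff M (bd D))"
proof (induction "card D" arbitrary: M D rule: less_induct)
  case less
  note cf = less.prems(1) and bE = less.prems(2)
  note cM = configD(1)[OF cf] and cM2 = configD(2)[OF cf] and DT = configD(5)[OF cf]
  have fD: "finite D" using configD(3)[OF cf] TW_finite[OF fW] finite_subset by blast
  show ?case
  proof (cases "\<exists>c. circuit c \<and> c \<subseteq> E1 \<and> c \<subseteq> edges_of D \<and> c \<inter> bd D \<noteq> {} \<and> c \<noteq> bd D \<and>
     dimer_covering W (sym_diff M c)")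
    case True
    then obtain c where c: "circuit c" "c \<subseteq> edges_of D" "c \<subseteq> E1" "c \<inter> bd D \<noteq> {}"
       "dimer_covering W (sym_diff M c)" and ne: "c \<noteq> bd D" by blast
    obtain D' where D': "D' \<subseteq> D" "bd D' = c" "D' \<noteq> {}" "config W M D'" "config W (sym_diff M c) (D - D')"
    "sym_diff (sym_diff M c) (bd (D - D')) = sym_diff M (bd D)" "bd (D - D') = sym_diff (bd D) c"
      by (rule split_config[OF fW sc cf c])
    have psub: "D' \<subset> D" using D'(1,2) ne by blast
    have l1: "card D' < card D" using psub fD by (rule psubset_card_mono[rotated])
    have cd: "card D = card D' + card (D - D')" using D'(1) fD
      by (metis card_Diff_subset card_mono finite_subset le_add_diff_inverse)
    have "card D' > 0" using D'(3) D'(1) fD finite_subset card_gt_0_iff by blast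
    then have l2: "card (D - D') < card D" using cd by simp
    have "reach W (card D') M (sym_diff M c)" using less.hyps[OF l1 D'(4)] D'(2) c(3) by simp
    moreover have "reach W (card (D - D')) (sym_diff M c) (sym_diff M (bd D))"
    proof -
      have "bd (D - D') \<subseteq> E1" unfolding D'(7) using bE c(3) by blast
      from less.hyps[OF l2 D'(5) this] show ?thesis unfolding D'(6) .
    qed
    ultimately show ?thesis unfolding cd by (rule reach_trans)
  next
    case noc: False
    show ?thesis
    proof (cases "D = {}")
      case True
      then show ?thesis using reach_refl by simp
    next
      case Dne: False
      have ev: "even_set (bd D)" using bd_even_set[OF fD DT] .
      have bne: "bd D \<noteq> {}" using bd_eq_empty[OF fD DT] Dne by blast
      have sdM: "sym_diff M (sym_diff M (bd D)) = bd D" by blast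
      have cir: "circuit (bd D)"
        unfolding circuit_def
      proof (intro conjI allI impI ev bne)
        fix X assume X: "X \<subseteq> bd D" "even_set X"
        show "X = {} \<or> X = bd D"
        proof (rule ccontr)
          assume n: "\<not> (X = {} \<or> X = bd D)"
          then obtain g where "g \<in> X" by blast
          then obtain c where c: "c \<subseteq> X" "circuit c" using circuit_through[OF X(2)] by blast
          have "dimer_covering W (sym_diff M c)"
            by (rule cov_sub[OF cM cM2]) (use c X sdM in \<open>auto simp: circuit_def\<close>)
          moreover have "c \<noteq> bd D" using n c X by blast
          moreover have "c \<inter> bd D \<noteq> {}" using c X unfolding circuit_def by blast
          ultimately show False using noc c X bE bd_edges_of by blast
        qed
      qed
      have nochord: "{v,u} \<in> bd D" if "f0 \<in> bd D" "v \<in> f0" "{v,u} \<in> E1" "{v,u} \<in> edges_of D" for f0 v u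
      proof (rule ccontr)
        assume n: "{v,u} \<notin> bd D"
        show False using split_circuit[OF fW cf cir bE that n] by (rule notE[OF noc])
      qed
      obtain e where e: "e \<in> bd D" using bne by blast
      then have "e \<in> E1" using bE by blast
      then obtain z x0 where zx: "e = {z,x0}" "cor z x0" by (rule E1E)
      obtain t where t: "t \<in> D" "e \<subseteq> t" using bd_edge_tri[OF e] by blast
      have zV: "z \<in> V3" using cor_white zx(2) .
      have zt: "z \<in> t" "t \<in> Tri" using t zx DT by auto
      obtain p q where pq: "t = {z,p,q}" "sq z p q" by (rule white_tri[OF zV zt(2,1)])
      define w where "w = other z p q"
      have sw: "sq w p q" unfolding w_def using sq_other[OF pq(2)] .
      \<comment> \<open>A side is not on a boundary made of spokes, so \<open>D\<close> continues
        across it. The four outer spokes of the two triangles start at boundary vertices; in the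
        absence of chords they lie on the boundary, and by minimality they exhaust it.\<close>
      have "{p,q} \<notin> bd D" using tri_edges(3)[OF pq(2)] bE E1_E2_disjoint by blast
      then have t2: "{w,p,q} \<in> D" using bd_side[OF DT pq(2)] t(1) unfolding pq(1) w_def by blast
      have zp: "{z,p} \<in> bd D" "{z,q} \<in> bd D"
        using nochord[OF e, of z] zx(1) tri_edges[OF pq(2)] t(1) unfolding edges_of_def pq(1) by blast+
      have "{p,w} \<in> E1" "{q,w} \<in> E1" using tri_edges[OF sw] by (simp_all add: insert_commute)
      moreover have "{p,w} \<in> edges_of D" "{q,w} \<in> edges_of D" using calculation by (auto intro!: edges_ofI[OF _ t2])
      ultimately have "{p,w} \<in> bd D" "{q,w} \<in> bd D" using nochord[OF zp(1), of p w] nochord[OF zp(2), of q w] by simp_all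
      then have wp: "{w,p} \<in> bd D" "{w,q} \<in> bd D" by (simp_all add: insert_commute)
      define R where "R = {{z,p,q},{w,p,q}}"
      have bR: "bd R = {{z,p},{z,q},{w,p},{w,q}}" unfolding R_def w_def by (rule bd_square[OF pq(2)])
      have R: "finite R" "R \<subseteq> Tri" unfolding R_def using TriI[OF pq(2)] TriI[OF sw] by simp_all
      have "bd R \<subseteq> bd D" unfolding bR using zp wp by simp
      moreover have "bd R \<noteq> {}" unfolding bR by simp
      ultimately have "bd R = bd D" using cir bd_even_set[OF R] unfolding circuit_def by blast
      then have DR: "D = R" using bd_inj[OF R fD DT] by simp
      have "(M, sym_diff M (bd D)) \<in> local_move W"
        by (rule square_move[OF pq(2) cM cM2]) (simp only: DR bR w_def)
      then have "reach W 1 M (sym_diff M (bd D))" by (rule reach_step)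
      moreover have "1 \<le> card D" using fD Dne by (simp add: Suc_le_eq card_gt_0_iff)
      ultimately show ?thesis by (rule reach_mono)
    qed
  qed
qed

section \<open>Rotating circuits with impurities\<close>

lemma slide_cov:
  assumes s: "sq z x y" and M: "dimer_covering W M" and e: "{x,y} \<in> M" "{z,opp z x} \<in> M"
  shows "dimer_covering W (sym_diff M (bd {{z,x,y},{z,y,opp z x}}))"
    "(M, sym_diff M (bd {{z,x,y},{z,y,opp z x}})) \<in> local_move W"
    "{y,opp z x} \<notin> M" "{z,x} \<notin> M"
proof -
  define a where "a = opp z x"
  have n: "x \<noteq> y" "z \<noteq> x" "z \<noteq> y" "a \<noteq> x" "a \<noteq> y" "z \<noteq> a" using sq_neqs[OF s] unfolding a_def by blast+
  have ea: "{z,a} \<in> M" using e(2) unfolding a_def .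
  have sa: "sq z a y" unfolding a_def using sq_opp[OF s] .
  have 1: "{y,a} \<notin> M"
  proof
    assume "{y,a} \<in> M"
    moreover have "{y,x} \<in> M" using e(1) by (simp add: insert_commute)
    ultimately show False using cov_pair[OF M] n by blast
  qed
  have 2: "{z,x} \<notin> M" using cov_pair[OF M ea] n by blast
  show "{y,opp z x} \<notin> M" "{z,x} \<notin> M" using 1 2 unfolding a_def by auto
  let ?Q = "{{x,y},{y,a},{z,x},{z,a}}"
  have eq: "sym_diff M ?Q = M - {{x,y},{z,a}} \<union> {{y,a},{z,x}}"
    by (rule sym_diff_swap[OF e(1) ea 1 2]) (simp add: insert_commute)
  have W: "x \<in> W" "y \<in> W" "z \<in> W" "a \<in> W" using cov_edges[OF M e(1)] cov_edges[OF M ea] by auto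
  have c: "dimer_covering W (sym_diff M ?Q)"
    unfolding eq
  proof (rule cov_replace[OF M])
    show "{{x,y},{z,a}} \<subseteq> M" using e(1) ea by simp
    have "{y,a} \<in> E2" using tri_edges(3)[OF sa] by (simp add: insert_commute)
    then show "{{y,a},{z,x}} \<subseteq> induced_edges W"
      unfolding induced_edges_def using tri_edges(1)[OF s] W by simp
    show "\<Union>{{x,y},{z,a}} = \<Union>{{y,a},{z,x}}" by auto
    fix v f g assume "f \<in> {{y,a},{z,x}}" "g \<in> {{y,a},{z,x}}" "v \<in> f" "v \<in> g"
    then show "f = g" using n by auto
  qed
  have b: "bd {{z,x,y},{z,y,opp z x}} = ?Q" unfolding a_def by (rule bd_slide[OF s])
  show "dimer_covering W (sym_diff M (bd {{z,x,y},{z,y,opp z x}}))" unfolding b by (rule c)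
  then show "(M, sym_diff M (bd {{z,x,y},{z,y,opp z x}})) \<in> local_move W"
    by (rule slide_move[OF s M]) (simp only: b a_def)
qed

lemma slide_new_impurity:
  assumes s: "sq z x y" and e: "e \<in> sym_diff M (bd {{z,x,y},{z,y,opp z x}})" "e \<in> E2" "e \<notin> M"
  shows "e = {y,opp z x} \<or> e = {x,y}"
proof -
  have "e \<in> {{x,y},{y,opp z x},{z,x},{z,opp z x}}" using e(1,3) unfolding bd_slide[OF s] by blast
  moreover have "{z,x} \<notin> E2" "{z,opp z x} \<notin> E2"
    using E1_E2_disjoint tri_edges[OF s] tri_edges[OF sq_opp[OF s]] by blast+
  ultimately show ?thesis using e(2) by auto
qed

text \<open>The two triangles swept by the slide leave \<open>D\<close>. They hang together across
  the spoke \<open>{z,y}\<close> and touch the boundary along \<open>{x,y}\<close>, as the removal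
  of a piece requires.\<close>

lemma slide_config:
  assumes cf: "config W M D" and s: "sq z x y" and e: "{x,y} \<in> M" "{z,opp z x} \<in> M"
    and b: "{x,y} \<in> bd D" and t: "{z,x,y} \<in> D" "{z,y,opp z x} \<in> D"
  defines "R \<equiv> {{z,x,y},{z,y,opp z x}}"
  shows "config W (sym_diff M (bd R)) (D - R)"
    "sym_diff (sym_diff M (bd R)) (bd (D - R)) = sym_diff M (bd D)"
proof -
  have R: "R \<subseteq> D" unfolding R_def using t by simp
  note D = configD(3)[OF cf] and DT = configD(5)[OF cf]
  show eq: "sym_diff (sym_diff M (bd R)) (bd (D - R)) = sym_diff M (bd D)"
    unfolding bd_Diff[OF DT R] by blast
  have bR: "bd R = {{x,y},{y,opp z x},{z,x},{z,opp z x}}" unfolding R_def by (rule bd_slide[OF s])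
  have n: "x \<noteq> y" "z \<noteq> x" "z \<noteq> y" "opp z x \<noteq> x" "opp z x \<noteq> y" "z \<noteq> opp z x" using sq_neqs[OF s] by blast+
  have zy: "{z,y} \<notin> bd R" unfolding bR using n by (auto simp: doubleton_eq_iff)
  have s': "sq z y (opp z x)" using sq_sym[OF sq_opp[OF s]] .
  show "config W (sym_diff M (bd R)) (D - R)"
    unfolding config_def eq
  proof (intro conjI ballI)
    show "dimer_covering W (sym_diff M (bd R))" unfolding R_def by (rule slide_cov[OF s configD(1)[OF cf] e])
    show "dimer_covering W (sym_diff M (bd D))" by (rule configD(2)[OF cf])
    show "D - R \<subseteq> TW W" using D by blast
    show "\<exists>t\<in>Tri. f \<subseteq> t \<and> t \<notin> D - R" if f: "f \<in> sym_diff M (bd R) \<inter> E2" for f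
    proof (cases "f \<in> M")
      case True
      then show ?thesis using configD(6)[OF cf True] f by blast
    next
      case False
      then have "f = {y,opp z x} \<or> f = {x,y}" using slide_new_impurity[OF s] f unfolding R_def by blast
      then have "f \<subseteq> {z,y,opp z x}" using False e(1) by auto
      then show ?thesis unfolding R_def using TriI[OF s'] by blast
    qed
    show "hole_free W (D - R)"
    proof (rule hole_free_Diff[OF configD(4)[OF cf] D R])
      fix Y assume Y: "Y \<subseteq> R" "bd Y \<subseteq> bd R"
      have "Y \<noteq> {{z,x,y}}" using Y(2) zy bd_single[OF s] by blast
      moreover have "Y \<noteq> {{z,y,opp z x}}" using Y(2) zy bd_single[OF s'] by blast
      ultimately show "Y = {} \<or> Y = R" using Y(1) unfolding R_def by blast
    next
      show "{x,y} \<in> bd R" unfolding bR by simp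
    qed (rule b)
  qed
qed

section \<open>Impurities whose slide leaves the rotated set\<close>

text \<open>An impurity on the boundary of \<open>D\<close> whose slide through \<open>z\<close> leaves \<open>D\<close>.\<close>

definition stuck :: "point set set \<Rightarrow> point set set \<Rightarrow> point \<Rightarrow> point \<Rightarrow> point \<Rightarrow> bool" where
  "stuck M D z x y \<longleftrightarrow> sq z x y \<and> {z,x,y} \<in> D \<and> {x,y} \<in> M \<and> {z,opp z x} \<in> M \<and> {z,y,opp z x} \<notin> D"

lemma stuckD:
  assumes "stuck M D z x y"
  shows "sq z x y" "{z,x,y} \<in> D" "{x,y} \<in> M" "{z,opp z x} \<in> M" "{z,y,opp z x} \<notin> D"
  using assms unfolding stuck_def by blast+

text \<open>The impurity occupies \<open>x\<close> and \<open>y\<close>, so \<open>z\<close> is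
  matched to the corner opposite to one of them; exchanging the names makes it
  \<open>opp z x\<close>.\<close>

lemma impurity_site:
  assumes cf: "config W M D" and e: "e \<in> M" "e \<in> E2" "e \<in> bd D"
  obtains z x y where "sq z x y" "e = {x,y}" "{z,x,y} \<in> D" "{z,opp z x} \<in> M"
proof -
  note cM = configD(1)[OF cf] and DT = configD(5)[OF cf]
  obtain z0 x y where e0: "e = {x,y}" "sq z0 x y" using e(2) by (rule E2E)
  obtain t where t: "t \<in> D" "e \<subseteq> t" using bd_edge_tri[OF e(3)] by blast
  have "t \<in> {t \<in> Tri. {x,y} \<subseteq> t}" using t DT e0 by blast
  then have "t = {z0,x,y} \<or> t = {other z0 x y,x,y}" unfolding side_tri[OF e0(2)] by simp
  then obtain z where z: "sq z x y" "{z,x,y} \<in> D" using t(1) e0(2) sq_other[OF e0(2)] by blast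
  have zW: "z \<in> W" using D_vertex[OF cf z(2)] by simp
  obtain m where m: "{z,m} \<in> M" using cov_mate[OF cM zW] by blast
  have "cor z m" using white_edge cov_edges[OF cM m] sqD(4)[OF z(1)] by blast
  then have "m = x \<or> m = y \<or> m = opp z x \<or> m = opp z y" using cor_cases[OF z(1)] by blast
  moreover have "m \<noteq> x"
  proof
    assume "m = x"
    then have "{x,z} \<in> M" "{x,y} \<in> M" using m e e0 by (simp_all add: insert_commute)
    then show False using cov_pair[OF cM] sq_neqs[OF z(1)] by blast
  qed
  moreover have "m \<noteq> y"
  proof
    assume "m = y"
    then have "{y,z} \<in> M" "{y,x} \<in> M" using m e e0 by (simp_all add: insert_commute)
    then show False using cov_pair[OF cM] sq_neqs[OF z(1)] by blast
  qed
  ultimately consider "m = opp z x" | "m = opp z y" by blast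
  then show ?thesis
  proof cases
    case 1
    then show ?thesis using that[OF z(1) e0(1) z(2)] m by simp
  next
    case 2
    have "e = {y,x}" "{z,y,x} \<in> D" using e0 z(2) by (simp_all add: insert_commute)
    then show ?thesis using that[OF sq_sym[OF z(1)]] m 2 by simp
  qed
qed

text \<open>The slide would cross the spoke \<open>{z,y}\<close> and leave \<open>D\<close>, so this
  spoke is on the boundary. Hence \<open>z\<close> and \<open>y\<close> are boundary vertices, where
  one edge of each covering runs along the boundary. Both boundary edges at \<open>y\<close> belong
  to the same triangle, so \<open>D\<close> has at \<open>y\<close> a tip consisting of that
  triangle alone.\<close>

lemma stuck_bd:
  assumes cf: "config W M D" and st: "stuck M D z x y"
  shows "{z,y} \<in> bd D" "{z,opp z x} \<in> bd D" "{x,y} \<in> bd D" "{z,x} \<notin> bd D" "{y,opp z x} \<notin> bd D"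
    "{z,x,opp z y} \<in> D"
    "\<And>f. f \<in> bd D \<Longrightarrow> y \<in> f \<Longrightarrow> f = {x,y} \<or> f = {z,y}"
    "\<And>t. t \<in> D \<Longrightarrow> y \<in> t \<Longrightarrow> t = {z,x,y}"
proof -
  note s = stuckD(1)[OF st] and cM = configD(1)[OF cf] and cM2 = configD(2)[OF cf] and DT = configD(5)[OF cf]
  have n: "x \<noteq> y" "z \<noteq> x" "z \<noteq> y" "opp z x \<noteq> x" "opp z x \<noteq> y" "z \<noteq> opp z x" using sq_neqs[OF s] by blast+
  have "{z,y,x} \<in> D" using stuckD(2)[OF st] by (simp add: insert_commute)
  then show zy: "{z,y} \<in> bd D" using bd_spoke[OF DT sq_sym[OF s]] stuckD(5)[OF st] by blast
  show za: "{z,opp z x} \<in> bd D" by (rule bd_at[OF cf _ _ zy, of _ z]) (use stuckD(4)[OF st] in auto)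
  show xy: "{x,y} \<in> bd D" by (rule bd_at[OF cf _ _ zy, of _ y]) (use stuckD(3)[OF st] in auto)
  have "{z,y} \<notin> M" using cov_pair[OF cM stuckD(4)[OF st]] n by blast
  then have zy2: "{z,y} \<in> sym_diff M (bd D)" using zy by blast
  have atz: "f = {z,opp z x} \<or> f = {z,y}" if "f \<in> bd D" "z \<in> f" for f
  proof (cases "f \<in> M")
    case True
    then show ?thesis using cov_unique[OF cM True stuckD(4)[OF st] that(2)] by blast
  next
    case False
    then have "f \<in> sym_diff M (bd D)" using that by blast
    then show ?thesis using cov_unique[OF cM2 _ zy2 that(2)] by blast
  qed
  show aty: "f = {x,y} \<or> f = {z,y}" if "f \<in> bd D" "y \<in> f" for f
  proof (cases "f \<in> M")
    case True
    then show ?thesis using cov_unique[OF cM True stuckD(3)[OF st] that(2)] by blast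
  next
    case False
    then have "f \<in> sym_diff M (bd D)" using that by blast
    then show ?thesis using cov_unique[OF cM2 _ zy2 that(2)] by blast
  qed
  show zx: "{z,x} \<notin> bd D" using atz[of "{z,x}"] n by (auto simp: doubleton_eq_iff)
  show "{y,opp z x} \<notin> bd D" using aty[of "{y,opp z x}"] n by (auto simp: doubleton_eq_iff)
  show "{z,x,opp z y} \<in> D" using bd_spoke[OF DT s] zx stuckD(2)[OF st] by blast
  show "t = {z,x,y}" if t: "t \<in> D" "y \<in> t" for t
  proof (rule ccontr)
    assume ne: "t \<noteq> {z,x,y}"
    let ?t = "{z,x,y}"
    have sub: "{?t} \<subseteq> D" using stuckD(2)[OF st] by simp
    have b: "bd (D - {?t}) = sym_diff (bd D) {{z,x},{z,y},{x,y}}"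
      unfolding bd_Diff[OF DT sub] bd_single[OF s] ..
    \<comment> \<open>Without the tip no boundary edge is left at \<open>y\<close>. Another triangle
      of \<open>D\<close> at \<open>y\<close> would then bring all triangles there with it, the
      removed one included.\<close>
    have no: "y \<notin> f" if f: "f \<in> bd (D - {?t})" for f
    proof
      assume y: "y \<in> f"
      show False
      proof (cases "f \<in> bd D")
        case True
        then have "f = {x,y} \<or> f = {z,y}" using aty y by blast
        then have "f \<in> {{z,x},{z,y},{x,y}}" by blast
        then show False using f True unfolding b by blast
      next
        case False
        then have "f = {z,x} \<or> f = {z,y} \<or> f = {x,y}" using f unfolding b by blast
        then show False using False zy xy y n by auto
      qed
    qed
    have "D - {?t} \<subseteq> Tri" using DT by blast
    then have "?t \<in> D - {?t}" using link[of "D - {?t}" y t ?t] no t ne TriI[OF s] by blast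
    then show False by blast
  qed
qed

text \<open>Exchanging the tip of \<open>D\<close> for the triangle beyond \<open>{z,y}\<close>
  compensates the slide: the target covering and the number of triangles stay the same. The main
  point is that the exchange creates no hole.\<close>

lemma toggle_config:
  assumes fW: "finite W" and cf: "config W M D" and st: "stuck M D z x y"
  defines "R \<equiv> {{z,x,y},{z,y,opp z x}}"
  shows "config W (sym_diff M (bd R)) (sym_diff D R)"
    "sym_diff (sym_diff M (bd R)) (bd (sym_diff D R)) = sym_diff M (bd D)"
    "card (sym_diff D R) = card D"
    "(M, sym_diff M (bd R)) \<in> local_move W"
proof -
  define a where "a = opp z x"
  define t where "t = {z,x,y}"
  define t' where "t' = {z,y,a}"
  define t3 where "t3 = {other z y a, y, a}"
  note s = stuckD(1)[OF st] and cM = configD(1)[OF cf] and DT = configD(5)[OF cf] and D = configD(3)[OF cf]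
  note sb = stuck_bd[OF cf st]
  have n: "x \<noteq> y" "z \<noteq> x" "z \<noteq> y" "a \<noteq> x" "a \<noteq> y" "z \<noteq> a" using sq_neqs[OF s] unfolding a_def by blast+
  have s': "sq z y a" unfolding a_def using sq_sym[OF sq_opp[OF s]] .
  have R: "R = {t,t'}" unfolding R_def t_def t'_def a_def ..
  have tD: "t \<in> D" "t' \<notin> D" using stuckD[OF st] unfolding t_def t'_def a_def by blast+
  have tt: "t \<in> Tri" "t' \<in> Tri" "t3 \<in> Tri" unfolding t_def t'_def t3_def using TriI[OF s] TriI[OF s'] TriI[OF sq_other[OF s']] .
  \<comment> \<open>\<open>t3\<close> is the triangle behind the new position of the impurity. It
    shows below that the impurity does not become interior.\<close>
  have t3D: "t3 \<notin> D"
  proof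
    assume "t3 \<in> D"
    moreover have "y \<in> t3" "a \<in> t3" unfolding t3_def by simp_all
    ultimately have "a \<in> {z,x,y}" using sb(8) by metis
    then show False using n by auto
  qed
  have t3t: "t3 \<noteq> t'" unfolding t3_def t'_def using side_tri_neq[OF s'] by metis
  have D1: "sym_diff D R = insert t' (D - {t})" unfolding R using tD by blast
  have RT: "R \<subseteq> Tri" unfolding R using tt by simp
  have bR: "bd R = {{x,y},{y,a},{z,x},{z,a}}" unfolding R_def a_def by (rule bd_slide[OF s])
  have b1: "bd (sym_diff D R) = sym_diff (bd D) {{x,y},{y,a},{z,x},{z,a}}"
    unfolding bd_sym_diff[OF DT RT] bR ..
  show eq: "sym_diff (sym_diff M (bd R)) (bd (sym_diff D R)) = sym_diff M (bd D)"
    unfolding bd_sym_diff[OF DT RT] by blast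
  show "(M, sym_diff M (bd R)) \<in> local_move W"
    unfolding R_def by (rule slide_cov(2)[OF s cM stuckD(3,4)[OF st]])
  have fD: "finite D" using D TW_finite[OF fW] finite_subset by blast
  show "card (sym_diff D R) = card D" unfolding D1 using fD tD card_Suc_Diff1[of D t] by simp
  have W: "x \<in> W" "y \<in> W" "z \<in> W" "a \<in> W"
    using cov_edges[OF cM stuckD(3)[OF st]] cov_edges[OF cM stuckD(4)[OF st]] unfolding a_def by auto
  have D1T: "sym_diff D R \<subseteq> TW W" unfolding D1 using D tt W unfolding TW_def t'_def by auto
  have D1Tri: "sym_diff D R \<subseteq> Tri" using D1T TW_Tri by blast
  have dist: "{x,y} \<noteq> {y,a}" "{z,x} \<noteq> {y,a}" "{x,y} \<noteq> {z,x}" "{z,a} \<noteq> {y,a}" "{z,a} \<noteq> {z,x}"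
    "{z,y} \<noteq> {x,y}" "{z,y} \<noteq> {y,a}" "{z,y} \<noteq> {z,x}" "{z,y} \<noteq> {z,a}"
    using n by (auto simp: doubleton_eq_iff)
  have sub1: "bd (sym_diff D R) \<subseteq> insert {y,a} (insert {z,x} (bd D))"
    unfolding b1 using sb(2,3) unfolding a_def by blast
  have noxy: "{x,y} \<notin> bd (sym_diff D R)" unfolding b1 using sb(3) by simp
  have noza: "{z,a} \<notin> bd (sym_diff D R)" unfolding b1 using sb(2) unfolding a_def by simp
  have hf1: "hole_free W (sym_diff D R)"
    unfolding hole_free_def
  proof (intro allI impI)
    fix X assume X: "X \<subseteq> TW W" "bd X \<subseteq> bd (sym_diff D R)"
    \<comment> \<open>At \<open>y\<close> the boundary of \<open>Y\<close> can use only
      \<open>{z,y}\<close> and \<open>{y,a}\<close>, so by evenness \<open>Y\<close> contains both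
      of \<open>t\<close>, \<open>t3\<close> or neither. If both, changing \<open>Y\<close> by
      \<open>R\<close> gives a set bounded by \<open>bd D\<close> that contains \<open>t'\<close>,
      which would fill a hole of \<open>D\<close>. If neither, \<open>Y\<close> is itself bounded by
      \<open>bd D\<close>, hence lies in \<open>D\<close> and is empty.\<close>
    define Y where "Y = X - sym_diff D R"
    have XT: "X \<subseteq> Tri" using X TW_Tri by blast
    have bY: "bd Y \<subseteq> bd (sym_diff D R)" unfolding Y_def
      by (rule outside_bd[OF D1Tri XT]) (use X(2) bd_edges_of in blast)
    have Y: "Y \<subseteq> TW W" "Y \<subseteq> Tri" "finite Y"
      using X XT TW_finite[OF fW] finite_subset unfolding Y_def by blast+
    have t'Y: "t' \<notin> Y" unfolding Y_def D1 by blast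
    have "{z,x,opp z y} \<in> sym_diff D R" unfolding D1 using sb(6) spoke_tri_neq[OF s] unfolding t_def by blast
    then have fY: "{z,x,opp z y} \<notin> Y" unfolding Y_def by blast
    have zx: "{z,x} \<in> bd Y \<longleftrightarrow> t \<in> Y" using bd_spoke[OF Y(2) s] fY unfolding t_def by blast
    have ya: "{y,a} \<in> bd Y \<longleftrightarrow> t3 \<in> Y"
      using bd_side[OF Y(2) s'] t'Y unfolding t'_def t3_def by blast
    have "{z,y} \<in> bd Y \<longleftrightarrow> ({z,y,x} \<in> Y) \<noteq> ({z,y,opp z x} \<in> Y)" by (rule bd_spoke[OF Y(2) sq_sym[OF s]])
    then have zy: "{z,y} \<in> bd Y \<longleftrightarrow> t \<in> Y" using t'Y unfolding t'_def t_def a_def by (simp add: insert_commute)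
    have "{e \<in> bd Y. y \<in> e} = {{z,y},{y,a}} \<inter> bd Y"
    proof (intro equalityI subsetI)
      fix e assume "e \<in> {e \<in> bd Y. y \<in> e}"
      then have e: "e \<in> bd Y" "y \<in> e" by simp_all
      then have "e \<in> insert {y,a} (insert {z,x} (bd D))" "e \<noteq> {x,y}" using bY sub1 noxy by blast+
      moreover have "y \<notin> {z,x}" using n by simp
      ultimately have "e = {y,a} \<or> e \<in> bd D" using e(2) by blast
      then have "e = {y,a} \<or> e = {z,y}" using sb(7)[of e] e(2) \<open>e \<noteq> {x,y}\<close> by blast
      then show "e \<in> {{z,y},{y,a}} \<inter> bd Y" using e(1) by blast
    next
      fix e assume "e \<in> {{z,y},{y,a}} \<inter> bd Y"
      then show "e \<in> {e \<in> bd Y. y \<in> e}" by auto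
    qed
    then have "card {e \<in> bd Y. y \<in> e} = card ({{z,y},{y,a}} \<inter> bd Y)" by (rule arg_cong)
    moreover have "even (card {e \<in> bd Y. y \<in> e})" using bd_even_set[OF Y(3,2)] unfolding even_set_def by blast
    ultimately have "even (card ({{z,y},{y,a}} \<inter> bd Y))" by simp
    then have t3: "t3 \<in> Y \<longleftrightarrow> t \<in> Y"
      unfolding Int_insert_left zy ya using dist(7) by (cases "t \<in> Y"; cases "t3 \<in> Y") simp_all
    have "t \<notin> Y"
    proof
      assume tY: "t \<in> Y"
      have YT: "sym_diff Y R \<subseteq> TW W" unfolding R using Y(1) D1T tt unfolding D1 R TW_def t_def t'_def using W by auto
      have "bd (sym_diff Y R) = sym_diff (bd Y) {{x,y},{y,a},{z,x},{z,a}}" unfolding bd_sym_diff[OF Y(2) RT] bR ..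
      moreover have "{z,x} \<in> bd Y" "{y,a} \<in> bd Y" using tY zx ya t3 by blast+
      ultimately have "bd (sym_diff Y R) \<subseteq> insert {x,y} (insert {z,a} (bd Y - {{z,x},{y,a}}))" by blast
      also have "\<dots> \<subseteq> bd D" using bY sub1 sb(2,3) unfolding a_def by blast
      finally have "sym_diff Y R \<subseteq> D" using configD(4)[OF cf] YT unfolding hole_free_def by blast
      moreover have "t' \<in> sym_diff Y R" unfolding R using t'Y by blast
      ultimately show False using tD by blast
    qed
    then have "{z,x} \<notin> bd Y" "{y,a} \<notin> bd Y" using zx ya t3 by blast+
    then have "bd Y \<subseteq> bd D" using bY sub1 by blast
    then have "Y \<subseteq> D" using configD(4)[OF cf] Y(1) unfolding hole_free_def by blast
    then have "Y = {}" using \<open>t \<notin> Y\<close> unfolding Y_def D1 by blast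
    then show "X \<subseteq> sym_diff D R" unfolding Y_def by blast
  qed
  show "config W (sym_diff M (bd R)) (sym_diff D R)"
    unfolding config_def eq
  proof (intro conjI ballI)
    show "dimer_covering W (sym_diff M (bd R))" unfolding R_def by (rule slide_cov[OF s cM stuckD(3,4)[OF st]])
    show "dimer_covering W (sym_diff M (bd D))" by (rule configD(2)[OF cf])
    show "\<exists>t\<in>Tri. f \<subseteq> t \<and> t \<notin> sym_diff D R" if f: "f \<in> sym_diff M (bd R) \<inter> E2" for f
    proof (cases "f \<in> M")
      case True
      then obtain u where u: "u \<in> Tri" "f \<subseteq> u" "u \<notin> D" using configD(6)[OF cf True] f by blast
      have "u \<noteq> t'"
      proof
        assume "u = t'"
        then have "f = {z,y} \<or> f = {z,a} \<or> f = {y,a}"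
          using edge_in_tri[OF tt(2) _ _ _ s'] u(2) f unfolding t'_def by blast
        moreover have "{z,y} \<notin> E2" "{z,a} \<notin> E2" using tri_edges[OF s'] E1_E2_disjoint by blast+
        ultimately have "f = {y,a}" using f by blast
        then show False using slide_cov(3)[OF s cM stuckD(3,4)[OF st]] True unfolding a_def by blast
      qed
      then show ?thesis unfolding D1 using u by blast
    next
      case False
      then have "f = {y,a} \<or> f = {x,y}" using slide_new_impurity[OF s] f unfolding R_def a_def by blast
      then have "f = {y,a}" using False stuckD(3)[OF st] by blast
      then have "f \<subseteq> t3" unfolding t3_def by blast
      then show ?thesis unfolding D1 using tt(3) t3D t3t by blast
    qed
  qed (use hf1 D1T in auto)
qed

lemma slide_keeps:
  assumes s: "sq z x y" and w: "w \<in> V3" "w \<noteq> z" and e: "w \<in> e"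
  shows "e \<notin> bd {{z,x,y},{z,y,opp z x}}"
proof
  assume "e \<in> bd {{z,x,y},{z,y,opp z x}}"
  then have "e \<in> {{x,y},{y,opp z x},{z,x},{z,opp z x}}" unfolding bd_slide[OF s] .
  then have "w \<in> {x,y,z,opp z x}" using e by auto
  moreover have "x \<notin> V3" "y \<notin> V3" "opp z x \<notin> V3"
    using white_not_black sqD[OF s] sqD[OF sq_opp[OF s]] by blast+
  ultimately show False using w by auto
qed

lemma white_in_tri: "sq z x y \<Longrightarrow> w \<in> V3 \<Longrightarrow> w \<in> {z,x,y} \<Longrightarrow> w = z"
  using white_not_black sqD by blast

text \<open>With two different white vertices both triangles at the impurity would lie in
  \<open>D\<close>, but a stuck impurity is on the boundary. So different stuck white vertices stand
  for different impurities.\<close>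

lemma stuck_unique:
  assumes cf: "config W M D" and a: "stuck M D z x y" and b: "stuck M D z' x' y'" and e: "{x,y} = {x',y'}"
  shows "z' = z"
proof (rule ccontr)
  assume ne: "z' \<noteq> z"
  have DT: "D \<subseteq> Tri" using configD(5)[OF cf] .
  have s': "sq z' x y" using stuckD(1)[OF b] e sq_sym by (metis doubleton_eq_iff)
  have "{z',x,y} = {z',x',y'}" using e by simp
  then have "{z',x,y} \<in> D" using stuckD(2)[OF b] by simp
  moreover have "z' = other z x y" using other_cases[OF stuckD(1)[OF a]] s' ne by blast
  ultimately show False using bd_side[OF DT stuckD(1)[OF a]] stuckD(2)[OF a] stuck_bd(3)[OF cf a] by blast
qed

text \<open>Makes the slides that the walk takes for granted. A slide disturbs no edge at another
  white vertex, and \<open>s\<close> is injective, so the other steps of the walk survive and each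
  missing step costs one move.\<close>

lemma toggle_all:
  assumes fW: "finite W" and S: "finite S" "bij_betw s S S" "\<And>w. w \<in> S \<Longrightarrow> w \<in> V3" and z0: "z0 \<in> S"
  shows "\<lbrakk>config W M D; \<And>w. w \<in> S \<Longrightarrow> {w, f w} \<in> E1 \<and> {w, f w} \<in> edges_of D;
     \<And>w. w \<in> S \<Longrightarrow> {f w, s w} \<in> M \<or> (\<exists>y. stuck M D (s w) (f w) y); \<exists>e\<in>bd D. z0 \<in> e\<rbrakk> \<Longrightarrow>
   \<exists>M1 D1. reach W (card {w \<in> S. {f w, s w} \<notin> M}) M M1 \<and> config W M1 D1 \<and> card D1 = card D \<and>
     sym_diff M1 (bd D1) = sym_diff M (bd D) \<and>
     (\<forall>w\<in>S. {w, f w} \<in> edges_of D1 \<and> {f w, s w} \<in> M1) \<and> (\<exists>e\<in>bd D1. z0 \<in> e)"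
proof (induction "card {w \<in> S. {f w, s w} \<notin> M}" arbitrary: M D)
  case 0
  then have "{w \<in> S. {f w, s w} \<notin> M} = {}" using S(1) by auto
  then have "\<forall>w\<in>S. {w, f w} \<in> edges_of D \<and> {f w, s w} \<in> M" using 0(3) by blast
  then show ?case using 0(2,5) reach_refl by blast
next
  case (Suc n)
  note cf = Suc.prems(1)
  have sS: "s w \<in> S" if "w \<in> S" for w using S(2) that unfolding bij_betw_def by blast
  have sinj: "w = w'" if "w \<in> S" "w' \<in> S" "s w = s w'" for w w'
    using S(2) that unfolding bij_betw_def inj_on_def by blast
  have "{w \<in> S. {f w, s w} \<notin> M} \<noteq> {}" using Suc.hyps(2) by (metis card.empty nat.distinct(1))
  then obtain w0 where w0: "w0 \<in> S" "{f w0, s w0} \<notin> M" by blast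
  define z where "z = s w0"
  define x where "x = f w0"
  obtain y where st: "stuck M D z x y" using Suc.prems(3)[OF w0(1)] w0(2) unfolding z_def x_def by blast
  note s = stuckD(1)[OF st] and cM = configD(1)[OF cf] and sb = stuck_bd[OF cf st]
  define R where "R = {{z,x,y},{z,y,opp z x}}"
  define M1 where "M1 = sym_diff M (bd R)"
  define D1 where "D1 = sym_diff D R"
  have tc: "config W M1 D1" "sym_diff M1 (bd D1) = sym_diff M (bd D)" "card D1 = card D" "(M, M1) \<in> local_move W"
    unfolding M1_def D1_def R_def using toggle_config[OF fW cf st] by blast+
  have D1: "t \<in> D1 \<longleftrightarrow> (t \<in> D \<and> t \<noteq> {z,x,y}) \<or> t = {z,y,opp z x}" for t
    unfolding D1_def R_def using stuckD(2,5)[OF st] by (cases "t = {z,x,y}"; cases "t = {z,y,opp z x}") simp_all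
  have zw: "s w \<noteq> z" if "w \<in> S" "w \<noteq> w0" for w using sinj that w0(1) unfolding z_def by blast
  have zV: "z \<in> V3" using sqD(4)[OF s] .
  have keep: "e \<in> M1 \<longleftrightarrow> e \<in> M" if "u \<in> V3" "u \<noteq> z" "u \<in> e" for u e
    using slide_keeps[OF s that] unfolding M1_def R_def by blast
  have "{f w0, s w0} \<in> M1"
    using slide_cov(4)[OF s cM stuckD(3,4)[OF st]] unfolding M1_def R_def bd_slide[OF s] z_def[symmetric] x_def[symmetric]
    by (simp add: insert_commute)
  note w0M = this
  have 3: "{f w, s w} \<in> M1 \<or> (\<exists>y. stuck M1 D1 (s w) (f w) y)" if w: "w \<in> S" for w
  proof (cases "w = w0")
    case True
    then show ?thesis using w0M by simp
  next
    case False
    have wz: "s w \<noteq> z" "s w \<in> V3" using zw[OF w False] S(3)[OF sS[OF w]] by blast+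
    show ?thesis
    proof (cases "{f w, s w} \<in> M")
      case True
      then show ?thesis using keep[OF wz(2,1), of "{f w, s w}"] by blast
    next
      case F: False
      then obtain y2 where st2: "stuck M D (s w) (f w) y2" using Suc.prems(3)[OF w] by blast
      note s2 = stuckD(1)[OF st2]
      have "{s w, f w, y2} \<in> D1" using D1 stuckD(2)[OF st2] white_in_tri[OF s wz(2)] wz(1) by blast
      moreover have "{s w, y2, opp (s w) (f w)} \<notin> D1"
      proof -
        have "{s w, y2, opp (s w) (f w)} \<noteq> {z,y,opp z x}"
          using white_in_tri[OF sq_sym[OF sq_opp[OF s]] wz(2)] wz(1) by blast
        then show ?thesis using D1 stuckD(5)[OF st2] by blast
      qed
      moreover have "{s w, opp (s w) (f w)} \<in> M1" using keep[OF wz(2,1)] stuckD(4)[OF st2] by blast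
      moreover have "{f w, y2} \<in> M1"
      proof -
        have "{f w, y2} \<noteq> {x,y}" using stuck_unique[OF cf st st2] wz(1) by metis
        moreover have "{f w, y2} \<noteq> {y,opp z x}" using slide_cov(3)[OF s cM stuckD(3,4)[OF st]] stuckD(3)[OF st2] by metis
        moreover have "{f w, y2} \<noteq> {z,x}" using slide_cov(4)[OF s cM stuckD(3,4)[OF st]] stuckD(3)[OF st2] by metis
        moreover have "{f w, y2} \<noteq> {z,opp z x}"
        proof
          assume "{f w, y2} = {z,opp z x}"
          then have "z \<in> {f w, y2}" by blast
          then show False using zV white_not_black sqD[OF s2] by blast
        qed
        ultimately show ?thesis using stuckD(3)[OF st2] unfolding M1_def R_def bd_slide[OF s] by simp
      qed
      ultimately show ?thesis unfolding stuck_def using s2 by blast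
    qed
  qed
  have 2: "{w, f w} \<in> E1 \<and> {w, f w} \<in> edges_of D1" if w: "w \<in> S" for w
  proof -
    have E: "{w, f w} \<in> E1" "{w, f w} \<in> edges_of D" using Suc.prems(2)[OF w] by blast+
    then obtain t where t: "t \<in> D" "{w, f w} \<subseteq> t" unfolding edges_of_def by blast
    have "\<exists>t\<in>D1. {w, f w} \<subseteq> t"
    proof (cases "t = {z,x,y}")
      case False
      then show ?thesis using D1 t by blast
    next
      case True
      then have wz: "w = z" using white_in_tri[OF s S(3)[OF w]] t(2) by blast
      have "f w \<noteq> z" using E(1) wz E1_colours[of w "f w"] white_not_black zV by metis
      then consider "f w = x" | "f w = y" using t(2) True by blast
      then show ?thesis
      proof cases
        case 1
        have "{z,x,opp z y} \<in> D1" using D1 sb(6) spoke_tri_neq[OF s] by metis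
        then show ?thesis by (rule bexI[rotated]) (simp add: 1 wz[symmetric])
      next
        case 2
        have "{z,y,opp z x} \<in> D1" using D1[of "{z,y,opp z x}"] by simp
        then show ?thesis by (rule bexI[rotated]) (simp add: 2 wz[symmetric])
      qed
    qed
    then show ?thesis unfolding edges_of_def using E(1) by blast
  qed
  have 4: "\<exists>e\<in>bd D1. z0 \<in> e"
  proof (cases "z0 = z")
    case True
    have "D1 \<subseteq> Tri" using configD(5)[OF tc(1)] .
    note b = bd_spoke[OF this sq_sym[OF s]]
    have "{z,x,y} \<noteq> {z,y,opp z x}" using stuckD(2,5)[OF st] by metis
    then have "{z,x,y} \<notin> D1" using D1[of "{z,x,y}"] by simp
    moreover have "{z,y,x} = {z,x,y}" by (simp add: insert_commute)
    moreover have "{z,y,opp z x} \<in> D1" using D1[of "{z,y,opp z x}"] by simp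
    ultimately have "{z,y} \<in> bd D1" using b by simp
    then show ?thesis using True by blast
  next
    case False
    obtain e where e: "e \<in> bd D" "z0 \<in> e" using Suc.prems(4) by blast
    have RT: "R \<subseteq> Tri" unfolding R_def using TriI[OF s] TriI[OF sq_sym[OF sq_opp[OF s]]] by simp
    have "e \<notin> bd R" using slide_keeps[OF s S(3)[OF z0] False e(2)] unfolding R_def .
    then have "e \<in> bd D1" unfolding D1_def bd_sym_diff[OF configD(5)[OF cf] RT] using e(1) by blast
    then show ?thesis using e(2) by blast
  qed
  have set_eq: "{w \<in> S. {f w, s w} \<notin> M1} = {w \<in> S. {f w, s w} \<notin> M} - {w0}"
  proof (intro equalityI subsetI)
    fix w assume "w \<in> {w \<in> S. {f w, s w} \<notin> M1}"
    then have w: "w \<in> S" "{f w, s w} \<notin> M1" by simp_all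
    then have ne: "w \<noteq> w0" using w0M by blast
    then show "w \<in> {w \<in> S. {f w, s w} \<notin> M} - {w0}"
      using w keep[OF S(3)[OF sS[OF w(1)]] zw[OF w(1) ne], of "{f w, s w}"] by simp
  next
    fix w assume "w \<in> {w \<in> S. {f w, s w} \<notin> M} - {w0}"
    then have w: "w \<in> S" "{f w, s w} \<notin> M" "w \<noteq> w0" by simp_all
    then show "w \<in> {w \<in> S. {f w, s w} \<notin> M1}"
      using keep[OF S(3)[OF sS[OF w(1)]] zw[OF w(1,3)], of "{f w, s w}"] by simp
  qed
  have "w0 \<in> {w \<in> S. {f w, s w} \<notin> M}" using w0 by simp
  then have cn: "n = card {w \<in> S. {f w, s w} \<notin> M1}"
    unfolding set_eq using Suc.hyps(2) by simp
  obtain M2 D2 where IH: "reach W (card {w \<in> S. {f w, s w} \<notin> M1}) M1 M2" "config W M2 D2" "card D2 = card D1"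
     "sym_diff M2 (bd D2) = sym_diff M1 (bd D1)"
     "\<forall>w\<in>S. {w, f w} \<in> edges_of D2 \<and> {f w, s w} \<in> M2" "\<exists>e\<in>bd D2. z0 \<in> e"
    using Suc.hyps(1)[OF cn tc(1) 2 3 4] by blast
  have "reach W (1 + n) M M2" using reach_trans[OF reach_step[OF tc(4)]] IH(1) cn by simp
  then have "reach W (card {w \<in> S. {f w, s w} \<notin> M}) M M2" using Suc.hyps(2) by simp
  then show ?case using IH tc(2,3) by (intro exI[of _ M2] exI[of _ D2]) simp
qed

text \<open>Otherwise \<open>M\<close> matches the black boundary vertices injectively to white
  ones, while the other covering always matches white boundary vertices injectively to black ones.
  The numbers agree, both matchings are bijections, and the whole boundary consists of
  spokes.\<close>

lemma impurity_exists:
  assumes fW: "finite W" and cf: "config W M D" and ne: "bd D \<noteq> {}"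
    and no: "\<And>X. X \<subseteq> bd D \<Longrightarrow> even_set X \<Longrightarrow> X \<subseteq> E1 \<Longrightarrow> X = {}"
  shows "\<exists>e\<in>bd D. e \<in> M \<and> e \<in> E2"
proof (rule ccontr)
  assume noimp: "\<not> ?thesis"
  let ?M2 = "sym_diff M (bd D)"
  note cM = configD(1)[OF cf] and cM2 = configD(2)[OF cf] and DT = configD(5)[OF cf]
  have fD: "finite D" using configD(3)[OF cf] TW_finite[OF fW] finite_subset by blast
  define P where "P = {z \<in> V3. \<exists>e\<in>bd D. z \<in> e}"
  define B where "B = {b \<in> Z2. \<exists>e\<in>bd D. b \<in> e}"
  have bdW: "v \<in> W" if "e \<in> bd D" "v \<in> e" for e v
    using bd_edge_tri[OF that(1)] that(2) D_vertex[OF cf] by blast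
  have PW: "P \<subseteq> W" "B \<subseteq> W" unfolding P_def B_def using bdW by blast+
  then have fin: "finite P" "finite B" using fW finite_subset by blast+
  define m where "m b = (SOME u. {b,u} \<in> M)" for b
  define m2 where "m2 b = (SOME u. {b,u} \<in> ?M2)" for b
  have m: "{b, m b} \<in> M" if "b \<in> W" for b unfolding m_def using cov_mate[OF cM that] by (metis someI_ex)
  have m2: "{b, m2 b} \<in> ?M2" if "b \<in> W" for b
    unfolding m2_def using cov_mate[OF cM2 that] by (metis (no_types, lifting) someI_ex)
  have mB: "m b \<in> P" if b: "b \<in> B" for b
  proof -
    obtain e where e: "e \<in> bd D" "b \<in> e" "b \<in> Z2" using b unfolding B_def by blast
    have bm: "{b, m b} \<in> M" using m b PW by blast
    have bb: "{b, m b} \<in> bd D" by (rule bd_at[OF cf _ _ e(1,2)]) (use bm in auto)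
    then have "{b, m b} \<in> E1" using noimp bm cov_edges[OF cM bm] by blast
    then have "m b \<in> V3" using E1_colours[of b "m b"] e(3) white_not_black by blast
    then show ?thesis unfolding P_def using bb by blast
  qed
  have m2P: "m2 z \<in> B" if z: "z \<in> P" for z
  proof -
    obtain e where e: "e \<in> bd D" "z \<in> e" "z \<in> V3" using z unfolding P_def by blast
    have bm: "{z, m2 z} \<in> ?M2" using m2 z PW by blast
    have bb: "{z, m2 z} \<in> bd D" by (rule bd_at[OF cf _ _ e(1,2)]) (use bm in auto)
    have "cor z (m2 z)" using white_edge[OF _ e(3)] bb bd_edges by blast
    then have "m2 z \<in> Z2" by (rule cor_black)
    then show ?thesis unfolding B_def using bb by blast
  qed
  have im: "inj_on m B"
  proof (rule inj_onI)
    fix p q assume "p \<in> B" "q \<in> B" "m p = m q"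
    then have "{m p, p} \<in> M" "{m p, q} \<in> M" using m PW by (metis insert_commute subsetD)+
    then show "p = q" using cov_pair[OF cM] by blast
  qed
  have im2: "inj_on m2 P"
  proof (rule inj_onI)
    fix p q assume "p \<in> P" "q \<in> P" "m2 p = m2 q"
    then have "{m2 p, p} \<in> ?M2" "{m2 p, q} \<in> ?M2" using m2 PW by (metis insert_commute subsetD)+
    then show "p = q" using cov_pair[OF cM2] by blast
  qed
  have "card B \<le> card P" using card_inj_on_le[OF im _ fin(1)] mB by blast
  then have BP: "m2 ` P = B" using card_subset_eq[OF fin(2), of "m2 ` P"] m2P card_image[OF im2]
      card_inj_on_le[OF im2 _ fin(2)] by (simp add: image_subset_iff)
  have "bd D \<subseteq> E1"
  proof
    fix e assume e: "e \<in> bd D"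
    show "e \<in> E1"
    proof (rule ccontr)
      assume "e \<notin> E1"
      then have e2: "e \<in> E2" using e bd_edges by blast
      then have eM: "e \<in> ?M2" using noimp e by blast
      obtain z0 a b where ab: "e = {a,b}" "sq z0 a b" using e2 by (rule E2E)
      have "a \<in> B" unfolding B_def using e ab sqD(5)[OF ab(2)] by blast
      then obtain z where z: "z \<in> P" "a = m2 z" using BP by blast
      have "{z,a} \<in> ?M2" using m2 z PW by blast
      then have "{z,a} = e" using cov_unique[OF cM2 _ eM, of "{z,a}" a] ab by blast
      then have "z \<in> Z2" using E2_black[OF e2] by blast
      then show False using z(1) white_not_black unfolding P_def by blast
    qed
  qed
  then show False using no[of "bd D"] bd_even_set[OF fD DT] ne by blast
qed

text \<open>With all impurities stuck, an alternating walk that arrives at the corner \<open>x\<close> of a stuck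
  impurity may continue through its white vertex \<open>z\<close>, because sliding that impurity matches \<open>x\<close>
  with \<open>z\<close>.  A stuck white vertex with minimal reachable set lies on a cycle of such walks.\<close>

lemma stuck_cycle:
  assumes fW: "finite W" and cf: "config W M D" and ne: "bd D \<noteq> {}"
    and no: "\<And>X. X \<subseteq> bd D \<Longrightarrow> even_set X \<Longrightarrow> X \<subseteq> E1 \<Longrightarrow> X = {}"
    and noslide: "\<And>z x y. \<lbrakk>sq z x y; {x,y} \<in> M; {z,opp z x} \<in> M; {x,y} \<in> bd D; {z,x,y} \<in> D\<rbrakk> \<Longrightarrow> {z,y,opp z x} \<notin> D"
  shows "\<exists>S s f z0. finite S \<and> bij_betw s S S \<and> S \<subseteq> V3 \<and> z0 \<in> S \<and> (\<exists>e\<in>bd D. z0 \<in> e) \<and>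
    (\<forall>w\<in>S. s w \<noteq> w \<and> {w, f w} \<in> E1 \<and> {w, f w} \<in> edges_of D \<and>
       ({f w, s w} \<in> M \<or> (\<exists>y. stuck M D (s w) (f w) y)))"
proof -
  let ?M2 = "sym_diff M (bd D)"
  note cM = configD(1)[OF cf] and cM2 = configD(2)[OF cf] and DT = configD(5)[OF cf]
  have fD: "finite D" using configD(3)[OF cf] TW_finite[OF fW] finite_subset by blast
  have site: "\<exists>z x y. stuck M D z x y \<and> e = {x,y}" if e: "e \<in> M" "e \<in> E2" "e \<in> bd D" for e
  proof -
    obtain z x y where z: "sq z x y" "e = {x,y}" "{z,x,y} \<in> D" "{z,opp z x} \<in> M"
      using impurity_site[OF cf e] by blast
    then have "{z,y,opp z x} \<notin> D" using noslide[OF z(1)] e by blast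
    then show ?thesis unfolding stuck_def using z e(1) by blast
  qed
  define mt where "mt b w \<longleftrightarrow> {b,w} \<in> M \<or> (\<exists>y. stuck M D w b y)" for b w
  define r where "r = {(w,w'). w \<in> V3 \<and> w' \<in> V3 \<and> w \<noteq> w' \<and>
     (\<exists>b. {w,b} \<in> E1 \<and> {w,b} \<in> edges_of D \<and> mt b w')}"
  have rD: "w \<in> V3 \<and> w' \<in> V3 \<and> w \<noteq> w' \<and> (\<exists>b. {w,b} \<in> E1 \<and> {w,b} \<in> edges_of D \<and> mt b w')"
    if "(w,w') \<in> r" for w w' using that unfolding r_def by simp
  have rI: "(w,w') \<in> r" if "w \<in> V3" "w' \<in> V3" "w \<noteq> w'" "{w,b} \<in> E1" "{w,b} \<in> edges_of D" "mt b w'" for w w' b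
    using that unfolding r_def by blast
  have DEv: "\<exists>t\<in>D. p \<in> t \<and> q \<in> t" if "{p,q} \<in> edges_of D" for p q
    using that unfolding edges_of_def by blast
  have range: "\<exists>t\<in>D. w' \<in> t" if r1: "(w,w') \<in> r" for w w'
  proof -
    obtain b where b: "{w,b} \<in> edges_of D" "mt b w'" using rD[OF r1] by blast
    show ?thesis using b(2) unfolding mt_def
    proof
      assume "{b,w'} \<in> M"
      obtain t where t: "t \<in> D" "b \<in> t" using DEv[OF b(1)] by blast
      have "{b,w'} \<in> edges_of D" using D_edge[OF cf t] \<open>{b,w'} \<in> M\<close> by blast
      then show ?thesis using DEv by blast
    next
      assume "\<exists>y. stuck M D w' b y"
      then show ?thesis using stuckD(2) by blast
    qed
  qed
  define Zs where "Zs = {z. \<exists>x y. stuck M D z x y}"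
  have "Zs \<noteq> {}"
  proof -
    obtain e where "e \<in> bd D" "e \<in> M" "e \<in> E2" using impurity_exists[OF fW cf ne no] by blast
    then show ?thesis using site unfolding Zs_def by blast
  qed
  define n where "n z = card (r\<^sup>+ `` {z})" for z
  obtain z where z: "z \<in> Zs" "\<And>z'. z' \<in> Zs \<Longrightarrow> n z \<le> n z'"
  proof -
    have "\<exists>z. z \<in> Zs \<and> (\<forall>z'. z' \<in> Zs \<longrightarrow> n z \<le> n z')"
      using ex_has_least_nat[of "\<lambda>z. z \<in> Zs" _ n] \<open>Zs \<noteq> {}\<close> by blast
    then show ?thesis using that by blast
  qed
  define L where "L = r\<^sup>+ `` {z}"
  have LD: "l \<in> V3 \<and> (\<exists>t\<in>D. l \<in> t)" if "l \<in> L" for l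
  proof -
    have "(z,l) \<in> r\<^sup>+" using that unfolding L_def by blast
    then obtain w where "(w,l) \<in> r" by (meson tranclD2)
    then show ?thesis using rD range by blast
  qed
  have "L \<subseteq> W" using LD D_vertex[OF cf] by blast
  then have fL: "finite L" using fW finite_subset by blast
  have Lstep: "w' \<in> L" if "w \<in> L" "(w,w') \<in> r" for w w'
    using that unfolding L_def by (meson Image_singleton_iff trancl_into_trancl)
  have "\<exists>z2. z2 \<in> Zs \<and> z2 \<in> L"
  proof (rule ccontr)
    assume none: "\<not> ?thesis"
    obtain x y where st: "stuck M D z x y" using z(1) unfolding Zs_def by blast
    note s = stuckD(1)[OF st] and sb = stuck_bd[OF cf st]
    have nq: "x \<noteq> y" "z \<noteq> x" "z \<noteq> y" "opp z y \<noteq> x" "opp z y \<noteq> y" "opp z x \<noteq> opp z y" using sq_neqs[OF s] by blast+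
    \<comment> \<open>The triangle \<open>{z,x,y'}\<close> also lies in \<open>D\<close>, so a walk
      can leave \<open>z\<close> along the spoke \<open>{z,y'}\<close>. If no stuck white vertex
      were reached from there, the count of spokes would force \<open>z\<close> itself to be
      reached, a contradiction.\<close>
    define y' where "y' = opp z y"
    have s': "sq z x y'" unfolding y'_def using sq_opp2[OF s] .
    have zV: "z \<in> V3" using sqD(4)[OF s] .
    have zy: "{z,y'} \<in> E1" using tri_edges(2)[OF s'] .
    have tD: "{z,x,y'} \<in> D" unfolding y'_def by (rule sb(6))
    have zyD: "{z,y'} \<in> edges_of D" by (rule edges_ofI[OF _ tD]) (use zy in auto)
    define B where "B = {b. \<exists>l\<in>L. {l,b} \<in> E1 \<and> {l,b} \<in> edges_of D}"
    have first: "p \<in> L" if "mt y' p" "p \<in> V3" "p \<noteq> z" for p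
    proof -
      have "(z,p) \<in> r" by (rule rI[OF zV that(2) _ zy zyD that(1)]) (use that(3) in blast)
      then show ?thesis unfolding L_def by blast
    qed
    have y'B: "y' \<in> B"
    proof -
      have y'W: "y' \<in> W" using D_vertex[OF cf tD] by simp
      obtain p where p: "{y',p} \<in> M" using cov_mate[OF cM y'W] by blast
      have "{y',p} \<in> E1"
      proof (rule ccontr)
        assume "{y',p} \<notin> E1"
        then have p2: "{y',p} \<in> E2" using cov_edges[OF cM p] by blast
        have "{y',p} \<in> bd D" by (rule impurity_on_bd[OF cf tD _ p _ p2, of y']) auto
        then obtain z2 x2 y2 where st2: "stuck M D z2 x2 y2" and e2: "{y',p} = {x2,y2}" using site[OF p p2] by blast
        then consider "y' = x2" | "y' = y2" by blast
        then show False
        proof cases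
          case 1
          have "z2 \<noteq> z"
          proof
            assume "z2 = z"
            then have "{z, opp z x2} \<in> M" using stuckD(4)[OF st2] by simp
            then have "opp z x2 = opp z x" by (rule cov_pair[OF cM _ stuckD(4)[OF st]])
            then have "x2 = x" by (metis opp_opp)
            then show False using 1 nq unfolding y'_def by blast
          qed
          then have "z2 \<in> L" using first[of z2] st2 1 sqD(4)[OF stuckD(1)[OF st2]] unfolding mt_def by blast
          then show False using none st2 unfolding Zs_def by blast
        next
          case 2
          have "{z,x,y'} = {z2,x2,y2}" by (rule stuck_bd(8)[OF cf st2 tD]) (simp add: 2)
          then have "{x,y'} = {x2,y2}" by (rule conjunct2[OF iffD1[OF tri_eq[OF s' stuckD(1)[OF st2]]]])
          then have "{x,y'} \<in> M" using stuckD(3)[OF st2] by simp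
          then have "y = y'" by (rule cov_pair[OF cM stuckD(3)[OF st]])
          then show False using nq(5) unfolding y'_def by simp
        qed
      qed
      note pE = this
      have "p \<in> V3" using E1_colours[OF pE] sqD(6)[OF s'] white_not_black by blast
      have "p \<noteq> z"
      proof
        assume "p = z"
        then have "{z,y'} \<in> M" using p by (simp add: insert_commute)
        then have "opp z x = y'" by (rule cov_pair[OF cM stuckD(4)[OF st]])
        then show False using nq(6) unfolding y'_def by simp
      qed
      have pL: "p \<in> L" using first[of p] p \<open>p \<in> V3\<close> \<open>p \<noteq> z\<close> unfolding mt_def by blast
      have "{y',p} \<in> edges_of D" by (rule D_edge[OF cf tD, of y']) (use p in auto)
      then have "{p,y'} \<in> edges_of D" "{p,y'} \<in> E1" using pE by (simp_all add: insert_commute)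
      then show ?thesis unfolding B_def using pL by blast
    qed
    have "z \<in> L"
    proof (rule closure_count[OF cf fL _ B_def _ _ _ fD y'B zy])
      fix l assume "l \<in> L" then show "\<exists>t\<in>D. l \<in> t" using LD by blast
    next
      fix l u assume l: "l \<in> L" "{l,u} \<in> M \<or> {l,u} \<in> ?M2"
      have "{l,u} \<in> E1 \<union> E2" using l(2) cov_edges[OF cM] cov_edges[OF cM2] by metis
      then have "cor l u" using white_edge LD[OF l(1)] by blast
      then show "{l,u} \<in> E1" by (rule E1I)
    next
      fix b assume "b \<in> B"
      then obtain l where l: "l \<in> L" "{l,b} \<in> E1" "{l,b} \<in> edges_of D" unfolding B_def by blast
      have lV: "l \<in> V3" using LD l(1) by blast
      obtain t where t: "t \<in> D" "l \<in> t" "b \<in> t" using DEv[OF l(3)] by blast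
      obtain p where p: "{b,p} \<in> M" using cov_mate[OF cM D_vertex[OF cf t(1,3)]] by blast
      have lstep: "q \<in> L" if "mt b q" "q \<in> V3" for q
      proof (cases "q = l")
        case False
        have "(l,q) \<in> r" by (rule rI[OF lV that(2) _ l(2,3) that(1)]) (use False in blast)
        then show ?thesis using Lstep[OF l(1)] by blast
      qed (use l in blast)
      have bZ: "b \<in> Z2" using cor_black[OF white_E1[OF l(2) lV]] .
      have "{b,p} \<in> E1"
      proof (rule ccontr)
        assume "{b,p} \<notin> E1"
        then have p2: "{b,p} \<in> E2" using cov_edges[OF cM p] by blast
        have "{b,p} \<in> bd D" by (rule impurity_on_bd[OF cf t(1,3) p _ p2]) auto
        then obtain z2 x2 y2 where st2: "stuck M D z2 x2 y2" and e2: "{b,p} = {x2,y2}" using site[OF p p2] by blast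
        have z2V: "z2 \<in> V3" using sqD(4)[OF stuckD(1)[OF st2]] .
        have "z2 \<in> Zs" using st2 unfolding Zs_def by blast
        then have z2L: "z2 \<notin> L" using none by blast
        consider "b = x2" | "b = y2" using e2 by blast
        then show False
        proof cases
          case 1
          then have "z2 \<in> L" using lstep[OF _ z2V] st2 unfolding mt_def by blast
          then show False using z2L by blast
        next
          case 2
          then have "t = {z2,x2,y2}" using stuck_bd(8)[OF cf st2 t(1)] t(3) by blast
          then have "l = z2" using white_in_tri[OF stuckD(1)[OF st2] lV] t(2) by blast
          then show False using z2L l(1) by blast
        qed
      qed
      then have "p \<in> V3" using E1_colours[of b p] bZ white_not_black by blast
      then have "p \<in> L" using lstep p unfolding mt_def by blast
      then show "\<exists>l\<in>L. {l,b} \<in> M" using p by (metis insert_commute)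
    next
      fix X assume "X \<subseteq> bd D" "even_set X" "X \<subseteq> E1"
      then show "X = {}" by (rule no)
    qed
    then show False using none z(1) by blast
  qed
  \<comment> \<open>Whatever is reachable from \<open>z2\<close> is reachable from \<open>z\<close>.
    By minimality the two reachable sets agree, so \<open>z2\<close> is reachable from
    itself.\<close>
  then obtain z2 where z2: "z2 \<in> Zs" "z2 \<in> L" by blast
  have "r\<^sup>+ `` {z2} \<subseteq> L"
    using z2(2) unfolding L_def by (meson Image_singleton_iff subsetI trancl_trans)
  moreover have "card L \<le> card (r\<^sup>+ `` {z2})" using z(2)[OF z2(1)] unfolding n_def L_def .
  ultimately have "r\<^sup>+ `` {z2} = L" using card_seteq[OF fL] by blast
  then have cyc: "(z2,z2) \<in> r\<^sup>+" using z2(2) by blast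
  obtain S s where S: "finite S" "z2 \<in> S" "bij_betw s S S" "\<forall>x\<in>S. (x, s x) \<in> r"
    using cycle_permutation[OF cyc] by (elim exE conjE) (rule that)
  define f where "f w = (SOME b. {w,b} \<in> E1 \<and> {w,b} \<in> edges_of D \<and> mt b (s w))" for w
  have f: "{w, f w} \<in> E1 \<and> {w, f w} \<in> edges_of D \<and> mt (f w) (s w)" if "w \<in> S" for w
  proof -
    have "\<exists>b. {w,b} \<in> E1 \<and> {w,b} \<in> edges_of D \<and> mt b (s w)" using rD[OF bspec[OF S(4) that]] by simp
    then show ?thesis unfolding f_def by (rule someI_ex)
  qed
  have SV: "w \<in> V3 \<and> s w \<noteq> w" if "w \<in> S" for w using rD[OF bspec[OF S(4) that]] by metis
  obtain x y where st: "stuck M D z2 x y" using z2(1) unfolding Zs_def by blast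
  have e: "\<exists>e\<in>bd D. z2 \<in> e" using stuck_bd(1)[OF cf st] by blast
  have "\<forall>w\<in>S. s w \<noteq> w \<and> {w, f w} \<in> E1 \<and> {w, f w} \<in> edges_of D \<and>
       ({f w, s w} \<in> M \<or> (\<exists>y. stuck M D (s w) (f w) y))"
    using f SV unfolding mt_def by simp
  moreover have "S \<subseteq> V3" using SV by blast
  ultimately show ?thesis using S(1,2,3) e by (intro exI[of _ S] exI[of _ s] exI[of _ f] exI[of _ z2]) simp
qed

text \<open>Each round either slides an impurity inside \<open>D\<close> or cuts off a circuit of
  spokes, so \<open>D\<close> shrinks. A cut may need preparatory slides that do not shrink
  \<open>D\<close>; these are charged to the triangles cut off.\<close>

lemma rotate:
  assumes fW: "finite W" and sc: "fillable W" and k: "\<And>M. dimer_covering W M \<Longrightarrow> card (impurities M) \<le> k"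
  shows "config W M D \<Longrightarrow> reach W ((k + 1) * card D) M (sym_diff M (bd D))"
proof (induction "card D" arbitrary: M D rule: less_induct)
  case less
  note cf = less.prems
  note cM = configD(1)[OF cf] and cM2 = configD(2)[OF cf] and DT = configD(5)[OF cf] and D = configD(3)[OF cf]
  have fD: "finite D" using D TW_finite[OF fW] finite_subset by blast
  \<comment> \<open>Rotating \<open>D'\<close> costs one move per triangle while
    \<open>k + 1\<close> are available. The surplus \<open>k * card D'\<close> is at least
    \<open>k\<close> and pays for the \<open>j\<close> preparatory slides.\<close>
  have cut: "reach W ((k + 1) * card D) M (sym_diff M (bd D))"
    if R: "reach W j M M1" "j \<le> k" and c1: "config W M1 D1" "card D1 = card D" "sym_diff M1 (bd D1) = sym_diff M (bd D)"
      and c: "circuit c" "c \<subseteq> edges_of D1" "c \<subseteq> E1" "c \<inter> bd D1 \<noteq> {}" "dimer_covering W (sym_diff M1 c)"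
    for j M1 D1 c
  proof -
    obtain D' where D': "D' \<subseteq> D1" "bd D' = c" "D' \<noteq> {}" "config W M1 D'" "config W (sym_diff M1 c) (D1 - D')"
      "sym_diff (sym_diff M1 c) (bd (D1 - D')) = sym_diff M1 (bd D1)" "bd (D1 - D') = sym_diff (bd D1) c"
      by (rule split_config[OF fW sc c1(1) c])
    have fD1: "finite D1" using configD(3)[OF c1(1)] TW_finite[OF fW] finite_subset by blast
    have cd: "card D = card D' + card (D1 - D')" using D'(1) fD1 c1(2)
      by (metis card_Diff_subset card_mono finite_subset le_add_diff_inverse)
    have p: "card D' > 0" using D'(3) D'(1) fD1 finite_subset card_gt_0_iff by blast
    then have l2: "card (D1 - D') < card D" using cd by simp
    have "reach W (card D') M1 (sym_diff M1 c)" using rotate_spokes[OF fW sc D'(4)] D'(2) c(3) by simp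
    moreover have "reach W ((k + 1) * card (D1 - D')) (sym_diff M1 c) (sym_diff M (bd D))"
      using less.hyps[OF l2 D'(5)] unfolding D'(6) c1(3) .
    ultimately have "reach W (j + (card D' + (k + 1) * card (D1 - D'))) M (sym_diff M (bd D))"
      using reach_trans[OF R(1)] reach_trans by blast
    moreover have "j + (card D' + (k + 1) * card (D1 - D')) \<le> (k + 1) * card D"
    proof -
      have "j \<le> k * card D'" using R(2) p by (metis Suc_leI le_trans mult.right_neutral mult_le_mono2 One_nat_def)
      then show ?thesis unfolding cd by (simp add: algebra_simps)
    qed
    ultimately show ?thesis by (rule reach_mono)
  qed
  show ?case
  proof (cases "D = {}")
    case True
    then show ?thesis using reach_refl by simp
  next
    case Dne: False
    have bne: "bd D \<noteq> {}" using bd_eq_empty[OF fD DT] Dne by blast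
    have sdM: "sym_diff M (sym_diff M (bd D)) = bd D" by blast
    show ?thesis
    proof (cases "\<exists>X\<subseteq>bd D. even_set X \<and> X \<subseteq> E1 \<and> X \<noteq> {}")
      case True
      then obtain X g where X: "X \<subseteq> bd D" "even_set X" "X \<subseteq> E1" "g \<in> X" by blast
      obtain c where c: "c \<subseteq> X" "circuit c" using circuit_through[OF X(2,4)] by blast
      have "dimer_covering W (sym_diff M c)"
        by (rule cov_sub[OF cM cM2]) (use c X sdM in \<open>auto simp: circuit_def\<close>)
      moreover have "c \<inter> bd D \<noteq> {}" using c X unfolding circuit_def by blast
      moreover have "c \<subseteq> edges_of D" "c \<subseteq> E1" using c X bd_edges_of by blast+
      ultimately show ?thesis using cut[OF reach_refl[of W 0 M] _ cf refl refl c(2)] by simp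
    next
      case noX: False
      show ?thesis
      proof (cases "\<exists>z x y. sq z x y \<and> {x,y} \<in> M \<and> {z,opp z x} \<in> M \<and> {x,y} \<in> bd D \<and> {z,x,y} \<in> D \<and> {z,y,opp z x} \<in> D")
        case True
        then obtain z x y where s: "sq z x y" "{x,y} \<in> M" "{z,opp z x} \<in> M" "{x,y} \<in> bd D" "{z,x,y} \<in> D" "{z,y,opp z x} \<in> D"
          by blast
        define R where "R = {{z,x,y},{z,y,opp z x}}"
        have c1: "config W (sym_diff M (bd R)) (D - R)"
          "sym_diff (sym_diff M (bd R)) (bd (D - R)) = sym_diff M (bd D)"
          unfolding R_def using slide_config[OF cf s] by blast+
        have "R \<inter> D \<noteq> {}" unfolding R_def using s by blast
        then have l: "card (D - R) < card D" using fD by (intro psubset_card_mono) auto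
        have "reach W 1 M (sym_diff M (bd R))" unfolding R_def by (rule reach_step[OF slide_cov(2)[OF s(1) cM s(2,3)]])
        moreover have "reach W ((k + 1) * card (D - R)) (sym_diff M (bd R)) (sym_diff M (bd D))"
          using less.hyps[OF l c1(1)] unfolding c1(2) .
        ultimately have "reach W (1 + (k + 1) * card (D - R)) M (sym_diff M (bd D))" by (rule reach_trans)
        moreover have "1 + (k + 1) * card (D - R) \<le> (k + 1) * card D"
        proof -
          have "(k + 1) * (card (D - R) + 1) \<le> (k + 1) * card D" using l by (intro mult_le_mono2) simp
          then show ?thesis by (simp add: algebra_simps)
        qed
        ultimately show ?thesis by (rule reach_mono)
      next
        case noslide: False
        have "\<exists>S s f z0. finite S \<and> bij_betw s S S \<and> S \<subseteq> V3 \<and> z0 \<in> S \<and> (\<exists>e\<in>bd D. z0 \<in> e) \<and>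
          (\<forall>w\<in>S. s w \<noteq> w \<and> {w, f w} \<in> E1 \<and> {w, f w} \<in> edges_of D \<and>
          ({f w, s w} \<in> M \<or> (\<exists>y. stuck M D (s w) (f w) y)))"
          by (rule stuck_cycle[OF fW cf bne]) (use noX noslide in blast)+
        then obtain S s f z0 where S: "finite S" "bij_betw s S S" "S \<subseteq> V3" "z0 \<in> S" "\<exists>e\<in>bd D. z0 \<in> e"
          and Sf: "\<forall>w\<in>S. s w \<noteq> w \<and> {w, f w} \<in> E1 \<and> {w, f w} \<in> edges_of D \<and>
          ({f w, s w} \<in> M \<or> (\<exists>y. stuck M D (s w) (f w) y))" by (elim exE conjE) (rule that)
        have "\<exists>M1 D1. reach W (card {w \<in> S. {f w, s w} \<notin> M}) M M1 \<and> config W M1 D1 \<and> card D1 = card D \<and>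
          sym_diff M1 (bd D1) = sym_diff M (bd D) \<and>
          (\<forall>w\<in>S. {w, f w} \<in> edges_of D1 \<and> {f w, s w} \<in> M1) \<and> (\<exists>e\<in>bd D1. z0 \<in> e)"
          by (rule toggle_all[OF fW S(1,2) _ S(4) cf]) (use S(3,5) Sf in blast)+
        then obtain M1 D1 where M1: "reach W (card {w \<in> S. {f w, s w} \<notin> M}) M M1" "config W M1 D1" "card D1 = card D"
          "sym_diff M1 (bd D1) = sym_diff M (bd D)"
          "\<forall>w\<in>S. {w, f w} \<in> edges_of D1 \<and> {f w, s w} \<in> M1" "\<exists>e\<in>bd D1. z0 \<in> e" by (elim exE conjE) (rule that)
        note cM1 = configD(1)[OF M1(2)]
        \<comment> \<open>Different missing steps slide different impurities of \<open>M\<close>, of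
          which there are at most \<open>k\<close>.\<close>
        have tog: "card {w \<in> S. {f w, s w} \<notin> M} \<le> k"
        proof -
          define g where "g w = {f w, SOME y. stuck M D (s w) (f w) y}" for w
          have st: "stuck M D (s w) (f w) (SOME y. stuck M D (s w) (f w) y)" if "w \<in> {w \<in> S. {f w, s w} \<notin> M}" for w
            using Sf that by (metis (mono_tags, lifting) mem_Collect_eq someI_ex)
          have "inj_on g {w \<in> S. {f w, s w} \<notin> M}"
          proof (rule inj_onI)
            fix w w' assume w: "w \<in> {w \<in> S. {f w, s w} \<notin> M}" "w' \<in> {w \<in> S. {f w, s w} \<notin> M}" "g w = g w'"
            then have "s w = s w'" using stuck_unique[OF cf st[OF w(2)] st[OF w(1)]] unfolding g_def by simp
            then show "w = w'" using S(2) w(1,2) unfolding bij_betw_def inj_on_def by blast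
          qed
          moreover have "g ` {w \<in> S. {f w, s w} \<notin> M} \<subseteq> impurities M"
          proof
            fix e assume "e \<in> g ` {w \<in> S. {f w, s w} \<notin> M}"
            then obtain w where w: "w \<in> {w \<in> S. {f w, s w} \<notin> M}" "e = g w" by blast
            note q = st[OF w(1)]
            show "e \<in> impurities M" unfolding impurities_def w(2) g_def
              using stuckD(3)[OF q] tri_edges(3)[OF stuckD(1)[OF q]] by blast
          qed
          moreover have "finite (impurities M)" using cov_finite[OF fW cM] unfolding impurities_def by simp
          ultimately have "card {w \<in> S. {f w, s w} \<notin> M} \<le> card (impurities M)" by (rule card_inj_on_le)
          then show ?thesis using k[OF cM] by simp
        qed
        define c1 where "c1 = (\<lambda>w. {w, f w}) ` S \<union> (\<lambda>w. {f w, s w}) ` S"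
        have fZ: "f w \<in> Z2" if "w \<in> S" for w
          using Sf S(3) that E1_colours[of w "f w"] white_not_black by blast
        have sS: "s w \<in> S" if "w \<in> S" for w using S(2) that unfolding bij_betw_def by blast
        have DEW: "edges_of D1 \<subseteq> induced_edges W" using edges_of_induced[OF configD(3)[OF M1(2)]] .
        have cov1: "dimer_covering W (sym_diff M1 c1)"
          unfolding c1_def
        proof (rule alternating_cycle[OF cM1 S(2)])
          show "S \<inter> f ` S = {}"
          proof (rule equals0I)
            fix x assume x: "x \<in> S \<inter> f ` S"
            then obtain p where "p \<in> S" "x = f p" by blast
            then show False using fZ[of p] S(3) x white_not_black by blast
          qed
          fix w assume w: "w \<in> S"
          show "{w, f w} \<in> induced_edges W" using DEW bspec[OF M1(5) w] by blast
          show "{f w, s w} \<in> M1" using bspec[OF M1(5) w] by blast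
          show "s w \<noteq> w" using bspec[OF Sf w] by blast
        qed
        have sd1: "sym_diff M1 (sym_diff M1 c1) = c1" by blast
        have ev1: "even_set c1" using cov_sym_diff_even_set[OF fW cM1 cov1] unfolding sd1 .
        have c1E: "e \<in> E1 \<and> e \<in> edges_of D1" if "e \<in> c1" for e
        proof -
          have "{f w, s w} \<in> E1 \<and> {f w, s w} \<in> edges_of D1" if w: "w \<in> S" for w
          proof -
            have wM: "{f w, s w} \<in> M1" "{w, f w} \<in> edges_of D1" using bspec[OF M1(5) w] by blast+
            obtain t where t: "t \<in> D1" "f w \<in> t" using wM(2) unfolding edges_of_def by blast
            have d: "{f w, s w} \<in> edges_of D1" by (rule D_edge[OF M1(2) t]) (use wM(1) in auto)
            have "{s w, f w} \<in> E1 \<union> E2" using cov_edges[OF cM1 wM(1)] by (simp add: insert_commute)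
            then have "cor (s w) (f w)" using white_edge S(3) sS[OF w] by blast
            then have "{s w, f w} \<in> E1" by (rule E1I)
            then show ?thesis using d by (simp add: insert_commute)
          qed
          moreover have "{w, f w} \<in> E1 \<and> {w, f w} \<in> edges_of D1" if w: "w \<in> S" for w
            using bspec[OF M1(5) w] bspec[OF Sf w] by blast
          ultimately show ?thesis using that unfolding c1_def by blast
        qed
        have "z0 \<in> s ` S" using S(2,4) unfolding bij_betw_def by simp
        then obtain w where w: "w \<in> S" "z0 = s w" by blast
        have eM: "{f w, z0} \<in> M1" "{f w, z0} \<in> c1" using bspec[OF M1(5) w(1)] w unfolding c1_def by blast+
        obtain e0 where e0: "e0 \<in> bd D1" "z0 \<in> e0" using M1(6) by blast
        have eb: "{f w, z0} \<in> bd D1" by (rule bd_at[OF M1(2) _ _ e0]) (use eM(1) in auto)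
        obtain c' where c': "c' \<subseteq> c1" "circuit c'" "{f w, z0} \<in> c'" using circuit_through[OF ev1 eM(2)] by blast
        have cov': "dimer_covering W (sym_diff M1 c')"
          by (rule cov_sub[OF cM1 cov1]) (use c' sd1 in \<open>auto simp: circuit_def\<close>)
        have "c' \<inter> bd D1 \<noteq> {}" using c'(3) eb by blast
        moreover have "c' \<subseteq> edges_of D1" "c' \<subseteq> E1" using c'(1) c1E by blast+
        ultimately show ?thesis using cut[OF M1(1) tog M1(2,3,4) c'(2) _ _ _ cov'] by simp
      qed
    qed
  qed
qed

section \<open>Sliding impurities to the border\<close>

text \<open>The line through a white vertex and its mate; sliding an impurity never changes it.\<close>

definition axis :: "point set set \<Rightarrow> point \<Rightarrow> point \<Rightarrow> bool" where
  "axis M z x \<longleftrightarrow> {z,x} \<in> M \<or> {z,opp z x} \<in> M"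

text \<open>Depends on \<open>M\<close> alone: as slides preserve axes, the possible routes of an
  impurity are known before any move is made.\<close>

definition slides :: "point set \<Rightarrow> point set set \<Rightarrow> (point set \<times> point set) set" where
  "slides W M = {(F,F'). \<exists>z x y. sq z x y \<and> z \<in> W \<and> axis M z x \<and> F = {x,y} \<and> F' = {y,opp z x}}"

lemma swap_Int: "p \<notin> E \<Longrightarrow> q \<notin> E \<Longrightarrow> r \<in> E \<Longrightarrow> (M - {a,q} \<union> {r,p}) \<inter> E = (M \<inter> E - {a}) \<union> {r}"
  by auto

lemma swap_Un: "S = A \<union> ({g} \<inter> E) \<Longrightarrow> g \<notin> A \<Longrightarrow> f \<in> E \<Longrightarrow> (S - {g}) \<union> {f} = A \<union> ({f} \<inter> E)"
  by auto

text \<open>With the impurity at \<open>{x,y}\<close> the vertex \<open>x\<close> is not matched to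
  \<open>z\<close>, so the preserved axis forces \<open>z\<close> to be matched to
  \<open>opp z x\<close> and the slide is possible. Other impurities neither obstruct the route nor
  move. The way back is recorded as well.\<close>

lemma slide_along:
  assumes M: "dimer_covering W M" and F0: "F0 \<in> M"
  shows "(F0,F) \<in> slides W M ^^ n \<Longrightarrow> \<exists>M'. (M,M') \<in> local_move W ^^ n \<and> (M',M) \<in> local_move W ^^ n \<and>
    dimer_covering W M' \<and> F \<in> M' \<and> F \<notin> M \<inter> E2 - {F0} \<and>
    (\<forall>z\<in>V3. \<forall>x. axis M' z x = axis M z x) \<and> M' \<inter> E2 = (M \<inter> E2 - {F0}) \<union> ({F} \<inter> E2)"
proof (induction n arbitrary: F)
  case 0
  then have "F = F0" by simp
  then show ?case using M F0 by (intro exI[of _ M]) auto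
next
  case (Suc n)
  then obtain G where G: "(F0,G) \<in> slides W M ^^ n" "(G,F) \<in> slides W M" by auto
  obtain M' where M': "(M,M') \<in> local_move W ^^ n" "(M',M) \<in> local_move W ^^ n" "dimer_covering W M'" "G \<in> M'"
    "G \<notin> M \<inter> E2 - {F0}" "\<forall>z\<in>V3. \<forall>x. axis M' z x = axis M z x" "M' \<inter> E2 = (M \<inter> E2 - {F0}) \<union> ({G} \<inter> E2)"
    using Suc.IH[OF G(1)] by (elim exE conjE) (rule that)
  obtain z x y where s: "sq z x y" "axis M z x" "G = {x,y}" "F = {y,opp z x}"
    using G(2) unfolding slides_def by blast
  have zV: "z \<in> V3" using sqD(4)[OF s(1)] .
  have n: "x \<noteq> y" "z \<noteq> x" "z \<noteq> y" "opp z x \<noteq> x" "opp z x \<noteq> y" "z \<noteq> opp z x" using sq_neqs[OF s(1)] by blast+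
  have G': "{x,y} \<in> M'" using M'(4) s(3) by simp
  have "{z,x} \<notin> M'"
  proof
    assume "{z,x} \<in> M'"
    then have "{x,z} \<in> M'" by (simp add: insert_commute)
    then have "y = z" by (rule cov_pair[OF M'(3) G'])
    then show False using n by simp
  qed
  moreover have "axis M' z x" using M'(6) zV s(2) by blast
  ultimately have zo: "{z,opp z x} \<in> M'" unfolding axis_def by blast
  define R where "R = {{z,x,y},{z,y,opp z x}}"
  define M1 where "M1 = sym_diff M' (bd R)"
  have sc: "dimer_covering W M1" "(M',M1) \<in> local_move W" "{y,opp z x} \<notin> M'" "{z,x} \<notin> M'"
    unfolding M1_def R_def using slide_cov[OF s(1) M'(3) G' zo] by blast+
  have bR: "bd R = {{x,y},{y,opp z x},{z,x},{z,opp z x}}" unfolding R_def by (rule bd_slide[OF s(1)])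
  have "M' = sym_diff M1 (bd R)" unfolding M1_def by blast
  then have bwd: "(M1,M') \<in> local_move W" by (intro slide_move[OF s(1) sc(1) M'(3)]) (simp only: bR)
  have M1: "M1 = (M' - {{x,y},{z,opp z x}}) \<union> {{y,opp z x},{z,x}}"
    unfolding M1_def bR by (rule sym_diff_swap[OF G' zo sc(3,4)]) (simp add: insert_commute)
  have sp: "{z,x} \<notin> E2" "{z,opp z x} \<notin> E2" "{y,opp z x} \<in> E2" "{x,y} \<in> E2"
    using tri_edges[OF s(1)] tri_edges[OF sq_opp[OF s(1)]] E1_E2_disjoint by (auto simp: insert_commute)
  have ax: "axis M1 w u = axis M' w u" if w: "w \<in> V3" for w u
  proof (cases "w = z")
    case False
    have "e \<in> M1 \<longleftrightarrow> e \<in> M'" if "w \<in> e" for e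
      using slide_keeps[OF s(1) w False that] unfolding M1_def R_def by blast
    then show ?thesis unfolding axis_def by blast
  next
    case True
    have zx: "{z,x} \<in> M1" unfolding M1 by blast
    have a: "{z,v} \<in> M1 \<longleftrightarrow> v = x" for v using cov_pair[OF sc(1) zx, of v] zx by blast
    have b: "{z,v} \<in> M' \<longleftrightarrow> v = opp z x" for v using cov_pair[OF M'(3) zo, of v] zo by blast
    show ?thesis unfolding axis_def True a b by (metis opp_opp)
  qed
  have AM: "M \<inter> E2 - {F0} \<subseteq> M'" using M'(7) by blast
  have "M1 \<inter> E2 = (M' \<inter> E2 - {{x,y}}) \<union> {{y,opp z x}}"
    unfolding M1 by (rule swap_Int[OF sp(1,2,3)])
  also have "\<dots> = (M \<inter> E2 - {F0}) \<union> ({F} \<inter> E2)"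
    unfolding s(3)[symmetric] s(4)[symmetric] by (rule swap_Un[OF M'(7,5)]) (use sp(3) s(4) in simp)
  finally have im: "M1 \<inter> E2 = (M \<inter> E2 - {F0}) \<union> ({F} \<inter> E2)" .
  have "(M,M1) \<in> local_move W ^^ Suc n" using M'(1) sc(2) by (rule relpow_Suc_I)
  moreover have "(M1,M) \<in> local_move W ^^ Suc n" using bwd M'(2) by (rule relpow_Suc_I2)
  moreover have "F \<in> M1" unfolding M1 s(4) by blast
  moreover have "F \<notin> M \<inter> E2 - {F0}" using AM sc(3) s(4) by blast
  ultimately show ?case using sc(1) ax M'(6) im by (intro exI[of _ M1]) simp
qed

text \<open>The 16 counts the offsets of \<open>x\<close> and \<open>y\<close> from
  \<open>z\<close>. It bounds the length of routes, since reachability in a finite relation takes at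
  most as many steps as the relation has pairs.\<close>

lemma slides_card: assumes "finite W" shows "finite (slides W M)" "card (slides W M) \<le> 16 * card W"
proof -
  let ?g = "\<lambda>(z,p,r). ({z + p, z + r}, {z + r, opp z (z + p)}) :: point set \<times> point set"
  have sub: "slides W M \<subseteq> ?g ` (W \<times> diag \<times> diag)"
  proof
    fix q assume "q \<in> slides W M"
    then obtain z x y where q: "sq z x y" "z \<in> W" "q = ({x,y},{y,opp z x})" unfolding slides_def by blast
    obtain p r where "p \<in> diag" "r \<in> diag" "x = z + p" "y = z + r" using q(1) by (rule sqE)
    then show "q \<in> ?g ` (W \<times> diag \<times> diag)" using q(2,3) by (intro image_eqI[of _ _ "(z,p,r)"]) auto
  qed
  have d: "finite diag" "card diag = 4" unfolding diag_def by simp_all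
  then have fin: "finite (W \<times> diag \<times> diag)" using assms by simp
  then show "finite (slides W M)" using sub finite_subset by blast
  have "card (slides W M) \<le> card (W \<times> diag \<times> diag)" using surj_card_le[OF fin sub] .
  then show "card (slides W M) \<le> 16 * card W" using d by (simp add: card_cartesian_product)
qed

lemma even_two: "finite A \<Longrightarrow> even (card A) \<Longrightarrow> a \<in> A \<Longrightarrow> card A \<ge> 2"
proof -
  assume a: "finite A" "even (card A)" "a \<in> A"
  then have "card A \<noteq> 0" by auto
  moreover have "card A \<noteq> 1" using a(2) by auto
  ultimately show ?thesis by linarith
qed

text \<open>The triangles swept by an impurity that never meets the border form a set \<open>K\<close> whose boundary
  runs along axes only.  Counting, every black vertex on this boundary is matched to a white one at
  all times, although the impurity visits it; so \<open>K\<close> is a finite set without boundary.\<close>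

lemma slide_to_border:
  assumes fW: "finite W" and M: "dimer_covering W M" and F0: "F0 \<in> M" "F0 \<in> E2"
  shows "\<exists>F. (F0,F) \<in> (slides W M)\<^sup>* \<and> F \<in> E2 \<and> (\<exists>t\<in>Tri. F \<subseteq> t \<and> \<not> t \<subseteq> W)"
proof (rule ccontr)
  assume no: "\<not> ?thesis"
  define A where "A = {F. (F0,F) \<in> (slides W M)\<^sup>*}"
  have AE: "F \<in> E2" if "F \<in> A" for F
  proof -
    have "(F0,F) \<in> (slides W M)\<^sup>*" using that unfolding A_def by simp
    then show ?thesis
    proof (cases rule: rtranclE)
      case (step G)
      then obtain z x y where "sq z x y" "F = {y,opp z x}" unfolding slides_def by blast
      then show ?thesis using tri_edges(3)[OF sq_opp[of z x y]] by (simp add: insert_commute)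
    qed (use F0 in simp)
  qed
  define K where "K = {t \<in> Tri. \<exists>F\<in>A. F \<subseteq> t}"
  have KT: "K \<subseteq> Tri" unfolding K_def by blast
  have KW: "t \<subseteq> W" if "t \<in> K" for t using that no AE unfolding K_def A_def by blast
  have fK: "finite K" by (rule finite_subset[of _ "Pow W"]) (use KW fW in auto)
  have KF: "{x,y} \<in> A" if t: "{z,x,y} \<in> K" and s: "sq z x y" for z x y
  proof -
    obtain F where F: "F \<in> A" "F \<subseteq> {z,x,y}" using t unfolding K_def by blast
    have "F = {z,x} \<or> F = {z,y} \<or> F = {x,y}" using edge_in_tri[OF TriI[OF s] _ F(2) refl s] AE[OF F(1)] by blast
    moreover have "{z,x} \<notin> E2" "{z,y} \<notin> E2" using tri_edges[OF s] E1_E2_disjoint by blast+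
    ultimately show ?thesis using F(1) AE[OF F(1)] by metis
  qed
  \<comment> \<open>A reached position brings both of its triangles into \<open>K\<close>, so no
    side is on the boundary of \<open>K\<close>.\<close>
  have bE: "e \<in> E1" if e: "e \<in> bd K" for e
  proof (rule ccontr)
    assume "e \<notin> E1"
    then have e2: "e \<in> E2" using e bd_edges by blast
    obtain z0 x y where xy: "e = {x,y}" "sq z0 x y" using e2 by (rule E2E)
    obtain t1 t2 where t: "t1 \<in> K" "t2 \<notin> K" "t1 \<in> Tri" "t2 \<in> Tri" "e \<subseteq> t1" "e \<subseteq> t2"
      by (rule bdE[OF e KT]) blast
    have "t1 \<in> {t \<in> Tri. {x,y} \<subseteq> t}" using t xy by simp
    then have "t1 = {z0,x,y} \<or> t1 = {other z0 x y,x,y}" unfolding side_tri[OF xy(2)] by simp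
    then obtain z where z: "sq z x y" "t1 = {z,x,y}" using xy(2) sq_other[OF xy(2)] by blast
    have "e \<in> A" using KF[of z x y] t(1) z xy(1) by simp
    then show False using t(2,4,6) unfolding K_def by blast
  qed
  have step: "{z,y,opp z x} \<in> K" if t: "{z,x,y} \<in> K" and s: "sq z x y" and a: "axis M z x" for z x y
  proof -
    have "{x,y} \<in> A" using KF[OF t s] .
    moreover have "z \<in> W" using KW[OF t] by simp
    ultimately have "({x,y},{y,opp z x}) \<in> slides W M" unfolding slides_def using s a by blast
    then have "{y,opp z x} \<in> A" using \<open>{x,y} \<in> A\<close> unfolding A_def by (simp add: rtrancl_into_rtrancl)
    then show ?thesis unfolding K_def using TriI[OF sq_sym[OF sq_opp[OF s]]] by blast
  qed
  have axs: "axis M z (opp z x) = axis M z x" for z x unfolding axis_def by auto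
  \<comment> \<open>Slides cross the spokes perpendicular to the axis, in both directions; such a
    spoke has both of its triangles in \<open>K\<close> or neither.\<close>
  have noax: "{z,y} \<notin> bd K" if s: "sq z x y" and a: "axis M z x" for z x y
  proof
    assume "{z,y} \<in> bd K"
    then have ne: "({z,y,x} \<in> K) \<noteq> ({z,y,opp z x} \<in> K)" using bd_spoke[OF KT sq_sym[OF s]] by blast
    have "{z,y,opp z x} \<in> K" if "{z,y,x} \<in> K"
      using step[OF _ s a] that by (simp add: insert_commute)
    moreover have "{z,y,x} \<in> K" if "{z,y,opp z x} \<in> K"
      using step[OF _ sq_opp[OF s]] that a axs[of z x] by (simp add: insert_commute)
    ultimately show False using ne by blast
  qed
  have bax: "axis M z b" if e: "{z,b} \<in> bd K" and z: "z \<in> V3" for z b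
  proof -
    have cb: "cor z b" using white_E1[OF bE[OF e] z] .
    obtain y where s: "sq z b y" using cor_sq[OF cb] by blast
    obtain t where "t \<in> K" "{z,b} \<subseteq> t" using bd_edge_tri[OF e] by blast
    then have zW: "z \<in> W" using KW by blast
    obtain m where m: "{z,m} \<in> M" using cov_mate[OF M zW] by blast
    have "cor z m" using white_edge cov_edges[OF M m] z by blast
    then have "m = b \<or> m = y \<or> m = opp z b \<or> m = opp z y" using cor_cases[OF s] by blast
    then have "axis M z b \<or> axis M z y" using m unfolding axis_def by auto
    then show ?thesis using noax[OF sq_sym[OF s]] e by blast
  qed
  have ev: "even_set (bd K)" using bd_even_set[OF fK KT] .
  have fb: "finite (bd K)" using ev unfolding even_set_def by blast
  define P where "P = {z \<in> V3. \<exists>e\<in>bd K. z \<in> e}"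
  define V where "V = {b \<in> Z2. \<exists>e\<in>bd K. b \<in> e}"
  have at: "{e \<in> bd K. z \<in> e} = {{z,b},{z,opp z b}}" if e: "{z,b} \<in> bd K" and z: "z \<in> V3" for z b
  proof -
    have cb: "cor z b" using white_E1[OF bE[OF e] z] .
    have "f = {z,b} \<or> f = {z,opp z b}" if f: "f \<in> bd K" "z \<in> f" for f
    proof -
      have "f \<in> E1 \<union> E2" using f(1) bd_edges by blast
      then obtain u where u: "f = {z,u}" using edge_card[of f] f(2) by blast
      have cu: "cor z u" using white_E1[OF _ z] bE[OF f(1)] u by blast
      obtain y where s: "sq z b y" using cor_sq[OF cb] by blast
      have "u \<noteq> y" "u \<noteq> opp z y"
        using noax[OF s bax[OF e z]] noax[OF sq_opp2[OF s] bax[OF e z]] f(1) unfolding u by blast+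
      then have "u = b \<or> u = opp z b" using cor_cases[OF s] cu by blast
      then show ?thesis using u by blast
    qed
    then have sub: "{e \<in> bd K. z \<in> e} \<subseteq> {{z,b},{z,opp z b}}" by (intro subsetI) simp
    have "even (card {e \<in> bd K. z \<in> e})" using ev unfolding even_set_def by blast
    then have "2 \<le> card {e \<in> bd K. z \<in> e}" using even_two[of "{e \<in> bd K. z \<in> e}" "{z,b}"] fb e by simp
    moreover have "card {{z,b},{z,opp z b}} \<le> 2" by (simp add: card_insert_if)
    ultimately show ?thesis using card_seteq[OF _ sub] by simp
  qed
  have getP: "\<exists>b. {z,b} \<in> bd K" if z: "z \<in> P" for z
  proof -
    obtain e where e: "e \<in> bd K" "z \<in> e" using z unfolding P_def by blast
    then obtain u where "e = {z,u}" using edge_card[of e] bd_edges by blast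
    then show ?thesis using e(1) by blast
  qed
  have P2: "card {e \<in> bd K. z \<in> e} = 2" if z: "z \<in> P" for z
  proof -
    obtain b where b: "{z,b} \<in> bd K" using getP[OF z] by blast
    have zV: "z \<in> V3" using z unfolding P_def by blast
    have cb: "cor z b" using white_E1[OF bE[OF b] zV] .
    have "{z,b} \<noteq> {z,opp z b}" using opp_neq[OF cb] by (auto simp: doubleton_eq_iff)
    then show ?thesis unfolding at[OF b zV] by simp
  qed
  have V2: "2 \<le> card {e \<in> bd K. v \<in> e}" if v: "v \<in> V" for v
  proof -
    obtain e where e: "e \<in> bd K" "v \<in> e" using v unfolding V_def by blast
    have "even (card {e \<in> bd K. v \<in> e})" using ev unfolding even_set_def by blast
    then show ?thesis using even_two[of "{e \<in> bd K. v \<in> e}" e] fb e by simp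
  qed
  have bKW: "v \<in> W" if "e \<in> bd K" "v \<in> e" for e v using bd_edge_tri[OF that(1)] that(2) KW by blast
  have "P \<subseteq> W" "V \<subseteq> W" unfolding P_def V_def using bKW by auto
  then have fin: "finite P" "finite V" using fW by (simp_all add: finite_subset)
  have cards: "card (bd K) = (\<Sum>v\<in>Q. card {e \<in> bd K. v \<in> e})"
    if Q: "finite Q" "\<And>e. e \<in> bd K \<Longrightarrow> \<exists>v\<in>Q. v \<in> e" "\<And>e u v. e \<in> bd K \<Longrightarrow> u \<in> Q \<Longrightarrow> v \<in> Q \<Longrightarrow> u \<in> e \<Longrightarrow> v \<in> e \<Longrightarrow> u = v" for Q
  proof -
    have "bd K = (\<Union>v\<in>Q. {e \<in> bd K. v \<in> e})" using Q(2) by blast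
    then have "card (bd K) = card (\<Union>v\<in>Q. {e \<in> bd K. v \<in> e})" by simp
    also have "\<dots> = (\<Sum>v\<in>Q. card {e \<in> bd K. v \<in> e})"
      by (rule card_UN_disjoint) (use Q fb in auto)
    finally show ?thesis .
  qed
  have wb: "\<exists>z b. e = {z,b} \<and> z \<in> P \<and> b \<in> V \<and> z \<notin> V \<and> b \<notin> P" if e: "e \<in> bd K" for e
  proof -
    obtain z b where zb: "e = {z,b}" "cor z b" using bE[OF e] by (rule E1E)
    have c: "z \<in> V3" "b \<in> Z2" using cor_white[OF zb(2)] cor_black[OF zb(2)] .
    then have n: "z \<notin> Z2" "b \<notin> V3" using white_not_black by blast+
    have "\<exists>e\<in>bd K. z \<in> e" "\<exists>e\<in>bd K. b \<in> e" using e zb(1) by blast+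
    then have "z \<in> P" "b \<in> V" "z \<notin> V" "b \<notin> P" unfolding P_def V_def using c n by simp_all
    then show ?thesis using zb(1) by metis
  qed
  have "card (bd K) = (\<Sum>v\<in>P. card {e \<in> bd K. v \<in> e})"
  proof (rule cards[OF fin(1)])
    show "\<exists>v\<in>P. v \<in> e" if "e \<in> bd K" for e using wb[OF that] by blast
    show "u = v" if "e \<in> bd K" "u \<in> P" "v \<in> P" "u \<in> e" "v \<in> e" for e u v using wb[OF that(1)] that by blast
  qed
  then have c1: "card (bd K) = 2 * card P" using P2 by simp
  have "card (bd K) = (\<Sum>v\<in>V. card {e \<in> bd K. v \<in> e})"
  proof (rule cards[OF fin(2)])
    show "\<exists>v\<in>V. v \<in> e" if "e \<in> bd K" for e using wb[OF that] by blast
    show "u = v" if "e \<in> bd K" "u \<in> V" "v \<in> V" "u \<in> e" "v \<in> e" for e u v using wb[OF that(1)] that by blast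
  qed
  also have "\<dots> \<ge> (\<Sum>v\<in>V. 2)" by (rule sum_mono) (use V2 in auto)
  finally have c2: "2 * card V \<le> card (bd K)" by simp
  \<comment> \<open>Every boundary edge joins \<open>P\<close> to \<open>V\<close>. A vertex of
    \<open>P\<close> has exactly two of them, along its axis, and a vertex of \<open>V\<close> has
    at least two by evenness.\<close>
  have VP: "card V \<le> card P" using c1 c2 by simp
  have "bd K = {}"
  proof (rule ccontr)
    assume "bd K \<noteq> {}"
    then obtain e where e: "e \<in> bd K" by blast
    obtain z v where zv: "e = {z,v}" "cor z v" using bE[OF e] by (rule E1E)
    have vV: "v \<in> V" unfolding V_def using e zv cor_black[OF zv(2)] by blast
    obtain t where t: "t \<in> K" "e \<subseteq> t" using bd_edge_tri[OF e] by blast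
    have zt: "z \<in> t" "v \<in> t" "t \<in> Tri" using t zv KT by auto
    obtain p q where pq: "t = {z,p,q}" "sq z p q" using white_tri[OF cor_white[OF zv(2)] zt(3,1)] .
    have FA: "{p,q} \<in> A" using KF[OF _ pq(2)] t(1) pq(1) by simp
    have vz: "v \<noteq> z" using zv(2) cor_black cor_white white_not_black by blast
    have "v \<in> {p,q}" using zt(2) pq(1) vz by blast
    then obtain q' where q': "{p,q} = {v,q'}" "q' \<in> Z2" using sqD(5,6)[OF pq(2)] by blast
    have "(F0,{p,q}) \<in> (slides W M)\<^sup>*" using FA unfolding A_def by simp
    then obtain n where "(F0,{p,q}) \<in> slides W M ^^ n" using rtrancl_imp_relpow by blast
    from slide_along[OF M F0(1) this] obtain M' where M': "dimer_covering W M'" "{p,q} \<in> M'"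
      "\<forall>z\<in>V3. \<forall>x. axis M' z x = axis M z x" by blast
    define m where "m w = (SOME u. {w,u} \<in> M')" for w
    have m: "{w, m w} \<in> M'" if "w \<in> W" for w unfolding m_def using cov_mate[OF M'(1) that] by (metis someI_ex)
    have PW: "w \<in> W" if "w \<in> P" for w using that bKW unfolding P_def by blast
    \<comment> \<open>The mate of a white boundary vertex stays on its axis, and both ends of that
      axis are black boundary vertices. Injectivity and the comparison of sizes then make
      \<open>m\<close> surjective onto \<open>V\<close>, although the impurity of \<open>M'\<close>
      sits at \<open>v\<close>.\<close>
    have mV: "m w \<in> V" if w: "w \<in> P" for w
    proof -
      obtain b where b: "{w,b} \<in> bd K" using getP[OF w] by blast
      have wV: "w \<in> V3" using w unfolding P_def by blast
      have cb: "cor w b" using white_E1[OF bE[OF b] wV] .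
      have ob: "{w,opp w b} \<in> bd K" using at[OF b wV] by blast
      have "axis M' w b" using bax[OF b wV] M'(3) wV by blast
      then have "m w = b \<or> m w = opp w b" using m[OF PW[OF w]] cov_pair[OF M'(1)] unfolding axis_def by blast
      moreover have "b \<in> Z2" "opp w b \<in> Z2" using cb cor_black cor_opp by blast+
      moreover have "b \<in> V" "opp w b \<in> V" unfolding V_def using calculation b ob by auto
      ultimately show ?thesis by metis
    qed
    have inj: "inj_on m P"
    proof (rule inj_onI)
      fix a b assume "a \<in> P" "b \<in> P" "m a = m b"
      then have "{m a, a} \<in> M'" "{m a, b} \<in> M'" using m PW by (metis insert_commute)+
      then show "a = b" by (rule cov_pair[OF M'(1)])
    qed
    have sub: "m ` P \<subseteq> V" using mV by blast
    have "card V \<le> card (m ` P)" using VP card_image[OF inj] by simp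
    then have "m ` P = V" using card_seteq[OF fin(2) sub] by blast
    then obtain w where w: "w \<in> P" "v = m w" using vV by blast
    have "{v,w} \<in> M'" using m[OF PW[OF w(1)]] w(2) by (simp add: insert_commute)
    moreover have "{v,q'} \<in> M'" using M'(2) q'(1) by simp
    ultimately have "w = q'" by (rule cov_pair[OF M'(1)])
    then show False using w(1) q'(2) white_not_black unfolding P_def by blast
  qed
  then have "K = {}" by (rule bd_eq_empty[OF fK KT])
  moreover have "K \<noteq> {}"
  proof -
    have "F0 \<in> E1 \<union> E2" using F0 by blast
    then obtain t where "t \<in> Tri" "F0 \<subseteq> t" using edge_triE by metis
    moreover have "F0 \<in> A" unfolding A_def by simp
    ultimately show ?thesis unfolding K_def by blast
  qed
  ultimately show False by blast
qed

section \<open>Connecting two coverings\<close>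

definition inner_impurities :: "point set \<Rightarrow> point set set \<Rightarrow> point set set" where
  "inner_impurities W M = {e \<in> M \<inter> E2. \<forall>t\<in>Tri. e \<subseteq> t \<longrightarrow> t \<subseteq> W}"

text \<open>The impurities are treated one by one, since a route leaves the others where they are.
  Both directions are stated because for the target covering the passage is run backwards.\<close>

lemma slide_all_to_border:
  assumes fW: "finite W"
  shows "dimer_covering W M \<Longrightarrow> \<exists>M'. reach W (16 * card W * card (inner_impurities W M)) M M' \<and>
     reach W (16 * card W * card (inner_impurities W M)) M' M \<and> dimer_covering W M' \<and> inner_impurities W M' = {}"
proof (induction "card (inner_impurities W M)" arbitrary: M)
  case 0
  have "finite (inner_impurities W M)" using cov_finite[OF fW 0(2)] unfolding inner_impurities_def by simp
  then have "inner_impurities W M = {}" using 0(1) by simp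
  then show ?case using reach_refl 0(2) by blast
next
  case (Suc n)
  note M = Suc.prems
  have "inner_impurities W M \<noteq> {}" using Suc.hyps(2) by (metis card.empty nat.distinct(1))
  then obtain F0 where F0: "F0 \<in> inner_impurities W M" by blast
  then have F0': "F0 \<in> M" "F0 \<in> E2" unfolding inner_impurities_def by blast+
  obtain F where F: "(F0,F) \<in> (slides W M)\<^sup>*" "F \<in> E2" "\<exists>t\<in>Tri. F \<subseteq> t \<and> \<not> t \<subseteq> W"
    using slide_to_border[OF fW M F0'] by blast
  have "(F0,F) \<in> (\<Union>j\<in>{j. j \<le> card (slides W M)}. slides W M ^^ j)"
    using F(1) rtrancl_finite_eq_relpow[OF slides_card(1)[OF fW]] by metis
  then obtain j where j: "j \<le> card (slides W M)" "(F0,F) \<in> slides W M ^^ j" by blast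
  have jW: "j \<le> 16 * card W" using j(1) slides_card(2)[OF fW, of M] by linarith
  obtain M1 where M1: "(M,M1) \<in> local_move W ^^ j" "(M1,M) \<in> local_move W ^^ j" "dimer_covering W M1"
     "M1 \<inter> E2 = (M \<inter> E2 - {F0}) \<union> ({F} \<inter> E2)"
    using slide_along[OF M F0'(1) j(2)] by blast
  have eq: "inner_impurities W M1 = inner_impurities W M - {F0}"
  proof (intro equalityI subsetI)
    fix e assume "e \<in> inner_impurities W M1"
    then have e: "e \<in> M1 \<inter> E2" "\<forall>t\<in>Tri. e \<subseteq> t \<longrightarrow> t \<subseteq> W" unfolding inner_impurities_def by simp_all
    then have "e \<noteq> F" using F(3) by blast
    then have "e \<in> M \<inter> E2 - {F0}" using e(1) unfolding M1(4) by blast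
    then show "e \<in> inner_impurities W M - {F0}" using e(2) unfolding inner_impurities_def by simp
  next
    fix e assume e: "e \<in> inner_impurities W M - {F0}"
    then have "e \<in> M1 \<inter> E2" unfolding M1(4) inner_impurities_def by simp
    then show "e \<in> inner_impurities W M1" using e unfolding inner_impurities_def by simp
  qed
  then have cn: "n = card (inner_impurities W M1)" using Suc.hyps(2) F0 by simp
  obtain M' where M': "reach W (16 * card W * card (inner_impurities W M1)) M1 M'"
     "reach W (16 * card W * card (inner_impurities W M1)) M' M1" "dimer_covering W M'" "inner_impurities W M' = {}"
    using Suc.hyps(1)[OF cn M1(3)] by (elim exE conjE) (rule that)
  have r1: "reach W (16 * card W) M M1" "reach W (16 * card W) M1 M"
    unfolding reach_def using M1(1,2) jW by blast+
  have sum: "16 * card W * card (inner_impurities W M) = 16 * card W + 16 * card W * card (inner_impurities W M1)"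
    unfolding Suc.hyps(2)[symmetric] cn[symmetric] by simp
  have sum2: "16 * card W * card (inner_impurities W M) = 16 * card W * card (inner_impurities W M1) + 16 * card W"
    using sum by simp
  have "reach W (16 * card W * card (inner_impurities W M)) M M'" unfolding sum by (rule reach_trans[OF r1(1) M'(1)])
  moreover have "reach W (16 * card W * card (inner_impurities W M)) M' M" unfolding sum2 by (rule reach_trans[OF M'(2) r1(2)])
  ultimately show ?case using M'(3,4) by (intro exI[of _ M']) simp
qed

lemma circuit_area:
  assumes fW: "finite W" and D: "D \<subseteq> TW W"
  shows "real (card D) \<le> 4 * sqrt (card W) * card (bd D)"
proof -
  have fD: "finite D" "D \<subseteq> Tri" using D TW_finite[OF fW] TW_Tri finite_subset by blast+
  have "whites D \<subseteq> W" using D unfolding whites_def TW_def by blast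
  then have "card D \<le> 4 * card W" using whites_card[OF fD] card_mono[OF fW, of "whites D"] by linarith
  then have "card D * card D \<le> (4 * card W) * (4 * (card (bd D))\<^sup>2)"
    using isoperimetric[OF fD] by (intro mult_le_mono)
  then have "real (card D * card D) \<le> real ((4 * card W) * (4 * (card (bd D))\<^sup>2))" by (rule of_nat_mono)
  then have "(real (card D))\<^sup>2 \<le> 16 * real (card W) * (real (card (bd D)))\<^sup>2" by (simp add: power2_eq_square)
  also have "\<dots> = (4 * sqrt (card W) * card (bd D))\<^sup>2" by (simp add: power_mult_distrib)
  finally show ?thesis by (rule power2_le_imp_le) simp
qed

text \<open>A border impurity has a triangle outside \<open>W\<close>, hence outside every filling
  in \<open>W\<close>, so the hypotheses of a rotation hold. Switching a circuit creates no inner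
  impurity, because all edges of the new covering come from \<open>M\<close> or \<open>M'\<close>.
  The circuits are disjoint, so their lengths add up.\<close>

lemma border_connected:
  assumes fW: "finite W" and sc: "fillable W" and k: "\<And>M. dimer_covering W M \<Longrightarrow> card (impurities M) \<le> k"
    and M': "dimer_covering W M'" "inner_impurities W M' = {}"
  shows "dimer_covering W M \<Longrightarrow> inner_impurities W M = {} \<Longrightarrow>
    \<exists>n. reach W n M M' \<and> real n \<le> (real k + 1) * (4 * sqrt (card W)) * card (sym_diff M M')"
proof (induction "card (sym_diff M M')" arbitrary: M rule: less_induct)
  case less
  note M = less.prems
  have ev: "even_set (sym_diff M M')" by (rule cov_sym_diff_even_set[OF fW M(1) M'(1)])
  show ?case
  proof (cases "sym_diff M M' = {}")
    case True
    then have "M = M'" by blast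
    then show ?thesis using reach_refl[of W 0 M] by (intro exI[of _ 0]) simp
  next
    case False
    then obtain g where "g \<in> sym_diff M M'" by blast
    then obtain c where c: "c \<subseteq> sym_diff M M'" "circuit c" using circuit_through[OF ev] by blast
    have cov: "dimer_covering W (sym_diff M c)"
      by (rule cov_sub[OF M(1) M'(1) c(1)]) (use c(2) circuit_def in blast)
    have "c \<subseteq> induced_edges W" using c(1) M(1) M'(1) unfolding dimer_covering_def by blast
    then have "\<exists>D\<subseteq>TW W. bd D = c" using sc c(2) unfolding fillable_def circuit_def by simp
    then obtain D where D: "D \<subseteq> TW W" "bd D = c" by blast
    have cir: "circuit (bd D)" using c(2) D(2) by simp
    have "config W M D" unfolding config_def D(2)
    proof (intro conjI ballI)
      show "\<exists>t\<in>Tri. e \<subseteq> t \<and> t \<notin> D" if "e \<in> M \<inter> E2" for e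
      proof -
        have "e \<notin> inner_impurities W M" using M(2) by simp
        then have "\<exists>t\<in>Tri. e \<subseteq> t \<and> \<not> t \<subseteq> W" using that unfolding inner_impurities_def by simp
        then show ?thesis using D(1) unfolding TW_def by blast
      qed
    qed (use M(1) cov D(1) hole_free_circuit[OF fW D(1) cir] in auto)
    then have r1: "reach W ((k + 1) * card D) M (sym_diff M c)" using rotate[OF fW sc k] D(2) by metis
    have "e \<in> M \<or> e \<in> M'" if "e \<in> sym_diff M c" for e using that c(1) by blast
    then have inn: "inner_impurities W (sym_diff M c) = {}" using M(2) M'(2) unfolding inner_impurities_def by blast
    have eq: "sym_diff (sym_diff M c) M' = sym_diff M M' - c" using c(1) by blast
    have fin: "finite (sym_diff M M')" using ev unfolding even_set_def by blast
    have fc: "finite c" using fin c(1) finite_subset by blast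
    have "c \<noteq> {}" using c(2) unfolding circuit_def by blast
    then have "sym_diff M M' - c \<subset> sym_diff M M'" using c(1) by blast
    then have lt: "card (sym_diff (sym_diff M c) M') < card (sym_diff M M')"
      unfolding eq by (rule psubset_card_mono[OF fin])
    obtain n where n: "reach W n (sym_diff M c) M'"
      "real n \<le> (real k + 1) * (4 * sqrt (card W)) * card (sym_diff (sym_diff M c) M')"
      using less.hyps[OF lt cov inn] by blast
    have cs: "card (sym_diff M M') = card c + card (sym_diff (sym_diff M c) M')"
      unfolding eq using card_Diff_subset[OF fc c(1)] card_mono[OF fin c(1)] by simp
    have "real ((k + 1) * card D) = (real k + 1) * real (card D)" by (simp add: algebra_simps)
    also have "\<dots> \<le> (real k + 1) * (4 * sqrt (card W) * card c)"
      using circuit_area[OF fW D(1)] unfolding D(2) by (intro mult_left_mono) auto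
    finally have b1: "real ((k + 1) * card D) \<le> (real k + 1) * (4 * sqrt (card W)) * card c" by (simp add: mult.assoc)
    have "real ((k + 1) * card D + n) \<le> (real k + 1) * (4 * sqrt (card W)) * card (sym_diff M M')"
      using b1 n(2) unfolding cs of_nat_add distrib_left by linarith
    moreover have "reach W ((k + 1) * card D + n) M M'" by (rule reach_trans[OF r1 n(1)])
    ultimately show ?thesis by blast
  qed
qed

lemma cov_card: assumes fW: "finite W" and M: "dimer_covering W M" shows "card M \<le> card W"
proof -
  define g where "g e = (SOME v. v \<in> e)" for e :: "point set"
  have g: "g e \<in> e" if e: "e \<in> M" for e
  proof -
    have "e \<noteq> {}" using edge_card[of e] cov_edges[OF M e] by blast
    then show ?thesis unfolding g_def using some_in_eq by blast
  qed
  have "inj_on g M" using g cov_unique[OF M] by (metis inj_onI)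
  moreover have "g ` M \<subseteq> W" using g cov_edges[OF M] by blast
  ultimately show ?thesis using card_inj_on_le fW by blast
qed

text \<open>In the constant 48, two passages to the border contribute 16 each, and the circuits
  contribute 16 as the product of 2 from \<open>k + 1 \<le> 2 * k\<close>, 4 from the area estimate
  and 2 from the size of the symmetric difference.\<close>

theorem connected_coverings:
  assumes fW: "finite W" and sc: "fillable W" and k: "\<And>M. dimer_covering W M \<Longrightarrow> card (impurities M) \<le> k" "k \<ge> 1"
    and M: "dimer_covering W M" and M': "dimer_covering W M'"
  shows "\<exists>s. (M, M') \<in> local_move W ^^ s \<and> real s \<le> 48 * (real k)\<^sup>2 * real (card W) powr (3/2)"
proof (cases "W = {}")
  case True
  have "A = {}" if A: "dimer_covering W A" for A
  proof (rule equals0I)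
    fix e assume e: "e \<in> A"
    obtain u v where "e = {u,v}" using edge_card cov_edges[OF A e] by blast
    then show False using cov_edges[OF A e] True by simp
  qed
  then have "M = {}" "M' = {}" using M M' by simp_all
  then show ?thesis by (intro exI[of _ 0]) simp
next
  case False
  define N where "N = real (card W)"
  have N1: "N \<ge> 1" unfolding N_def using False fW by (simp add: Suc_le_eq card_gt_0_iff)
  have inner: "card (inner_impurities W A) \<le> k" if A: "dimer_covering W A" for A
  proof -
    have "inner_impurities W A \<subseteq> impurities A" unfolding inner_impurities_def impurities_def by blast
    moreover have "finite (impurities A)" using cov_finite[OF fW A] unfolding impurities_def by simp
    ultimately show ?thesis using card_mono k(1)[OF A] le_trans by metis
  qed
  obtain A where A: "reach W (16 * card W * card (inner_impurities W M)) M A" "dimer_covering W A" "inner_impurities W A = {}"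
    using slide_all_to_border[OF fW M] by (elim exE conjE) (rule that)
  obtain B where B: "reach W (16 * card W * card (inner_impurities W M')) B M'" "dimer_covering W B" "inner_impurities W B = {}"
    using slide_all_to_border[OF fW M'] by (elim exE conjE) (rule that)
  obtain n where n: "reach W n A B" "real n \<le> (real k + 1) * (4 * sqrt (card W)) * card (sym_diff A B)"
    using border_connected[OF fW sc k(1) B(2,3) A(2,3)] by blast
  have "reach W (16 * card W * k) M A" "reach W (16 * card W * k) B M'"
    using reach_mono[OF A(1)] reach_mono[OF B(1)] inner[OF M] inner[OF M'] by simp_all
  then have "reach W (16 * card W * k + (n + 16 * card W * k)) M M'"
    using n(1) reach_trans by blast
  then obtain s where s: "s \<le> 16 * card W * k + (n + 16 * card W * k)" "(M,M') \<in> local_move W ^^ s"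
    unfolding reach_def by blast
  have "card (sym_diff A B) \<le> card (A \<union> B)"
    by (rule card_mono) (use cov_finite[OF fW A(2)] cov_finite[OF fW B(2)] in auto)
  also have "\<dots> \<le> card A + card B" by (rule card_Un_le)
  finally have "card (sym_diff A B) \<le> 2 * card W" using cov_card[OF fW A(2)] cov_card[OF fW B(2)] by simp
  then have cAB: "real (card (sym_diff A B)) \<le> 2 * N" unfolding N_def by linarith
  have k1: "real k \<ge> 1" using k(2) by simp
  have sq1: "sqrt N \<ge> 1" using N1 by simp
  have pw: "N powr (3/2) = N * sqrt N"
  proof -
    have "N powr (3/2) = N powr (1 + 1/2)" by simp
    also have "\<dots> = N powr 1 * N powr (1/2)" by (rule powr_add)
    finally show ?thesis using N1 by (simp add: powr_half_sqrt)
  qed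
  have "real n \<le> (real k + 1) * (4 * sqrt N) * (2 * N)"
  proof -
    have "(real k + 1) * (4 * sqrt (card W)) * card (sym_diff A B) \<le> (real k + 1) * (4 * sqrt N) * (2 * N)"
      using cAB unfolding N_def by (intro mult_left_mono) auto
    then show ?thesis using n(2) by linarith
  qed
  also have "\<dots> \<le> (2 * real k) * (4 * sqrt N) * (2 * N)"
    using k1 sq1 N1 by (intro mult_right_mono) auto
  finally have n16: "real n \<le> 16 * real k * (N * sqrt N)" by (simp add: mult_ac)
  have NN: "N \<le> N * sqrt N" using N1 sq1 by simp
  have "real s \<le> 32 * real k * N + real n" using s(1) of_nat_mono[OF s(1), where 'a = real] unfolding N_def by (simp add: algebra_simps)
  also have "\<dots> \<le> 32 * real k * (N * sqrt N) + 16 * real k * (N * sqrt N)"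
    using n16 NN k1 by (intro add_mono mult_left_mono) auto
  also have "\<dots> = 48 * real k * (N * sqrt N)" by simp
  also have "\<dots> \<le> 48 * (real k)\<^sup>2 * (N * sqrt N)"
    using k1 N1 sq1 by (intro mult_right_mono) (auto simp: power2_eq_square)
  finally have "real s \<le> 48 * (real k)\<^sup>2 * N powr (3/2)" unfolding pw .
  then show ?thesis using s(2) unfolding N_def by blast
qed

section \<open>Euler's formula\<close>

lemma leaving_edge:
  assumes "(u,v) \<in> R\<^sup>*" "u \<in> A" "v \<notin> A" shows "\<exists>a b. (a,b) \<in> R \<and> a \<in> A \<and> b \<notin> A"
proof -
  have "u \<in> A \<longrightarrow> v \<in> A \<or> (\<exists>a b. (a,b) \<in> R \<and> a \<in> A \<and> b \<notin> A)"
    using assms(1) by (induction rule: rtrancl_induct) blast+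
  then show ?thesis using assms by blast
qed

lemma induced_finite: "finite W \<Longrightarrow> finite (induced_edges W)"
  unfolding induced_edges_def by (rule finite_subset[of _ "Pow W"]) auto

text \<open>Acyclicity is expressed by the absence of nonempty even subsets. It survives the growth
  of the tree, since the added edge is the only one at its new vertex and so belongs to no even
  set.\<close>

lemma spanning_tree:
  assumes fW: "finite W" and con: "connected_graph W"
  shows "1 \<le> n \<Longrightarrow> n \<le> card W \<Longrightarrow> \<exists>A F. A \<subseteq> W \<and> card A = n \<and> F \<subseteq> induced_edges W \<and> (\<forall>e\<in>F. e \<subseteq> A) \<and>
    card F + 1 = n \<and> (\<forall>X\<subseteq>F. even_set X \<longrightarrow> X = {})"
proof (induction n rule: dec_induct)
  case base
  then obtain w where "w \<in> W" by fastforce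
  then show ?case by (intro exI[of _ "{w}"] exI[of _ "{}"]) auto
next
  case (step n)
  obtain A F where AF: "A \<subseteq> W" "card A = n" "F \<subseteq> induced_edges W" "\<forall>e\<in>F. e \<subseteq> A" "card F + 1 = n"
    "\<forall>X\<subseteq>F. even_set X \<longrightarrow> X = {}" using step by auto
  have fA: "finite A" "finite F" using AF(1,3) fW induced_finite[OF fW] finite_subset by blast+
  have "A \<noteq> {}" using AF(2) step by auto
  then obtain u where u: "u \<in> A" by blast
  have "A \<noteq> W" using AF(2) step by auto
  then obtain v where v: "v \<in> W" "v \<notin> A" using AF(1) by blast
  have "(u,v) \<in> {(a, b). {a, b} \<in> induced_edges W}\<^sup>*" using con u v AF(1) unfolding connected_graph_def by blast
  from leaving_edge[OF this u v(2)] obtain a b where ab: "{a,b} \<in> induced_edges W" "a \<in> A" "b \<notin> A" by auto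
  have bW: "b \<in> W" using ab(1) unfolding induced_edges_def by blast
  have abF: "{a,b} \<notin> F" using AF(4) ab(3) by blast
  have noev: "X = {}" if X: "X \<subseteq> insert {a,b} F" "even_set X" for X
  proof -
    have "{a,b} \<notin> X"
    proof
      assume "{a,b} \<in> X"
      then have "{e \<in> X. b \<in> e} = {{a,b}}" using X(1) AF(4) ab(3) by blast
      then have "card {e \<in> X. b \<in> e} = 1" by simp
      then show False using X(2) unfolding even_set_def by (metis odd_one)
    qed
    then show ?thesis using X AF(6) by blast
  qed
  show ?case
  proof (intro exI conjI)
    show "insert b A \<subseteq> W" using AF(1) bW by simp
    show "card (insert b A) = Suc n" using AF(2) fA(1) ab(3) by simp
    show "insert {a,b} F \<subseteq> induced_edges W" using AF(3) ab(1) by simp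
    show "\<forall>e\<in>insert {a,b} F. e \<subseteq> insert b A" using AF(4) ab(2) by blast
    show "card (insert {a,b} F) + 1 = Suc n" using AF(5) fA(2) abF by simp
    show "\<forall>X\<subseteq>insert {a,b} F. even_set X \<longrightarrow> X = {}" using noev by simp
  qed
qed

text \<open>The boundaries of the \<open>2 ^ card (TW W)\<close> sets of triangles are distinct, and an even edge set is
  determined by its edges outside a spanning tree.\<close>

lemma euler_fillable:
  assumes fW: "finite W" "W \<noteq> {}" and con: "connected_graph W"
    and eu: "card (induced_edges W) + 1 \<le> card W + card (TW W)"
  shows "fillable W"
proof -
  let ?E = "induced_edges W"
  have cW: "1 \<le> card W" using fW by (simp add: Suc_le_eq card_gt_0_iff)
  obtain F where F: "F \<subseteq> ?E" "card F + 1 = card W" "\<forall>X\<subseteq>F. even_set X \<longrightarrow> X = {}"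
    using spanning_tree[OF fW(1) con cW order_refl] by (elim exE conjE) (rule that)
  have fE: "finite ?E" by (rule induced_finite[OF fW(1)])
  have fT: "finite (TW W)" by (rule TW_finite[OF fW(1)])
  define Ev where "Ev = {X. X \<subseteq> ?E \<and> even_set X}"
  have fEv: "finite Ev" by (rule finite_subset[of _ "Pow ?E"]) (use fE in \<open>auto simp: Ev_def\<close>)
  have inj: "inj_on (\<lambda>X. X - F) Ev"
  proof (rule inj_onI)
    fix X Y assume h: "X \<in> Ev" "Y \<in> Ev" "X - F = Y - F"
    then have "sym_diff X Y \<subseteq> F" by blast
    moreover have "even_set (sym_diff X Y)" using h even_set_sym_diff unfolding Ev_def by blast
    ultimately have "sym_diff X Y = {}" using F(3) by blast
    then show "X = Y" by blast
  qed
  have "card Ev \<le> card (Pow (?E - F))"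
    by (rule card_inj_on_le[OF inj]) (use fE in \<open>auto simp: Ev_def\<close>)
  also have "\<dots> = 2 ^ card (?E - F)" using fE by (simp add: card_Pow)
  also have "card (?E - F) = card ?E - card F" using F(1) fE by (meson card_Diff_subset finite_subset)
  also have "(2::nat) ^ (card ?E - card F) \<le> 2 ^ card (TW W)" using eu F(2) by (intro power_increasing) auto
  also have "\<dots> = card (Pow (TW W))" using fT by (simp add: card_Pow)
  also have "\<dots> = card (bd ` Pow (TW W))"
  proof (rule card_image[symmetric], rule inj_onI)
    fix A B assume h: "A \<in> Pow (TW W)" "B \<in> Pow (TW W)" "bd A = bd B"
    have AB: "A \<subseteq> TW W" "B \<subseteq> TW W" using h(1,2) by simp_all
    have "finite A" "finite B" using AB fT finite_subset by blast+
    then show "A = B" using bd_inj[of A B] AB TW_Tri[of W] h(3) by blast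
  qed
  finally have le: "card Ev \<le> card (bd ` Pow (TW W))" .
  have "bd ` Pow (TW W) \<subseteq> Ev"
  proof
    fix X assume "X \<in> bd ` Pow (TW W)"
    then obtain D where D: "D \<subseteq> TW W" "X = bd D" by blast
    have "finite D" "D \<subseteq> Tri" using D(1) fT TW_Tri finite_subset by blast+
    then have "even_set X" unfolding D(2) by (rule bd_even_set)
    moreover have "X \<subseteq> ?E" unfolding D(2) using bd_edges_of edges_of_induced[OF D(1)] by blast
    ultimately show "X \<in> Ev" unfolding Ev_def by simp
  qed
  then have eq: "bd ` Pow (TW W) = Ev" using le by (rule card_seteq[OF fEv])
  show ?thesis unfolding fillable_def
  proof (intro allI impI)
    fix X assume "X \<subseteq> ?E" "even_set X"
    then have "X \<in> bd ` Pow (TW W)" unfolding eq Ev_def by simp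
    then show "\<exists>D\<subseteq>TW W. bd D = X" by auto
  qed
qed

text \<open>The spokes of \<open>M\<close> correspond to the white vertices of \<open>W\<close>,
  because white vertices are never adjacent; the other edges of \<open>M\<close> are the
  impurities.\<close>

lemma cov_count:
  assumes fW: "finite W" and M: "dimer_covering W M"
  shows "card W = 2 * card (W \<inter> V3) + 2 * card (impurities M)"
proof -
  have fM: "finite M" by (rule cov_finite[OF fW M])
  have "\<Union>M = W"
  proof (intro equalityI subsetI)
    fix v assume "v \<in> W"
    then show "v \<in> \<Union>M" using M unfolding dimer_covering_def by blast
  next
    fix v assume "v \<in> \<Union>M"
    then show "v \<in> W" using cov_edges[OF M] by blast
  qed
  have c2: "card e = 2 \<and> finite e" if "e \<in> M" for e
  proof -
    obtain u v where "u \<noteq> v" "e = {u,v}" using edge_card cov_edges[OF M \<open>e \<in> M\<close>] by blast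
    then show ?thesis by simp
  qed
  have "pairwise disjnt M" using cov_unique[OF M] unfolding pairwise_def disjnt_def by blast
  then have "card (\<Union>M) = sum card M" using card_Union_disjoint c2 by blast
  also have "\<dots> = 2 * card M" using c2 by simp
  finally have cW: "card W = 2 * card M" unfolding \<open>\<Union>M = W\<close> .
  have ME: "M = (M \<inter> E1) \<union> impurities M" unfolding impurities_def using cov_edges[OF M] by blast
  have "(M \<inter> E1) \<inter> impurities M = {}" unfolding impurities_def using E1_E2_disjoint by blast
  then have cM: "card M = card (M \<inter> E1) + card (impurities M)"
    using ME fM card_Un_disjoint[of "M \<inter> E1" "impurities M"] by (metis finite_Un)
  have white: "\<exists>z x. e = {z,x} \<and> cor z x" if "e \<in> E1" for e using E1E[OF that] by metis
  define h where "h z = (THE e. e \<in> M \<and> z \<in> e)" for z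
  have h: "h z \<in> M \<inter> E1 \<and> z \<in> h z" if z: "z \<in> W \<inter> V3" for z
  proof -
    have "\<exists>!e. e \<in> M \<and> z \<in> e" using M z unfolding dimer_covering_def by blast
    then have hz: "h z \<in> M" "z \<in> h z" unfolding h_def using theI'[of "\<lambda>e. e \<in> M \<and> z \<in> e"] by blast+
    have "h z \<notin> E2" using E2_black[of "h z" z] hz z white_not_black by blast
    then show ?thesis using hz cov_edges[OF M hz(1)] by blast
  qed
  have "inj_on h (W \<inter> V3)"
  proof (rule inj_onI)
    fix a b assume ab: "a \<in> W \<inter> V3" "b \<in> W \<inter> V3" "h a = h b"
    obtain z x where zx: "h a = {z,x}" "cor z x" using white h[OF ab(1)] by blast
    have "x \<notin> V3" using cor_black[OF zx(2)] white_not_black by blast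
    moreover have "a \<in> {z,x}" "b \<in> {z,x}" using h[OF ab(1)] h[OF ab(2)] ab(3) zx(1) by simp_all
    ultimately show "a = b" using ab(1,2) by auto
  qed
  moreover have "h ` (W \<inter> V3) = M \<inter> E1"
  proof (intro equalityI subsetI)
    fix e assume "e \<in> h ` (W \<inter> V3)"
    then show "e \<in> M \<inter> E1" using h by blast
  next
    fix e assume e: "e \<in> M \<inter> E1"
    then obtain z x where zx: "e = {z,x}" "cor z x" using white by blast
    have z: "z \<in> W \<inter> V3" using e zx cor_white[OF zx(2)] cov_edges[OF M, of e] by blast
    have "h z = e" using cov_unique[OF M, of "h z" e z] h[OF z] e zx(1) by blast
    then show "e \<in> h ` (W \<inter> V3)" using z by blast
  qed
  ultimately have "card (M \<inter> E1) = card (W \<inter> V3)" using card_image by fastforce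
  then show ?thesis using cW cM by simp
qed

section \<open>Counting edges and triangles by the class \<open>V1\<close>\<close>

lemma V1_Z2: "V1 \<subseteq> Z2" unfolding V1_def Z2_def by blast

lemma V1_iff: "(real_of_int a, real_of_int b) \<in> V1 \<longleftrightarrow> even (a - b)"
  unfolding V1_def by auto

lemma sq_V1: assumes "sq z x y" shows "x \<in> V1 \<longleftrightarrow> y \<notin> V1"
proof -
  obtain a b :: int where x: "x = (of_int a, of_int b)" using sqD(5)[OF assms] unfolding Z2_def by auto
  obtain c d :: int where y: "y = (of_int c, of_int d)" using sqD(6)[OF assms] unfolding Z2_def by auto
  have "fst x = fst y \<and> \<bar>snd x - snd y\<bar> = 1 \<or> snd x = snd y \<and> \<bar>fst x - fst y\<bar> = 1"
    using assms unfolding sq_iff by blast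
  then have "a = c \<and> \<bar>real_of_int (b - d)\<bar> = 1 \<or> b = d \<and> \<bar>real_of_int (a - c)\<bar> = 1"
    unfolding x y by simp
  then have "a = c \<and> \<bar>b - d\<bar> = 1 \<or> b = d \<and> \<bar>a - c\<bar> = 1" by linarith
  then have "even (a - b) \<longleftrightarrow> odd (c - d)" by presburger
  then show ?thesis unfolding x y V1_iff .
qed

lemma opp_V1: assumes "cor z x" shows "opp z x \<in> V1 \<longleftrightarrow> x \<in> V1"
proof -
  obtain y where "sq z x y" using cor_sq[OF assms] by blast
  then show ?thesis using sq_V1[of z x y] sq_V1[OF sq_opp, of z x y] by blast
qed

lemma corner_classes:
  assumes z: "z \<in> V3" shows "card {v. cor z v \<and> v \<in> V1} = 2" "card {v. cor z v \<and> v \<notin> V1} = 2"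
proof -
  have "card {x. cor z x} = 4" by (rule cor_E1_card[OF z])
  then obtain x where "cor z x" by (metis (no_types, lifting) card.empty Collect_empty_eq zero_neq_numeral)
  then obtain x0 y0 where "sq z x0 y0" using cor_sq by blast
  then obtain x y where s: "sq z x y" "x \<in> V1" "y \<notin> V1" using sq_V1[of z x0 y0] sq_sym by metis
  have cv: "cor z v \<longleftrightarrow> v = x \<or> v = y \<or> v = opp z x \<or> v = opp z y" for v by (rule cor_cases[OF s(1)])
  have o: "opp z x \<in> V1" "opp z y \<notin> V1" using opp_V1 sqD[OF s(1)] s(2,3) by blast+
  have "{v. cor z v \<and> v \<in> V1} = {x, opp z x}" using cv o s(2,3) by auto
  then show "card {v. cor z v \<and> v \<in> V1} = 2" using opp_neq[OF sqD(1)[OF s(1)]] by auto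
  have "{v. cor z v \<and> v \<notin> V1} = {y, opp z y}" using cv o s(2,3) by auto
  then show "card {v. cor z v \<and> v \<notin> V1} = 2" using opp_neq[OF sqD(2)[OF s(1)]] by auto
qed

text \<open>A square has two corners in \<open>V1\<close> and two outside, and a triangle has
  exactly one in \<open>V1\<close>. Counting spokes and triangles thus reduces to counting these
  pairs.\<close>

definition V1_spokes :: "point set \<Rightarrow> (point \<times> point) set" where
  "V1_spokes W = {(z,v). z \<in> W \<and> v \<in> W \<and> v \<in> V1 \<and> cor z v}"

lemma spokes_count:
  assumes fW: "finite W"
  shows "card (induced_edges W \<inter> E1) \<le> 2 * card (W \<inter> V3) + card (V1_spokes W)"
proof -
  define J where "J = (SIGMA z:W \<inter> V3. {v. cor z v \<and> v \<notin> V1})"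
  have c2: "finite {v. cor z v \<and> v \<notin> V1}" if "z \<in> V3" for z
    by (rule card_ge_0_finite) (simp add: corner_classes(2)[OF that])
  have fJ: "finite J" unfolding J_def by (rule finite_SigmaI) (use fW c2 in auto)
  have "card J = (\<Sum>z\<in>W \<inter> V3. card {v. cor z v \<and> v \<notin> V1})"
    unfolding J_def by (rule card_SigmaI) (use fW c2 in auto)
  then have cJ: "card J = 2 * card (W \<inter> V3)" using corner_classes(2) by simp
  have fV: "finite (V1_spokes W)" by (rule finite_subset[of _ "W \<times> W"]) (use fW in \<open>auto simp: V1_spokes_def\<close>)
  have "induced_edges W \<inter> E1 \<subseteq> (\<lambda>(z,v). {z,v}) ` (J \<union> V1_spokes W)"
  proof
    fix e assume e: "e \<in> induced_edges W \<inter> E1"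
    then have "e \<in> E1" by blast
    then obtain z x where zx: "e = {z,x}" "cor z x" by (rule E1E)
    have W: "z \<in> W" "x \<in> W" using e zx(1) unfolding induced_edges_def by auto
    have "(z,x) \<in> J \<union> V1_spokes W" using W zx(2) cor_white[OF zx(2)] unfolding J_def V1_spokes_def by auto
    then show "e \<in> (\<lambda>(z,v). {z,v}) ` (J \<union> V1_spokes W)" using zx(1) by (intro image_eqI[of _ _ "(z,x)"]) auto
  qed
  then have "card (induced_edges W \<inter> E1) \<le> card (J \<union> V1_spokes W)"
    using surj_card_le[of "J \<union> V1_spokes W"] fJ fV by blast
  also have "\<dots> \<le> card J + card (V1_spokes W)" by (rule card_Un_le)
  finally show ?thesis unfolding cJ .
qed

text \<open>A spoke to \<open>V1\<close> extends by either of the two corners outside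
  \<open>V1\<close> to a triangle, and the corner of the triangle in \<open>V1\<close> recovers the
  spoke. By \<open>full\<close> these triangles lie in \<open>W\<close>.\<close>

lemma triangles_count:
  assumes fW: "finite W" and full: "\<And>z v. z \<in> W \<Longrightarrow> cor z v \<Longrightarrow> v \<notin> V1 \<Longrightarrow> v \<in> W"
  shows "2 * card (V1_spokes W) \<le> card (TW W)"
proof -
  define J where "J = (SIGMA q:V1_spokes W. {y. cor (fst q) y \<and> y \<notin> V1})"
  have fV: "finite (V1_spokes W)" by (rule finite_subset[of _ "W \<times> W"]) (use fW in \<open>auto simp: V1_spokes_def\<close>)
  have c2: "card {y. cor (fst q) y \<and> y \<notin> V1} = 2 \<and> finite {y. cor (fst q) y \<and> y \<notin> V1}" if "q \<in> V1_spokes W" for q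
  proof -
    have "fst q \<in> V3" using that cor_white unfolding V1_spokes_def by auto
    then have c: "card {y. cor (fst q) y \<and> y \<notin> V1} = 2" by (rule corner_classes(2))
    then have "finite {y. cor (fst q) y \<and> y \<notin> V1}" by (intro card_ge_0_finite) simp
    then show ?thesis using c by simp
  qed
  have "card J = (\<Sum>q\<in>V1_spokes W. card {y. cor (fst q) y \<and> y \<notin> V1})"
    unfolding J_def by (rule card_SigmaI) (use fV c2 in auto)
  then have cJ: "card J = 2 * card (V1_spokes W)" using c2 by simp
  define g where "g = (\<lambda>((z,v),y). {z,v,y} :: point set)"
  have Jq: "\<exists>z v y. q = ((z,v),y) \<and> z \<in> W \<and> v \<in> W \<and> v \<in> V1 \<and> y \<in> W \<and> y \<notin> V1 \<and> sq z v y" if "q \<in> J" for q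
  proof -
    obtain z v y where q: "q = ((z,v),y)" by (metis prod.collapse)
    have h: "z \<in> W" "v \<in> W" "v \<in> V1" "cor z v" "cor z y" "y \<notin> V1" using that unfolding q J_def V1_spokes_def by auto
    have "sq z v y" unfolding sq_def using h opp_V1[OF h(4)] by metis
    then show ?thesis using q h full by blast
  qed
  have "inj_on g J"
  proof (rule inj_onI)
    fix q q' assume J: "q \<in> J" "q' \<in> J" "g q = g q'"
    obtain z v y where q: "q = ((z,v),y)" "v \<in> V1" "y \<notin> V1" "sq z v y" using Jq[OF J(1)] by metis
    obtain z' v' y' where q': "q' = ((z',v'),y')" "v' \<in> V1" "y' \<notin> V1" "sq z' v' y'" using Jq[OF J(2)] by metis
    have "{z,v,y} = {z',v',y'}" using J(3) unfolding g_def q q' by simp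
    then have "z = z'" "{v,y} = {v',y'}" using tri_eq[OF q(4) q'(4)] by simp_all
    then show "q = q'" unfolding q q' using q(2,3) q'(2,3) by (auto simp: doubleton_eq_iff)
  qed
  moreover have "g ` J \<subseteq> TW W"
  proof
    fix t assume "t \<in> g ` J"
    then obtain q where "q \<in> J" "t = g q" by blast
    then show "t \<in> TW W" using Jq[of q] TriI unfolding g_def TW_def by auto
  qed
  ultimately show ?thesis using card_inj_on_le[of g J "TW W"] TW_finite[OF fW] cJ by simp
qed

text \<open>With \<open>w\<close> white vertices and \<open>s\<close> spokes to \<open>V1\<close>
  there are at most \<open>2 * w + s\<close> spokes and at least \<open>2 * s\<close> triangles, so
  Euler's inequality follows from \<open>eu\<close>.\<close>

lemma count_fillable:
  assumes fW: "finite W" "W \<noteq> {}" and con: "connected_graph W"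
    and full: "\<And>z v. z \<in> W \<Longrightarrow> cor z v \<Longrightarrow> v \<notin> V1 \<Longrightarrow> v \<in> W"
    and eu: "2 * card (W \<inter> V3) + card (induced_edges W \<inter> E2) + 1 \<le> card W + card (V1_spokes W)"
  shows "fillable W"
proof (rule euler_fillable[OF fW con])
  have tc: "2 * card (V1_spokes W) \<le> card (TW W)" by (rule triangles_count[OF fW(1)]) (rule full)
  have "induced_edges W = (induced_edges W \<inter> E1) \<union> (induced_edges W \<inter> E2)" unfolding induced_edges_def by blast
  then have "card (induced_edges W) \<le> card (induced_edges W \<inter> E1) + card (induced_edges W \<inter> E2)"
    by (metis card_Un_le)
  then show "card (induced_edges W) + 1 \<le> card W + card (TW W)"
    using spokes_count[OF fW(1)] tc eu by linarith
qed

section \<open>The rectangles\<close>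

lemma near_edge: "x \<in> Z2 \<Longrightarrow> y \<in> Z2 \<Longrightarrow> fst x = fst y \<and> \<bar>snd x - snd y\<bar> = 1 \<or> snd x = snd y \<and> \<bar>fst x - fst y\<bar> = 1 \<Longrightarrow> {x,y} \<in> E2"
  using side_sq E2I by blast

lemma connected_to:
  assumes "\<And>v. v \<in> W \<Longrightarrow> (c, v) \<in> {(a, b). {a, b} \<in> induced_edges W}\<^sup>*"
  shows "connected_graph W"
  unfolding connected_graph_def
proof (intro ballI)
  fix u v assume uv: "u \<in> W" "v \<in> W"
  let ?R = "{(a, b). {a, b} \<in> induced_edges W}"
  have "sym ?R" by (rule symI) (simp add: insert_commute)
  then have "sym (?R\<^sup>*)" by (rule sym_rtrancl)
  then have "(u,c) \<in> ?R\<^sup>*" using assms[OF uv(1)] by (rule symD)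
  then show "(u,v) \<in> ?R\<^sup>*" using assms[OF uv(2)] by (rule rtrancl_trans)
qed

lemma nat_Z2: "(real i, real j) \<in> Z2"
  unfolding Z2_def by (metis (mono_tags, lifting) mem_Collect_eq of_int_of_nat_eq)

lemma nat_V3: "(real i + 1/2, real j + 1/2) \<in> V3"
  unfolding V3_def by (metis (mono_tags, lifting) mem_Collect_eq of_int_of_nat_eq)

lemma rect_parts:
  fixes m n :: nat
  defines "A \<equiv> (\<lambda>(i,j). (real i, real j)) ` ({..m} \<times> {..n})"
    and "B \<equiv> (\<lambda>(i,j). (real i + 1/2, real j + 1/2)) ` ({..<m} \<times> {..<n})"
  shows "rect_graph m n = A \<union> B" "A \<subseteq> Z2" "B \<subseteq> V3" "card A = (m + 1) * (n + 1)" "card B = m * n"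
    "finite (rect_graph m n)" "rect_graph m n \<inter> V3 = B" "rect_graph m n \<inter> Z2 = A"
    "card (rect_graph m n) = (m + 1) * (n + 1) + m * n"
proof -
  show W: "rect_graph m n = A \<union> B" unfolding rect_graph_def A_def B_def by (auto simp: image_iff)
  show A: "A \<subseteq> Z2" unfolding A_def using nat_Z2 by auto
  show B: "B \<subseteq> V3" unfolding B_def using nat_V3 by auto
  have "inj_on (\<lambda>(i,j). (real i, real j)) ({..m} \<times> {..n})" by (auto simp: inj_on_def)
  then show cA: "card A = (m + 1) * (n + 1)" unfolding A_def by (simp add: card_image card_cartesian_product)
  have "inj_on (\<lambda>(i,j). (real i + 1/2, real j + 1/2)) ({..<m} \<times> {..<n})" by (auto simp: inj_on_def)
  then show cB: "card B = m * n" unfolding B_def by (simp add: card_image card_cartesian_product)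
  have f: "finite A" "finite B" unfolding A_def B_def by simp_all
  then show "finite (rect_graph m n)" unfolding W by simp
  show "rect_graph m n \<inter> V3 = B" "rect_graph m n \<inter> Z2 = A"
    unfolding W using A B white_not_black by blast+
  have "A \<inter> B = {}" using A B white_not_black by blast
  then show "card (rect_graph m n) = (m + 1) * (n + 1) + m * n"
    unfolding W using card_Un_disjoint[OF f] cA cB by simp
qed

lemma rect_black: "i \<le> m \<Longrightarrow> j \<le> n \<Longrightarrow> (real i, real j) \<in> rect_graph m n"
  unfolding rect_graph_def by auto

lemma rect_white: "i < m \<Longrightarrow> j < n \<Longrightarrow> (real i + 1/2, real j + 1/2) \<in> rect_graph m n"
  unfolding rect_graph_def by auto

lemma rect_connected: "connected_graph (rect_graph m n)"
proof -
  let ?W = "rect_graph m n"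
  let ?R = "{(a, b). {a, b} \<in> induced_edges ?W}"
  have h: "((0,0),(real i, 0)) \<in> ?R\<^sup>*" if "i \<le> m" for i
    using that
  proof (induction i)
    case (Suc i)
    have "{(real i, real 0), (real (Suc i), real 0)} \<in> E2" by (rule near_edge[OF nat_Z2 nat_Z2]) simp
    then have "((real i, 0), (real (Suc i), 0)) \<in> ?R"
      unfolding induced_edges_def using rect_black[of i m 0 n] rect_black[of "Suc i" m 0 n] Suc.prems by simp
    then show ?case using Suc by (meson Suc_leD rtrancl.rtrancl_into_rtrancl)
  qed simp
  have b: "((0,0),(real i, real j)) \<in> ?R\<^sup>*" if "i \<le> m" "j \<le> n" for i j
    using that(2)
  proof (induction j)
    case 0
    then show ?case using h[OF that(1)] by simp
  next
    case (Suc j)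
    have "{(real i, real j), (real i, real (Suc j))} \<in> E2" by (rule near_edge[OF nat_Z2 nat_Z2]) simp
    then have "((real i, real j), (real i, real (Suc j))) \<in> ?R"
      unfolding induced_edges_def using rect_black[of i m j n] rect_black[of i m "Suc j" n] Suc.prems that(1) by simp
    then show ?case using Suc by (meson Suc_leD rtrancl.rtrancl_into_rtrancl)
  qed
  show ?thesis
  proof (rule connected_to[of _ "(0,0)"])
    fix v assume "v \<in> ?W"
    then consider i j where "v = (real i, real j)" "i \<le> m" "j \<le> n"
      | i j where "v = (real i + 1/2, real j + 1/2)" "i < m" "j < n" unfolding rect_graph_def by blast
    then show "((0,0),v) \<in> ?R\<^sup>*"
    proof cases
      case 1
      then show ?thesis using b by simp
    next
      case 2
      have "cor v (real i, real j)" unfolding cor_def 2(1) using nat_V3 by simp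
      then have "{v, (real i, real j)} \<in> E1" by (rule E1I)
      then have "((real i, real j), v) \<in> ?R"
        unfolding induced_edges_def using rect_black[of i m j n] rect_white[OF 2(2,3)] 2 by (simp add: insert_commute)
      then show ?thesis using b[of i j] 2 by (meson less_imp_le rtrancl.rtrancl_into_rtrancl)
    qed
  qed
qed

lemma rect_corner: assumes z: "z \<in> rect_graph m n" and c: "cor z v" shows "v \<in> rect_graph m n"
proof -
  have "z \<in> rect_graph m n \<inter> V3" using z cor_white[OF c] by blast
  then obtain i j where ij: "z = (real i + 1/2, real j + 1/2)" "i < m" "j < n" unfolding rect_parts(7) by auto
  have "fst v = real i \<or> fst v = real (Suc i)" "snd v = real j \<or> snd v = real (Suc j)"
    using c unfolding cor_def ij(1) abs_half_iff by auto
  then obtain a b where ab: "v = (real a, real b)" "a = i \<or> a = Suc i" "b = j \<or> b = Suc j"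
    by (metis prod.collapse)
  show ?thesis unfolding ab(1) by (rule rect_black) (use ab(2,3) ij(2,3) in auto)
qed

lemma rect_sides: "card (induced_edges (rect_graph m n) \<inter> E2) \<le> m * (n + 1) + (m + 1) * n"
proof -
  define H where "H = (\<lambda>(i,j). {(real i, real j), (real (Suc i), real j)}) ` ({..<m} \<times> {..n})"
  define V where "V = (\<lambda>(i,j). {(real i, real j), (real i, real (Suc j))}) ` ({..m} \<times> {..<n})"
  have "induced_edges (rect_graph m n) \<inter> E2 \<subseteq> H \<union> V"
  proof
    fix e assume e: "e \<in> induced_edges (rect_graph m n) \<inter> E2"
    then have "e \<in> E2" by blast
    then obtain z x y where xy: "e = {x,y}" "sq z x y" by (rule E2E)
    have "x \<in> rect_graph m n \<inter> Z2" "y \<in> rect_graph m n \<inter> Z2"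
      using e xy sqD(5,6)[OF xy(2)] unfolding induced_edges_def by auto
    then obtain i j i' j' where x: "x = (real i, real j)" "i \<le> m" "j \<le> n" and y: "y = (real i', real j')" "i' \<le> m" "j' \<le> n"
      unfolding rect_parts(8) by auto
    have "fst x = fst y \<and> \<bar>snd x - snd y\<bar> = 1 \<or> snd x = snd y \<and> \<bar>fst x - fst y\<bar> = 1"
      using xy(2) unfolding sq_iff by blast
    then consider "i = i'" "j' = Suc j" | "i = i'" "j = Suc j'" | "j = j'" "i' = Suc i" | "j = j'" "i = Suc i'"
      unfolding x y by (auto simp: abs_if split: if_splits)
    then show "e \<in> H \<union> V"
    proof cases
      case 1
      then have "e \<in> V" unfolding V_def xy(1) x(1) y(1) using x y by (intro image_eqI[of _ _ "(i,j)"]) auto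
      then show ?thesis ..
    next
      case 2
      then have "e \<in> V" unfolding V_def xy(1) x(1) y(1) using x y by (intro image_eqI[of _ _ "(i,j')"]) auto
      then show ?thesis ..
    next
      case 3
      then have "e \<in> H" unfolding H_def xy(1) x(1) y(1) using x y by (intro image_eqI[of _ _ "(i,j)"]) auto
      then show ?thesis ..
    next
      case 4
      then have "e \<in> H" unfolding H_def xy(1) x(1) y(1) using x y by (intro image_eqI[of _ _ "(i',j)"]) auto
      then show ?thesis ..
    qed
  qed
  moreover have fin: "finite H" "finite V" unfolding H_def V_def by simp_all
  ultimately have "card (induced_edges (rect_graph m n) \<inter> E2) \<le> card (H \<union> V)" by (intro card_mono) auto
  also have "\<dots> \<le> card H + card V" by (rule card_Un_le)
  also have "card H \<le> card ({..<m} \<times> {..n})" unfolding H_def by (rule card_image_le) simp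
  also have "card V \<le> card ({..m} \<times> {..<n})" unfolding V_def by (rule card_image_le) simp
  finally show ?thesis by (simp add: card_cartesian_product)
qed

text \<open>With the bound on the number of sides, both sides of the required inequality come to
  \<open>4 * m * n + m + n + 1\<close>.\<close>

lemma rect_fillable: "fillable (rect_graph m n)"
proof (rule count_fillable[OF rect_parts(6) _ rect_connected])
  let ?W = "rect_graph m n"
  have "(real 0, real 0) \<in> ?W" by (rule rect_black) auto
  then show "?W \<noteq> {}" by blast
  show "v \<in> ?W" if "z \<in> ?W" "cor z v" "v \<notin> V1" for z v using rect_corner that by blast
  have "V1_spokes ?W = (SIGMA z:?W \<inter> V3. {v. cor z v \<and> v \<in> V1})"
    unfolding V1_spokes_def using rect_corner cor_white by (auto simp: Sigma_def)
  moreover have "card (SIGMA z:?W \<inter> V3. {v. cor z v \<and> v \<in> V1}) = (\<Sum>z\<in>?W \<inter> V3. card {v. cor z v \<and> v \<in> V1})"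
  proof (rule card_SigmaI)
    show "finite (?W \<inter> V3)" using rect_parts(6) by simp
    show "\<forall>z\<in>?W \<inter> V3. finite {v. cor z v \<and> v \<in> V1}"
      using corner_classes(1) by (auto intro!: card_ge_0_finite)
  qed
  moreover have "\<dots> = 2 * card (?W \<inter> V3)" using corner_classes(1) by simp
  ultimately have "card (V1_spokes ?W) = 2 * (m * n)" using rect_parts(5,7) by simp
  moreover have "card (?W \<inter> V3) = m * n" using rect_parts(5,7) by simp
  ultimately show "2 * card (?W \<inter> V3) + card (induced_edges ?W \<inter> E2) + 1 \<le> card ?W + card (V1_spokes ?W)"
    using rect_sides[of m n] rect_parts(9)[of m n] by (simp add: algebra_simps)
qed

lemma rect_impurities:
  assumes "odd (m + n)" "dimer_covering (rect_graph m n) M"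
  shows "card (impurities M) = (m + n + 1) div 2"
  using cov_count[OF rect_parts(6) assms(2)] rect_parts(5,7,9)[of m n] by (simp add: algebra_simps)

section \<open>The compositions of basic blocks\<close>

lemma white_nbrs: assumes "v \<in> Z2"
  shows "{z. cor z v} = {v + (1/2, 1/2), v - (1/2, 1/2), v + (1/2, -1/2), v - (1/2, -1/2)}"
proof -
  have "{z. cor z v} = (\<lambda>p. v + p) ` diag"
  proof (rule set_eqI)
    fix z
    have "z \<in> (\<lambda>p. v + p) ` diag \<longleftrightarrow> z - v \<in> diag" by force
    then show "z \<in> {z. cor z v} \<longleftrightarrow> z \<in> (\<lambda>p. v + p) ` diag"
      using assms by (simp add: cor_iff diag_iff abs_minus_commute)
  qed
  moreover have "v - (1/2, 1/2) = v + (-1/2, -1/2)" "v - (1/2, -1/2) = v + (-1/2, 1/2)"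
    by (simp_all add: prod_eq_iff)
  ultimately show ?thesis unfolding diag_def by (simp only: image_insert image_empty insert_commute)
qed

lemma black_nbrs: assumes v: "v \<in> Z2"
  shows "{w. \<exists>z. sq z v w} = {v + (1, 0), v - (1, 0), v + (0, 1), v - (0, 1)}"
proof (intro equalityI subsetI)
  fix w assume "w \<in> {w. \<exists>z. sq z v w}"
  then have "fst v = fst w \<and> \<bar>snd v - snd w\<bar> = 1 \<or> snd v = snd w \<and> \<bar>fst v - fst w\<bar> = 1"
    unfolding sq_iff by blast
  then show "w \<in> {v + (1, 0), v - (1, 0), v + (0, 1), v - (0, 1)}"
    by (auto simp: prod_eq_iff abs_if split: if_splits)
next
  fix w assume w: "w \<in> {v + (1, 0), v - (1, 0), v + (0, 1), v - (0, 1)}"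
  obtain a b :: int where ab: "v = (of_int a, of_int b)" using v unfolding Z2_def by auto
  have "w = (of_int (a + 1), of_int b) \<or> w = (of_int (a - 1), of_int b) \<or>
     w = (of_int a, of_int (b + 1)) \<or> w = (of_int a, of_int (b - 1))" using w unfolding ab by auto
  then have "w \<in> Z2" unfolding Z2_def by blast
  moreover have "fst v = fst w \<and> \<bar>snd v - snd w\<bar> = 1 \<or> snd v = snd w \<and> \<bar>fst v - fst w\<bar> = 1"
    using w by auto
  ultimately show "w \<in> {w. \<exists>z. sq z v w}" using side_sq[OF v] by blast
qed

lemma block_eq: assumes "v \<in> Z2" shows "basic_block v = {v} \<union> {w. \<exists>z. sq z v w} \<union> {z. cor z v}"
  unfolding white_nbrs[OF assms] black_nbrs[OF assms] basic_block_def by auto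

text \<open>A block contributes four spokes at its centre and at most four sides, a terminal at
  least one spoke and at most two sides. With the vertex count from a dimer covering, Euler's
  inequality becomes \<open>card T + 1 \<le> 2 * k\<close>, which is an equality for
  \<open>2 * k - 1\<close> terminals.\<close>

lemma block_fillable:
  assumes k: "k \<ge> 1" and bg: "block_graph k W" and M: "dimer_covering W M"
  shows "finite W" "fillable W"
proof -
  obtain B T where B: "finite B" "B \<subseteq> V1" and T: "finite T" "T \<subseteq> V1 - B" "card T = 2 * k - 1"
    and W: "W = (\<Union>v\<in>B. basic_block v) \<union> T" and con: "connected_graph W"
    and att: "\<forall>t\<in>T. attached_terminal W t" and imp: "\<forall>M. dimer_covering W M \<longrightarrow> card (impurities M) = k"
    using bg unfolding block_graph_def by blast
  have BZ: "v \<in> Z2" if "v \<in> B \<union> T" for v using that B T V1_Z2 by blast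
  show fW: "finite W" unfolding W using B T by (simp add: basic_block_def)
  have BW: "basic_block v \<subseteq> W" if "v \<in> B" for v using that unfolding W by blast
  \<comment> \<open>The centre is the only vertex of a block in \<open>V1\<close>. Hence every side
    has exactly one end among the centres and terminals and can be counted there.\<close>
  have WV1: "v \<in> B \<union> T" if "v \<in> W" "v \<in> V1" for v
  proof (rule ccontr)
    assume n: "v \<notin> B \<union> T"
    then obtain u where u: "u \<in> B" "v \<in> basic_block u" "v \<noteq> u" using \<open>v \<in> W\<close> unfolding W by blast
    then have "(\<exists>z. sq z u v) \<or> cor v u" using block_eq[of u] BZ by blast
    then show False
    proof
      assume "\<exists>z. sq z u v"
      then show False using sq_V1 that(2) u(1) B(2) by blast
    next
      assume "cor v u"
      then show False using cor_white white_not_black that(2) V1_Z2 by blast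
    qed
  qed
  \<comment> \<open>A white vertex comes from a block, whose centre is one of its corners in
    \<open>V1\<close>. Its corners outside \<open>V1\<close> are adjacent to that centre and so
    belong to the same block.\<close>
  have full: "v \<in> W" if z: "z \<in> W" and c: "cor z v" and v: "v \<notin> V1" for z v
  proof -
    have zV: "z \<in> V3" using cor_white[OF c] .
    have zZ: "z \<notin> Z2" using zV white_not_black by blast
    then obtain u where u: "u \<in> B" "z \<in> basic_block u" using z BZ unfolding W by blast
    have uZ: "u \<in> Z2" using BZ u by blast
    have "\<not> (\<exists>y. sq y u z)" using sqD(6) zZ by blast
    then have zu: "cor z u" using u(2) uZ zZ unfolding block_eq[OF uZ] by blast
    have u1: "u \<in> V1" using u(1) B(2) by blast
    have "sq z u v" unfolding sq_def using zu c v u1 opp_V1[OF zu] by blast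
    then have "v \<in> basic_block u" unfolding block_eq[OF uZ] by blast
    then show ?thesis using BW[OF u(1)] by blast
  qed
  have BT: "B \<inter> T = {}" using T by blast
  have fBT: "finite (B \<union> T)" using B T by simp
  have sumBT: "(\<Sum>v\<in>B \<union> T. g v) = (\<Sum>v\<in>B. g v) + (\<Sum>v\<in>T. g v)" for g :: "point \<Rightarrow> nat"
    by (rule sum.union_disjoint[OF B(1) T(1) BT])
  have trm: "\<exists>z\<in>W. cor z t \<and> (\<forall>w. {t,w} \<in> induced_edges W \<longrightarrow> w = z \<or> {w,z} \<in> induced_edges W)" if t: "t \<in> T" for t
  proof -
    obtain z where z: "{s \<in> V3. {t, s} \<in> induced_edges W} = {z}"
       "\<forall>w. {t, w} \<in> induced_edges W \<longrightarrow> w = z \<or> {w, z} \<in> induced_edges W"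
      using att t unfolding attached_terminal_def by blast
    have "z \<in> {s \<in> V3. {t, s} \<in> induced_edges W}" unfolding z(1) by simp
    then have zt: "z \<in> V3" "{t,z} \<in> induced_edges W" by simp_all
    then have "{z,t} \<in> E1 \<union> E2" "z \<in> W" unfolding induced_edges_def by (auto simp: insert_commute)
    then show ?thesis using white_edge zt(1) z(2) by blast
  qed
  have spk: "4 * card B + card T \<le> card (V1_spokes W)"
  proof -
    define J where "J = (SIGMA v:B \<union> T. {z \<in> W. cor z v})"
    have "card J = (\<Sum>v\<in>B \<union> T. card {z \<in> W. cor z v})"
      unfolding J_def by (rule card_SigmaI) (use fBT fW in auto)
    also have "\<dots> = (\<Sum>v\<in>B. card {z \<in> W. cor z v}) + (\<Sum>v\<in>T. card {z \<in> W. cor z v})" by (rule sumBT)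
    also have "\<dots> \<ge> (\<Sum>v\<in>B. 4) + (\<Sum>v\<in>T. 1)"
    proof (intro add_mono sum_mono)
      fix v assume v: "v \<in> B"
      have vZ: "v \<in> Z2" using BZ v by blast
      have "{z \<in> W. cor z v} = {z. cor z v}" using BW[OF v] unfolding block_eq[OF vZ] by blast
      then show "4 \<le> card {z \<in> W. cor z v}" using white_card[OF vZ] by simp
    next
      fix t assume "t \<in> T"
      then have "{z \<in> W. cor z t} \<noteq> {}" using trm by blast
      then show "1 \<le> card {z \<in> W. cor z t}" using fW by (simp add: Suc_le_eq card_gt_0_iff)
    qed
    finally have le: "4 * card B + card T \<le> card J" by simp
    have sub: "prod.swap ` J \<subseteq> V1_spokes W"
    proof
      fix q assume "q \<in> prod.swap ` J"
      then obtain v z where q: "q = (z,v)" "v \<in> B \<union> T" "z \<in> W" "cor z v" unfolding J_def by auto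
      have "v \<in> V1" using q(2) B T by blast
      moreover have "v \<in> W"
      proof (cases "v \<in> B")
        case True
        then show ?thesis using BW[OF True] unfolding basic_block_def by blast
      next
        case False
        then show ?thesis using q(2) unfolding W by blast
      qed
      ultimately show "q \<in> V1_spokes W" unfolding V1_spokes_def q(1) using q by simp
    qed
    have fV: "finite (V1_spokes W)" by (rule finite_subset[of _ "W \<times> W"]) (use fW in \<open>auto simp: V1_spokes_def\<close>)
    have "card (prod.swap ` J) = card J" by (rule card_image) (auto simp: inj_on_def)
    then show ?thesis using le card_mono[OF fV sub] by simp
  qed
  have sides: "card (induced_edges W \<inter> E2) \<le> 4 * card B + 2 * card T"
  proof -
    let ?S = "\<lambda>v. {e \<in> induced_edges W \<inter> E2. v \<in> e}"
    have nb: "?S v \<subseteq> (\<lambda>w. {v,w}) ` {w. {v,w} \<in> induced_edges W \<inter> E2}" for v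
    proof
      fix e assume e: "e \<in> ?S v"
      then obtain w where "e = {v,w}" using edge_card[of e] by blast
      then show "e \<in> (\<lambda>w. {v,w}) ` {w. {v,w} \<in> induced_edges W \<inter> E2}" using e by blast
    qed
    have side: "\<exists>z. sq z v w" if "{v,w} \<in> E2" for v w
      using E2E[OF that] by (metis doubleton_eq_iff sq_sym)
    have "induced_edges W \<inter> E2 \<subseteq> (\<Union>v\<in>B \<union> T. ?S v)"
    proof
      fix e assume e: "e \<in> induced_edges W \<inter> E2"
      then have "e \<in> E2" by blast
      then obtain z x y where xy: "e = {x,y}" "sq z x y" by (rule E2E)
      have "x \<in> W" "y \<in> W" using e xy(1) unfolding induced_edges_def by auto
      then have "x \<in> B \<union> T \<or> y \<in> B \<union> T" using WV1 sq_V1[OF xy(2)] by blast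
      then show "e \<in> (\<Union>v\<in>B \<union> T. ?S v)" using e xy(1) by blast
    qed
    moreover have "finite (\<Union>v\<in>B \<union> T. ?S v)" using fBT induced_finite[OF fW] by simp
    ultimately have "card (induced_edges W \<inter> E2) \<le> card (\<Union>v\<in>B \<union> T. ?S v)" by (intro card_mono)
    also have "\<dots> \<le> (\<Sum>v\<in>B \<union> T. card (?S v))" by (rule card_UN_le[OF fBT])
    also have "\<dots> = (\<Sum>v\<in>B. card (?S v)) + (\<Sum>v\<in>T. card (?S v))" by (rule sumBT)
    also have "\<dots> \<le> (\<Sum>v\<in>B. 4) + (\<Sum>v\<in>T. 2)"
    proof (intro add_mono sum_mono)
      fix v assume v: "v \<in> B"
      have vZ: "v \<in> Z2" using BZ v by blast
      have "{w. {v,w} \<in> induced_edges W \<inter> E2} \<subseteq> {w. \<exists>z. sq z v w}"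
        using side[of v] by (intro Collect_mono impI) blast
      then have "?S v \<subseteq> (\<lambda>w. {v,w}) ` {w. \<exists>z. sq z v w}" by (rule order_trans[OF nb image_mono])
      moreover have "finite {w. \<exists>z. sq z v w}" unfolding black_nbrs[OF vZ] by simp
      ultimately have "card (?S v) \<le> card {w. \<exists>z. sq z v w}" using surj_card_le by blast
      also have "\<dots> \<le> 4" unfolding black_nbrs[OF vZ] by (simp add: card_insert_if)
      finally show "card (?S v) \<le> 4" .
    next
      fix t assume t: "t \<in> T"
      obtain z where z: "z \<in> W" "cor z t" "\<forall>w. {t,w} \<in> induced_edges W \<longrightarrow> w = z \<or> {w,z} \<in> induced_edges W"
        using trm[OF t] by blast
      have zV: "z \<in> V3" using cor_white[OF z(2)] .
      \<comment> \<open>Attachment places the black neighbours of \<open>t\<close> among the corners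
        of \<open>z\<close>, and being adjacent to \<open>t\<close> they are the two corners outside
        \<open>V1\<close> at most.\<close>
      have "?S t \<subseteq> (\<lambda>w. {t,w}) ` {w. cor z w \<and> w \<notin> V1}"
      proof
        fix e assume "e \<in> ?S t"
        then have "e \<in> (\<lambda>w. {t,w}) ` {w. {t,w} \<in> induced_edges W \<inter> E2}" by (rule subsetD[OF nb])
        then obtain w where w: "e = {t,w}" "{t,w} \<in> induced_edges W" "{t,w} \<in> E2" by auto
        have "w \<in> Z2" using E2_black[OF w(3)] by simp
        then have "w \<noteq> z" using zV white_not_black by blast
        then have "{w,z} \<in> induced_edges W" using z(3) w(2) by blast
        then have "{z,w} \<in> E1 \<union> E2" unfolding induced_edges_def by (simp add: insert_commute)
        then have "cor z w" using white_edge zV by blast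
        moreover have "w \<notin> V1" using side[OF w(3)] sq_V1 t T(2) by blast
        ultimately show "e \<in> (\<lambda>w. {t,w}) ` {w. cor z w \<and> w \<notin> V1}" using w(1) by blast
      qed
      moreover have "finite {w. cor z w \<and> w \<notin> V1}" by (rule card_ge_0_finite) (simp add: corner_classes(2)[OF zV])
      ultimately have "card (?S t) \<le> card {w. cor z w \<and> w \<notin> V1}" using surj_card_le by blast
      then show "card (?S t) \<le> 2" using corner_classes(2)[OF zV] by simp
    qed
    finally show ?thesis by simp
  qed
  have cW: "card W = 2 * card (W \<inter> V3) + 2 * k" using cov_count[OF fW M] imp M by simp
  have "card T \<ge> 1" using T(3) k by simp
  then have "T \<noteq> {}" by auto
  then have "W \<noteq> {}" unfolding W by blast
  then show "fillable W"
  proof (rule count_fillable[OF fW _ con])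
    show "2 * card (W \<inter> V3) + card (induced_edges W \<inter> E2) + 1 \<le> card W + card (V1_spokes W)"
      using spk sides cW T(3) k by linarith
  qed (rule full)
qed

theorem theorem3:
  shows "\<exists>C::real. \<forall>(W :: point set) (k :: nat).
    ((\<exists>m n. odd (m + n) \<and> k = (m + n + 1) div 2 \<and> W = rect_graph m n) \<or>
     (k \<ge> 1 \<and> block_graph k W)) \<longrightarrow>
    (\<forall>M M'. dimer_covering W M \<longrightarrow> dimer_covering W M' \<longrightarrow>
      (\<exists>s::nat. (M, M') \<in> local_move W ^^ s \<and>
         real s \<le> C * (real k)\<^sup>2 * real (card W) powr (3/2)))"
proof (rule exI[of _ 48], intro allI impI)
  fix W k M M'
  assume h: "(\<exists>m n. odd (m + n) \<and> k = (m + n + 1) div 2 \<and> W = rect_graph m n) \<or> (k \<ge> 1 \<and> block_graph k W)"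
    and M: "dimer_covering W M" "dimer_covering W M'"
  have "finite W \<and> fillable W \<and> k \<ge> 1 \<and> (\<forall>M. dimer_covering W M \<longrightarrow> card (impurities M) \<le> k)"
    using h
  proof
    assume "\<exists>m n. odd (m + n) \<and> k = (m + n + 1) div 2 \<and> W = rect_graph m n"
    then obtain m n where mn: "odd (m + n)" "k = (m + n + 1) div 2" "W = rect_graph m n" by blast
    have "m + n \<noteq> 0" using mn(1) by (metis even_zero)
    then have "k \<ge> 1" unfolding mn(2) by linarith
    then show ?thesis using rect_parts(6) rect_fillable rect_impurities[OF mn(1)] unfolding mn(2,3) by simp
  next
    assume b: "k \<ge> 1 \<and> block_graph k W"
    then have "\<forall>M. dimer_covering W M \<longrightarrow> card (impurities M) = k" unfolding block_graph_def by blast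
    then show ?thesis using block_fillable[of k W M] b M(1) by simp
  qed
  then show "\<exists>s. (M, M') \<in> local_move W ^^ s \<and> real s \<le> 48 * (real k)\<^sup>2 * real (card W) powr (3/2)"
    using connected_coverings[of W k M M'] M by blast
qed

end
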